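(* Let $W\in L^2(I^2)$ be nonnegative and satisfy (W-1) and (W-2), let $g\in L^2(I)$, let $0<\gamma<\tfrac12$ and $\alpha_n=n^{-\gamma}$. For each $n$ let $u_n(t)=(u_{n,1}(t),\dots,u_{n,n}(t))$ be the solution of the Kuramoto-type system on the sparse random directed graph $\Gamma_n=G_d(n,W,n^{-\gamma})$, $$\dot u_{n,i}=f(u_{n,i},t)+\frac{1}{n\alpha_n}\sum_{j=1}^n a_{n,ij}\,D(u_{n,j}-u_{n,i}),\qquad u_{n,i}(0)=n\int_{I_{n,i}}g(x)\,dx,\qquad i\in[n],$$ and let $\mathbf u_n(t)=\sum_{i=1}^n u_{n,i}(t)\mathbf 1_{I_{n,i}}\in L^2(I)$. Let $\mathbf u$ be the weak solution of the initial value problem $$\partial_t u(t,x)=f(u(t,x),t)+\int_I W(x,y)D\big(u(t,y)-u(t,x)\big)\,dy,\qquad u(0,x)=g(x),\qquad x\in I.$$ Then for any $T>0$, $$\lim_{n\to\infty}\|\mathbf u_n-\mathbf u\|_{C(0,T;L^2(I))}=0\quad\text{almost surely},$$ where $\|\mathbf w\|_{C(0,T;L^2(I))}=\max_{t\in[0,T]}\|\mathbf w(t)\|_{L^2(I)}$.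
   Context: $I=[0,1]$, $[n]=\{1,\dots,n\}$, $I_{n,i}=((i-1)/n,\,i/n]$. For an integrable function, $\langle V\rangle_{I_{n,i}\times I_{n,j}}=n^2\int_{I_{n,i}\times I_{n,j}}V(x,y)\,dx\,dy$. $a\wedge b=\min\{a,b\}$. Nonlinearities: $D:\mathbb R\to\mathbb R$ is $2\pi$-periodic and Lipschitz continuous with $\max|D|=1$. $f:\mathbb R\times\mathbb R\to\mathbb R$, $(u,t)\mapsto f(u,t)$, is Lipschitz continuous in $u$ (with constant independent of $t$) and continuous in $t$. Phases are treated as real-valued. Conditions on $W$: with $W_n(x,y)=\sum_{i,j=1}^n\langle W\rangle_{I_{n,i}\times I_{n,j}}\mathbf 1_{I_{n,i}\times I_{n,j}}(x,y)$, (W-1) $\sup_{n\in\mathbb N}\sup_{y\in I}\int_0^1W_n(x,y)\,dx=:W_1<\infty$; (W-2) $\sup_{n\in\mathbb N}\sup_{x\in I}\int_0^1W_n(x,y)\,dy=:W_2<\infty$. Random graph $G_d(n,W,\alpha_n)$: the adjacency entries $a_{n,ij}$, $(i,j)\in[n]^2$, are independent Bernoulli random variables with $\mathbb P(a_{n,ij}=1)=\alpha_n\langle\tilde W_n\rangle_{I_{n,i}\times I_{n,j}}$, where $\tilde W_n(x,y)=\alpha_n^{-1}\wedge W(x,y)$. (The event $a_{n,ij}=1$ means there is an edge $j\to i$; loops are allowed.) The graphs for all $n$ are defined on one probability space. Weak solution: with $X=L^2(I)$ and inner product $(\cdot,\cdot)$, and $K(u)(x)=\int_IW(x,y)D(u(y)-u(x))\,dy$,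 a function $\mathbf u\in H^1(0,T;X)$ is a weak solution on $[0,T]$ if $(\mathbf u'(t)-K(\mathbf u(t))-f(\mathbf u(t),t),\mathbf v)=0$ for all $\mathbf v\in X$ for a.e. $t\in[0,T]$, and $\mathbf u(0)=g$ (continuous representative). *)

theory Defs
  imports "HOL-Probability.Probability"
begin

section \<open>Square-integrable functions and the Hilbert space of classes on the unit interval\<close>

definition sq_integrable :: "'a measure \<Rightarrow> ('a \<Rightarrow> real) \<Rightarrow> bool" where
  "sq_integrable M f \<longleftrightarrow> f \<in> borel_measurable M \<and> integrable M (\<lambda>x. (f x)\<^sup>2)"

abbreviation lebI :: "real measure" where
  "lebI \<equiv> lebesgue_on {0..1}"

lemma sq_integrable_measurable [measurable_dest]:
  "sq_integrable M f \<Longrightarrow> f \<in> borel_measurable M"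
  by (simp add: sq_integrable_def)

lemma sq_integrable_mult:
  assumes "sq_integrable M f" "sq_integrable M g"
  shows "integrable M (\<lambda>x. f x * g x)"
proof (rule Bochner_Integration.integrable_bound)
  show "integrable M (\<lambda>x. (f x)\<^sup>2 + (g x)\<^sup>2)"
    using assms by (simp add: sq_integrable_def)
  show "(\<lambda>x. f x * g x) \<in> borel_measurable M"
    using assms by measurable
  have "\<bar>a * b\<bar> \<le> a\<^sup>2 + b\<^sup>2" for a b :: real
  proof -
    have "2 * (\<bar>a\<bar> * \<bar>b\<bar>) \<le> a\<^sup>2 + b\<^sup>2"
      using sum_squares_bound[of "\<bar>a\<bar>" "\<bar>b\<bar>"] by (simp add: algebra_simps)
    moreover have "0 \<le> \<bar>a\<bar> * \<bar>b\<bar>" by simp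
    ultimately show ?thesis unfolding abs_mult by linarith
  qed
  then show "AE x in M. norm (f x * g x) \<le> norm ((f x)\<^sup>2 + (g x)\<^sup>2)"
    by (intro AE_I2) simp
qed

lemma sq_integrable_add:
  assumes "sq_integrable M f" "sq_integrable M g"
  shows "sq_integrable M (\<lambda>x. f x + g x)"
  using assms sq_integrable_mult[OF assms]
  unfolding sq_integrable_def power2_sum by (auto simp: mult.assoc)

lemma sq_integrable_scale:
  "sq_integrable M f \<Longrightarrow> sq_integrable M (\<lambda>x. c * f x)"
  by (auto simp: sq_integrable_def power_mult_distrib)

lemma sq_integrable_minus:
  "sq_integrable M f \<Longrightarrow> sq_integrable M (\<lambda>x. - f x)"
  by (auto simp: sq_integrable_def)

lemma sq_integrable_diff:
  "sq_integrable M f \<Longrightarrow> sq_integrable M g \<Longrightarrow> sq_integrable M (\<lambda>x. f x - g x)"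
  using sq_integrable_add[of M f "\<lambda>x. - g x"] sq_integrable_minus[of M g] by simp

lemma sq_integrable_zero: "sq_integrable M (\<lambda>x. 0)"
  by (simp add: sq_integrable_def)

lemma sq_integrable_abs:
  "sq_integrable M f \<Longrightarrow> sq_integrable M (\<lambda>x. \<bar>f x\<bar>)"
  by (auto simp: sq_integrable_def)

lemma finite_measure_lebI: "finite_measure lebI"
  by (rule finite_measure_lebesgue_on) simp

lemma measure_lebI: "measure lebI (space lebI) = 1"
  by (simp add: measure_restrict_space)

lemma sq_integrable_bounded:
  assumes "f \<in> borel_measurable lebI" "\<And>x. x \<in> {0..1} \<Longrightarrow> \<bar>f x\<bar> \<le> B"
  shows "sq_integrable lebI f"
proof -
  interpret finite_measure lebI by (rule finite_measure_lebI)
  have "integrable lebI (\<lambda>x. (f x)\<^sup>2)"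
    using assms by (intro integrable_const_bound[where B="B\<^sup>2"] AE_I2)
      (auto simp: abs_le_square_iff[symmetric] intro: order_trans[OF assms(2) abs_ge_self])
  with assms show ?thesis by (simp add: sq_integrable_def)
qed

quotient_type L2 = "real \<Rightarrow> real" /
  partial: "\<lambda>f g. sq_integrable lebI f \<and> sq_integrable lebI g \<and> (AE x in lebI. f x = g x)"
proof (rule part_equivpI)
  show "\<exists>f. sq_integrable lebI f \<and> sq_integrable lebI f \<and> (AE x in lebI. f x = f x)"
    using sq_integrable_zero[of lebI] by auto
  show "symp (\<lambda>f g. sq_integrable lebI f \<and> sq_integrable lebI g \<and> (AE x in lebI. f x = g x))"
    by (auto intro!: sympI)
  show "transp (\<lambda>f g. sq_integrable lebI f \<and> sq_integrable lebI g \<and> (AE x in lebI. f x = g x))"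
  proof (rule transpI, elim conjE, intro conjI)
    fix f g h :: "real \<Rightarrow> real"
    assume "AE x in lebI. f x = g x" "AE x in lebI. g x = h x"
    then show "AE x in lebI. f x = h x" by eventually_elim simp
  qed
qed

instantiation L2 :: real_inner
begin

lift_definition zero_L2 :: L2 is "\<lambda>x. 0"
  by (simp add: sq_integrable_zero)

lift_definition plus_L2 :: "L2 \<Rightarrow> L2 \<Rightarrow> L2" is "\<lambda>f g x. f x + g x"
  by (auto simp: sq_integrable_add)

lift_definition minus_L2 :: "L2 \<Rightarrow> L2 \<Rightarrow> L2" is "\<lambda>f g x. f x - g x"
  by (auto simp: sq_integrable_diff)

lift_definition uminus_L2 :: "L2 \<Rightarrow> L2" is "\<lambda>f x. - f x"
  by (auto simp: sq_integrable_minus)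

lift_definition scaleR_L2 :: "real \<Rightarrow> L2 \<Rightarrow> L2" is "\<lambda>c f x. c * f x"
  by (auto simp: sq_integrable_scale)

lift_definition inner_L2 :: "L2 \<Rightarrow> L2 \<Rightarrow> real" is "\<lambda>f g. LINT x|lebI. f x * g x"
proof (elim conjE)
  fix f f' g g' :: "real \<Rightarrow> real"
  assume *: "sq_integrable lebI f" "sq_integrable lebI f'" "sq_integrable lebI g" "sq_integrable lebI g'"
    and "AE x in lebI. f x = f' x" "AE x in lebI. g x = g' x"
  then have ae: "AE x in lebI. f x * g x = f' x * g' x" by auto
  show "(LINT x|lebI. f x * g x) = (LINT x|lebI. f' x * g' x)"
    using *[THEN sq_integrable_measurable] by (intro integral_cong_AE ae) auto
qed

definition norm_L2 :: "L2 \<Rightarrow> real" where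
  "norm_L2 u = sqrt (u \<bullet> u)"

definition dist_L2 :: "L2 \<Rightarrow> L2 \<Rightarrow> real" where
  "dist_L2 u v = norm (u - v)"

definition sgn_L2 :: "L2 \<Rightarrow> L2" where
  "sgn_L2 u = scaleR (inverse (norm u)) u"

definition uniformity_L2 :: "(L2 \<times> L2) filter" where
  "uniformity_L2 = (INF e\<in>{0<..}. principal {(u, v). dist u v < e})"

definition open_L2 :: "L2 set \<Rightarrow> bool" where
  "open_L2 U \<longleftrightarrow> (\<forall>u\<in>U. eventually (\<lambda>(u', v). u' = u \<longrightarrow> v \<in> U) uniformity)"

instance
proof
  fix u v w :: L2 and c d :: real and U :: "L2 set"
  show "u + v + w = u + (v + w)"
    by transfer (auto simp: sq_integrable_add add.assoc)
  show "u + v = v + u"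
    by transfer (auto simp: sq_integrable_add add.commute)
  show "0 + u = u"
    by transfer simp
  show "- u + u = 0"
    by transfer (simp add: sq_integrable_zero)
  show "u - v = u + - v"
    by transfer (auto simp: sq_integrable_diff)
  show "c *\<^sub>R (u + v) = c *\<^sub>R u + c *\<^sub>R v"
    by transfer (auto simp: sq_integrable_add sq_integrable_scale distrib_left)
  show "(c + d) *\<^sub>R u = c *\<^sub>R u + d *\<^sub>R u"
    by transfer (auto simp: sq_integrable_add sq_integrable_scale distrib_right)
  show "c *\<^sub>R d *\<^sub>R u = (c * d) *\<^sub>R u"
    by transfer (auto simp: sq_integrable_scale mult.assoc)
  show "1 *\<^sub>R u = u"
    by transfer simp
  show "u \<bullet> v = v \<bullet> u"
    by transfer (simp add: mult.commute)
  show "(u + v) \<bullet> w = u \<bullet> w + v \<bullet> w"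
    by transfer (simp add: distrib_right Bochner_Integration.integral_add sq_integrable_mult)
  show "(c *\<^sub>R u) \<bullet> v = c * (u \<bullet> v)"
    by transfer (simp add: mult.assoc)
  show "0 \<le> u \<bullet> u"
    by transfer simp
  show "u \<bullet> u = 0 \<longleftrightarrow> u = 0"
    by transfer (simp add: integral_nonneg_eq_0_iff_AE sq_integrable_mult sq_integrable_zero)
qed (auto simp: norm_L2_def dist_L2_def sgn_L2_def uniformity_L2_def open_L2_def)

end

lemma sq_integrable_rep: "sq_integrable lebI (rep_L2 u)"
  using Quotient3_rep_reflp[OF Quotient3_L2] by auto

lemma abs_rep_L2: "abs_L2 (rep_L2 u) = u"
  by (rule Quotient3_abs_rep[OF Quotient3_L2])

lemma rep_abs_L2:
  "sq_integrable lebI f \<Longrightarrow> AE x in lebI. rep_L2 (abs_L2 f) x = f x"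
  using rep_abs_rsp_left[OF Quotient3_L2, of f f] by simp

lemma minus_abs_L2:
  "sq_integrable lebI f \<Longrightarrow> sq_integrable lebI g \<Longrightarrow>
    abs_L2 f - abs_L2 g = abs_L2 (\<lambda>x. f x - g x)"
  by (simp add: minus_L2.abs_eq)

lemma inner_abs_L2:
  "sq_integrable lebI f \<Longrightarrow> sq_integrable lebI g \<Longrightarrow>
    abs_L2 f \<bullet> abs_L2 g = (LINT x|lebI. f x * g x)"
  by (simp add: inner_L2.abs_eq)

lemma norm_abs_L2:
  "sq_integrable lebI f \<Longrightarrow> norm (abs_L2 f) = sqrt (LINT x|lebI. (f x)\<^sup>2)"
  by (simp add: norm_eq_sqrt_inner inner_abs_L2 power2_eq_square)

lemma dist_abs_L2:
  "sq_integrable lebI f \<Longrightarrow> sq_integrable lebI g \<Longrightarrow>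
    dist (abs_L2 f) (abs_L2 g) = sqrt (LINT x|lebI. (f x - g x)\<^sup>2)"
  by (simp add: dist_norm minus_abs_L2 norm_abs_L2 sq_integrable_diff)

lemma L1_le_norm_L2:
  assumes f: "sq_integrable lebI f"
  shows "integrable lebI f" "(LINT x|lebI. \<bar>f x\<bar>) \<le> norm (abs_L2 f)"
proof -
  have one: "sq_integrable lebI (\<lambda>x. 1)"
    by (rule sq_integrable_bounded[where B=1]) auto
  show "integrable lebI f"
    using sq_integrable_mult[OF f one] by simp
  have "abs_L2 (\<lambda>x. \<bar>f x\<bar>) \<bullet> abs_L2 (\<lambda>x. 1) \<le> norm (abs_L2 (\<lambda>x. \<bar>f x\<bar>)) * norm (abs_L2 (\<lambda>x. 1))"
    by (rule norm_cauchy_schwarz)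
  then show "(LINT x|lebI. \<bar>f x\<bar>) \<le> norm (abs_L2 f)"
    using f one measure_lebI by (simp add: inner_abs_L2 norm_abs_L2 sq_integrable_abs)
qed

instance L2 :: complete_space
proof
  fix X :: "nat \<Rightarrow> L2" assume X: "Cauchy X"
  have "\<exists>N. \<forall>m\<ge>N. \<forall>n\<ge>N. dist (X m) (X n) < (1/2)^k" for k :: nat
    using X unfolding Cauchy_def by simp
  then obtain N where N: "\<And>k m n. m \<ge> N k \<Longrightarrow> n \<ge> N k \<Longrightarrow> dist (X m) (X n) < (1/2)^k"
    by metis
  define r where "r k = k + (\<Sum>i\<le>k. N i)" for k
  have r: "strict_mono r"
    by (rule strict_mono_Suc_iff[THEN iffD2]) (simp add: r_def)
  have "N k \<le> r k" for k
    unfolding r_def by (intro trans_le_add2 member_le_sum) auto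
  then have rN: "N k \<le> r m" if "k \<le> m" for k m
    using that r by (meson order_trans strict_mono_less_eq)
  define F where "F k = rep_L2 (X (r k))" for k
  have F: "sq_integrable lebI (F k)" and absF: "abs_L2 (F k) = X (r k)" for k
    by (simp_all add: F_def sq_integrable_rep abs_rep_L2)
  have [measurable]: "F k \<in> borel_measurable lebI" for k
    using F by (rule sq_integrable_measurable)
  have distF: "sqrt (LINT x|lebI. (F k x - F m x)\<^sup>2) \<le> (1/2)^m" if "m \<le> k" for k m
  proof -
    have "dist (X (r k)) (X (r m)) \<le> (1/2)^m"
      using that by (intro less_imp_le[OF N[OF rN rN]]) auto
    then show ?thesis by (simp add: absF[symmetric] dist_abs_L2 F)
  qed
  have G: "(\<integral>\<^sup>+x. ennreal \<bar>F (Suc k) x - F k x\<bar> \<partial>lebI) \<le> ennreal ((1/2)^k)" for k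
  proof -
    have s: "sq_integrable lebI (\<lambda>x. F (Suc k) x - F k x)"
      by (intro sq_integrable_diff F)
    have "(LINT x|lebI. \<bar>F (Suc k) x - F k x\<bar>) \<le> (1/2)^k"
      using L1_le_norm_L2(2)[OF s] distF[of k "Suc k"] by (simp add: norm_abs_L2 s)
    then show ?thesis
      using L1_le_norm_L2(1)[OF s] by (subst nn_integral_eq_integral) (auto intro!: ennreal_leI)
  qed
  have "(\<integral>\<^sup>+x. (\<Sum>k. ennreal \<bar>F (Suc k) x - F k x\<bar>) \<partial>lebI)
      = (\<Sum>k. \<integral>\<^sup>+x. ennreal \<bar>F (Suc k) x - F k x\<bar> \<partial>lebI)"
    by (rule nn_integral_suminf) measurable
  also have "\<dots> \<le> (\<Sum>k. ennreal ((1/2)^k))"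
    by (intro suminf_le G) auto
  also have "\<dots> < \<infinity>"
    by (subst suminf_ennreal2) (auto intro!: summable_geometric)
  finally have "AE x in lebI. (\<Sum>k. ennreal \<bar>F (Suc k) x - F k x\<bar>) \<noteq> \<infinity>"
    by (intro nn_integral_noteq_infinite) auto
  then have conv: "AE x in lebI. (\<lambda>k. F k x) \<longlonglongrightarrow> lim (\<lambda>k. F k x)"
  proof eventually_elim
    case (elim x)
    then have "summable (\<lambda>k. \<bar>F (Suc k) x - F k x\<bar>)"
      by (intro summable_suminf_not_top) auto
    then have "summable (\<lambda>k. F (Suc k) x - F k x)"
      by (rule summable_rabs_cancel)
    then have "convergent (\<lambda>n. \<Sum>k<n. F (Suc k) x - F k x)"
      by (simp add: summable_iff_convergent)
    then have "convergent (\<lambda>n. F n x - F 0 x)"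
      by (simp only: sum_lessThan_telescope[of "\<lambda>k. F k x"])
    then have "convergent (\<lambda>n. F n x)"
      using convergent_add[OF _ convergent_const[of "F 0 x"]] by fastforce
    then show ?case by (simp add: convergent_LIMSEQ_iff)
  qed
  define h where "h x = lim (\<lambda>k. F k x)" for x
  have [measurable]: "h \<in> borel_measurable lebI"
    unfolding h_def by measurable
  have fatou: "(\<integral>\<^sup>+x. ennreal ((h x - F m x)\<^sup>2) \<partial>lebI) \<le> ennreal (((1/2)^m)\<^sup>2)" for m
  proof -
    have "(\<integral>\<^sup>+x. ennreal ((h x - F m x)\<^sup>2) \<partial>lebI)
        = (\<integral>\<^sup>+x. liminf (\<lambda>k. ennreal ((F k x - F m x)\<^sup>2)) \<partial>lebI)"
    proof (rule nn_integral_cong_AE)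
      show "AE x in lebI. ennreal ((h x - F m x)\<^sup>2) = liminf (\<lambda>k. ennreal ((F k x - F m x)\<^sup>2))"
        using conv
      proof eventually_elim
        case (elim x)
        then have "(\<lambda>k. ennreal ((F k x - F m x)\<^sup>2)) \<longlonglongrightarrow> ennreal ((h x - F m x)\<^sup>2)"
          unfolding h_def by (intro tendsto_intros)
        then show ?case by (intro lim_imp_Liminf[symmetric]) auto
      qed
    qed
    also have "\<dots> \<le> liminf (\<lambda>k. \<integral>\<^sup>+x. ennreal ((F k x - F m x)\<^sup>2) \<partial>lebI)"
      by (rule nn_integral_liminf) measurable
    also have "\<dots> \<le> limsup (\<lambda>k. \<integral>\<^sup>+x. ennreal ((F k x - F m x)\<^sup>2) \<partial>lebI)"
      by (intro Liminf_le_Limsup) simp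
    also have "\<dots> \<le> ennreal (((1/2)^m)\<^sup>2)"
    proof (rule Limsup_bounded, rule eventually_sequentiallyI[of m])
      fix k assume "m \<le> k"
      have s: "sq_integrable lebI (\<lambda>x. F k x - F m x)"
        by (intro sq_integrable_diff F)
      have "(LINT x|lebI. (F k x - F m x)\<^sup>2) \<le> ((1/2)^m)\<^sup>2"
        using distF[OF \<open>m \<le> k\<close>] by (rule sqrt_le_D)
      then show "(\<integral>\<^sup>+x. ennreal ((F k x - F m x)\<^sup>2) \<partial>lebI) \<le> ennreal (((1/2)^m)\<^sup>2)"
        using s unfolding sq_integrable_def
        by (subst nn_integral_eq_integral) (auto intro!: ennreal_leI)
    qed
    finally show ?thesis .
  qed
  have hF: "sq_integrable lebI (\<lambda>x. h x - F m x)" for m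
    unfolding sq_integrable_def
    by (auto intro!: integrableI_bounded le_less_trans[OF fatou[of m]])
  have h: "sq_integrable lebI h"
    using sq_integrable_add[OF hF[of 0] F[of 0]] by simp
  have bound: "dist (X (r m)) (abs_L2 h) \<le> (1/2)^m" for m
  proof -
    have "ennreal (LINT x|lebI. (h x - F m x)\<^sup>2) \<le> ennreal (((1/2)^m)\<^sup>2)"
      using fatou[of m] hF[of m] unfolding sq_integrable_def
      by (subst (asm) nn_integral_eq_integral) auto
    then have "(LINT x|lebI. (h x - F m x)\<^sup>2) \<le> ((1/2)^m)\<^sup>2"
      by (simp add: ennreal_le_iff)
    then have "sqrt (LINT x|lebI. (h x - F m x)\<^sup>2) \<le> (1/2)^m"
      by (rule real_le_lsqrt[rotated]) simp
    then show ?thesis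
      by (simp add: absF[symmetric] dist_commute[of _ "abs_L2 h"] dist_abs_L2 F h)
  qed
  have "(\<lambda>m. (1/2::real)^m) \<longlonglongrightarrow> 0"
    by (rule LIMSEQ_power_zero) simp
  then have "(\<lambda>m. dist (X (r m)) (abs_L2 h)) \<longlonglongrightarrow> 0"
    by (rule tendsto_sandwich[OF _ _ tendsto_const, rotated 2]) (auto simp: bound)
  then have "(X \<circ> r) \<longlonglongrightarrow> abs_L2 h"
    unfolding o_def by (rule tendsto_dist_iff[THEN iffD2])
  then have "X \<longlonglongrightarrow> abs_L2 h"
    by (rule Cauchy_converges_subseq[OF X r])
  then show "convergent X"
    by (rule convergentI)
qed

lemma L2_dense_bounded:
  assumes f: "sq_integrable lebI f" and "e > 0"
  obtains g B where "g \<in> borel_measurable lebI" "\<And>x. \<bar>g x\<bar> \<le> B" "dist (abs_L2 g) (abs_L2 f) < e"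
proof -
  define T where "T k x = max (- real k) (min (real k) (f x))" for k x
  have [measurable]: "f \<in> borel_measurable lebI"
    using f by (rule sq_integrable_measurable)
  have [measurable]: "T k \<in> borel_measurable lebI" for k
    unfolding T_def by measurable
  have Tb: "\<bar>T k x\<bar> \<le> real k" for k x
    unfolding T_def by auto
  have sT: "sq_integrable lebI (T k)" for k
    by (rule sq_integrable_bounded[OF _ Tb]) measurable
  have "(\<lambda>k. LINT x|lebI. (T k x - f x)\<^sup>2) \<longlonglongrightarrow> (LINT x|lebI. 0)"
  proof (rule integral_dominated_convergence)
    show "integrable lebI (\<lambda>x. (f x)\<^sup>2)"
      using f by (simp add: sq_integrable_def)
    show "AE x in lebI. norm ((T k x - f x)\<^sup>2) \<le> (f x)\<^sup>2" for k
      by (rule AE_I2) (auto simp: T_def abs_le_square_iff[symmetric])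
    show "AE x in lebI. (\<lambda>k. (T k x - f x)\<^sup>2) \<longlonglongrightarrow> 0"
    proof (rule AE_I2)
      fix x
      obtain K :: nat where "\<bar>f x\<bar> \<le> real K" using real_arch_simple by blast
      then have "eventually (\<lambda>k. (T k x - f x)\<^sup>2 = 0) sequentially"
        by (intro eventually_sequentiallyI[of K]) (auto simp: T_def)
      then show "(\<lambda>k. (T k x - f x)\<^sup>2) \<longlonglongrightarrow> 0"
        by (rule tendsto_eventually)
    qed
  qed measurable
  then have "(\<lambda>k. sqrt (LINT x|lebI. (T k x - f x)\<^sup>2)) \<longlonglongrightarrow> sqrt 0"
    by (intro tendsto_real_sqrt) simp
  then have "(\<lambda>k. dist (abs_L2 (T k)) (abs_L2 f)) \<longlonglongrightarrow> 0"
    by (simp add: dist_abs_L2 f sT)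
  then have "eventually (\<lambda>k. dist (abs_L2 (T k)) (abs_L2 f) < e) sequentially"
    using \<open>e > 0\<close> by (rule order_tendstoD)
  then obtain k where "dist (abs_L2 (T k)) (abs_L2 f) < e"
    by (auto simp: eventually_sequentially)
  then show thesis using that[of "T k"] Tb by auto
qed

lemma L2_dense_continuous:
  assumes g [measurable]: "g \<in> borel_measurable lebI" and B: "\<And>x. \<bar>g x\<bar> \<le> B" and "e > 0"
  obtains h where "continuous_on {0..1} h" "sq_integrable lebI h" "dist (abs_L2 h) (abs_L2 g) < e"
proof -
  have B0: "0 \<le> B" using B[of 0] by linarith
  have sg: "sq_integrable lebI g"
    by (rule sq_integrable_bounded[OF g B])
  have "(\<lambda>x. if x \<in> {0..1} then g x else 0) \<in> borel_measurable lebesgue"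
    using g by (subst borel_measurable_if) auto
  then have "(\<lambda>x. if x \<in> {0..1} then g x else 0) measurable_on UNIV"
    by (rule lebesgue_measurable_imp_measurable_on_real) simp
  then obtain N c where N: "negligible N" and c: "\<And>n. continuous_on UNIV (c n)"
    and lim: "\<And>x. x \<notin> N \<Longrightarrow> (\<lambda>n. c n x) \<longlonglongrightarrow> (if x \<in> {0..1} then g x else 0)"
    unfolding measurable_on_def by auto
  define h where "h n x = max (- B) (min B (c n x))" for n x
  have hc: "continuous_on {0..1} (h n)" for n
    unfolding h_def by (intro continuous_intros continuous_on_subset[OF c]) auto
  have [measurable]: "h n \<in> borel_measurable lebI" for n
    by (rule continuous_imp_measurable_on_sets_lebesgue[OF hc]) simp
  have hb: "\<bar>h n x\<bar> \<le> B" for n x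
    unfolding h_def using B0 by auto
  have sh: "sq_integrable lebI (h n)" for n
    by (rule sq_integrable_bounded[OF _ hb]) measurable
  have "AE x in lebesgue. x \<notin> N"
    using N by (intro AE_not_in) (simp add: negligible_iff_null_sets)
  then have ae: "AE x in lebI. x \<notin> N"
    by (subst AE_restrict_space_iff) auto
  interpret finite_measure lebI by (rule finite_measure_lebI)
  have "(\<lambda>n. LINT x|lebI. (h n x - g x)\<^sup>2) \<longlonglongrightarrow> (LINT x|lebI. 0)"
  proof (rule integral_dominated_convergence)
    show "integrable lebI (\<lambda>x. (2 * B)\<^sup>2)" by simp
    have "\<bar>h n x - g x\<bar> \<le> \<bar>2 * B\<bar>" for n x
      using hb[of n x] B[of x] B0 by linarith
    then show "AE x in lebI. norm ((h n x - g x)\<^sup>2) \<le> (2 * B)\<^sup>2" for n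
      by (intro AE_I2) (simp only: abs_le_square_iff real_norm_def abs_power2)
    show "AE x in lebI. (\<lambda>n. (h n x - g x)\<^sup>2) \<longlonglongrightarrow> 0"
      using ae AE_space
    proof eventually_elim
      case (elim x)
      then have "(\<lambda>n. c n x) \<longlonglongrightarrow> g x"
        using lim[of x] by simp
      then have "(\<lambda>n. h n x) \<longlonglongrightarrow> max (- B) (min B (g x))"
        unfolding h_def by (intro tendsto_intros)
      moreover have "max (- B) (min B (g x)) = g x"
        using B[of x] by auto
      ultimately have "(\<lambda>n. (h n x - g x)\<^sup>2) \<longlonglongrightarrow> (g x - g x)\<^sup>2"
        by (intro tendsto_intros) simp
      then show ?case by simp
    qed
  qed measurable
  then have "(\<lambda>k. sqrt (LINT x|lebI. (h k x - g x)\<^sup>2)) \<longlonglongrightarrow> sqrt 0"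
    by (intro tendsto_real_sqrt) simp
  then have "(\<lambda>k. dist (abs_L2 (h k)) (abs_L2 g)) \<longlonglongrightarrow> 0"
    by (simp add: dist_abs_L2 sg sh)
  then have "eventually (\<lambda>k. dist (abs_L2 (h k)) (abs_L2 g) < e) sequentially"
    using \<open>e > 0\<close> by (rule order_tendstoD)
  then obtain k where "dist (abs_L2 (h k)) (abs_L2 g) < e"
    by (auto simp: eventually_sequentially)
  then show thesis using that[of "h k"] hc sh by auto
qed

definition rat_step :: "nat \<Rightarrow> rat list \<Rightarrow> real \<Rightarrow> real" where
  "rat_step n qs x =
     (if nat \<lfloor>real n * x\<rfloor> < length qs then of_rat (qs ! nat \<lfloor>real n * x\<rfloor>) else 0)"

lemma sq_integrable_rat_step: "sq_integrable lebI (rat_step n qs)"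
proof (rule sq_integrable_bounded)
  have "(\<lambda>x. (\<lambda>k. if k < length qs then of_rat (qs ! k) else 0 :: real) (nat \<lfloor>real n * x\<rfloor>))
      \<in> borel_measurable borel"
    by measurable
  then have "rat_step n qs \<in> borel_measurable borel"
    by (simp add: rat_step_def[abs_def])
  then show "rat_step n qs \<in> borel_measurable lebI"
    by (intro measurable_restrict_space1 measurable_completion) simp
  show "\<bar>rat_step n qs x\<bar> \<le> (\<Sum>q\<leftarrow>qs. \<bar>of_rat q\<bar>)" for x
    unfolding rat_step_def by (auto intro!: member_le_sum_list sum_list_nonneg)
qed

lemma L2_dense_rat_step:
  assumes h: "continuous_on {0..1} h" "sq_integrable lebI h" and "e > 0"
  obtains n qs where "dist (abs_L2 (rat_step n qs)) (abs_L2 h) < e"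
proof -
  have "uniformly_continuous_on {0..1} h"
    using h by (intro compact_uniformly_continuous) auto
  then obtain d where d: "d > 0"
    "\<And>x y. x \<in> {0..1} \<Longrightarrow> y \<in> {0..1} \<Longrightarrow> dist y x < d \<Longrightarrow> dist (h y) (h x) < e / 4"
    unfolding uniformly_continuous_on_def using \<open>e > 0\<close>
    by (metis zero_less_divide_iff zero_less_numeral)
  obtain n where n: "1 / d < real n"
    using reals_Archimedean2 by blast
  then have n0: "n > 0" using d(1) by (auto intro!: gr0I simp: field_simps)
  have "\<exists>q. \<bar>of_rat q - h (real i / real n)\<bar> < e / 4" for i
  proof -
    obtain q where "h (real i / real n) - e / 4 < of_rat q" "of_rat q < h (real i / real n)"
      using of_rat_dense[of "h (real i / real n) - e / 4" "h (real i / real n)"] \<open>e > 0\<close> by auto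
    then show ?thesis by (intro exI[of _ q]) auto
  qed
  then obtain q where q: "\<And>i. \<bar>of_rat (q i) - h (real i / real n)\<bar> < e / 4"
    by metis
  define qs where "qs = map q [0..<Suc n]"
  have close: "\<bar>rat_step n qs x - h x\<bar> \<le> e / 2" if x: "x \<in> {0..1}" for x
  proof -
    define i where "i = nat \<lfloor>real n * x\<rfloor>"
    have nx: "0 \<le> real n * x" "real n * x \<le> real n"
      using x by (auto simp: mult_left_le)
    have i: "real i \<le> real n * x" "real n * x < real i + 1"
      using nx(1) by (auto simp: i_def of_nat_floor)
    then have "i \<le> n" using nx by linarith
    then have eq: "rat_step n qs x = of_rat (q i)"
      unfolding rat_step_def i_def[symmetric] by (simp add: qs_def del: upt_Suc)
    have "\<bar>real i / real n - x\<bar> \<le> 1 / real n"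
    proof -
      have "real i / real n - x = (real i - real n * x) / real n"
        using n0 by (simp add: field_simps)
      then show ?thesis
        using i by (simp add: abs_divide divide_right_mono)
    qed
    moreover have "1 / real n < d"
      using n d(1) n0 by (simp add: field_simps)
    ultimately have "dist (h (real i / real n)) (h x) < e / 4"
      using x \<open>i \<le> n\<close> n0 by (intro d(2)) (auto simp: dist_real_def)
    then show ?thesis
      using q[of i] unfolding eq dist_real_def by linarith
  qed
  interpret finite_measure lebI by (rule finite_measure_lebI)
  have sd: "sq_integrable lebI (\<lambda>x. rat_step n qs x - h x)"
    by (intro sq_integrable_diff sq_integrable_rat_step h)
  have "(LINT x|lebI. (rat_step n qs x - h x)\<^sup>2) \<le> (LINT x|lebI. (e / 2)\<^sup>2)"
  proof (rule integral_mono)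
    show "integrable lebI (\<lambda>x. (rat_step n qs x - h x)\<^sup>2)"
      using sd by (simp add: sq_integrable_def)
    show "(rat_step n qs x - h x)\<^sup>2 \<le> (e / 2)\<^sup>2" if "x \<in> space lebI" for x
      using close[of x] that \<open>e > 0\<close> by (simp only: abs_le_square_iff[symmetric]) simp
  qed simp
  also have "\<dots> = (e / 2)\<^sup>2"
    using measure_lebI by simp
  finally have "sqrt (LINT x|lebI. (rat_step n qs x - h x)\<^sup>2) \<le> e / 2"
    using \<open>e > 0\<close> by (intro real_le_lsqrt) auto
  then have "dist (abs_L2 (rat_step n qs)) (abs_L2 h) < e"
    using \<open>e > 0\<close> by (simp add: dist_abs_L2 h sq_integrable_rat_step)
  then show thesis by (rule that)
qed

instance L2 :: second_countable_topology
proof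
  define D where "D = (\<lambda>(n, qs). abs_L2 (rat_step n qs)) ` UNIV"
  have "countable D"
    unfolding D_def by (intro countable_image) simp
  have dense: "\<exists>d\<in>D. dist d u < e" if "e > 0" for u e
  proof -
    have e: "e / 3 > 0" using that by simp
    obtain g B where g: "g \<in> borel_measurable lebI" "\<And>x. \<bar>g x\<bar> \<le> B"
      "dist (abs_L2 g) (abs_L2 (rep_L2 u)) < e / 3"
      using L2_dense_bounded[OF sq_integrable_rep e] by blast
    obtain h where h: "continuous_on {0..1} h" "sq_integrable lebI h" "dist (abs_L2 h) (abs_L2 g) < e / 3"
      using L2_dense_continuous[OF g(1,2) e] by blast
    obtain n qs where s: "dist (abs_L2 (rat_step n qs)) (abs_L2 h) < e / 3"
      using L2_dense_rat_step[OF h(1,2) e] by blast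
    have "dist (abs_L2 (rat_step n qs)) u < e"
      using g(3) h(3) s dist_triangle[of "abs_L2 (rat_step n qs)" u "abs_L2 h"]
        dist_triangle[of "abs_L2 h" u "abs_L2 g"] by (simp add: abs_rep_L2)
    then show ?thesis by (auto simp: D_def)
  qed
  define B where "B = (\<lambda>(d, n). ball d (1 / real (Suc n))) ` (D \<times> UNIV)"
  have "countable B"
    unfolding B_def using \<open>countable D\<close> by (intro countable_image countable_SIGMA) auto
  moreover have "topological_basis B"
  proof (rule topological_basisI)
    show "open U" if "U \<in> B" for U
      using that by (auto simp: B_def)
    fix U and u :: L2 assume "open U" "u \<in> U"
    then obtain e where e: "e > 0" "ball u e \<subseteq> U"
      by (auto simp: open_contains_ball)
    obtain n where n: "1 / real (Suc n) < e / 2"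
      using nat_approx_posE[of "e / 2"] e(1) by auto
    obtain d where d: "d \<in> D" "dist d u < 1 / real (Suc n)"
      using dense[of "1 / real (Suc n)" u] by auto
    have "ball d (1 / real (Suc n)) \<subseteq> ball u e"
    proof
      fix v assume "v \<in> ball d (1 / real (Suc n))"
      then show "v \<in> ball u e"
        using d(2) n dist_triangle[of u v d] by (simp add: dist_commute[of u d])
    qed
    then show "\<exists>V\<in>B. u \<in> V \<and> V \<subseteq> U"
      using d e(2) by (intro bexI[of _ "ball d (1 / real (Suc n))"]) (auto simp: B_def)
  qed
  ultimately show "\<exists>B::L2 set set. countable B \<and> open = generate_topology B"
    by (metis topological_basis_imp_subbasis)
qed


section \<open>Sobolev functions with values in \<open>L2\<close>\<close>

text \<open>Since \<open>L2\<close> is separable, Borel measurability coincides with strong measurability.\<close>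

definition L2_time :: "real \<Rightarrow> (real \<Rightarrow> L2) \<Rightarrow> bool" where
  "L2_time T v \<longleftrightarrow> v \<in> borel_measurable (lebesgue_on {0..T}) \<and>
     integrable (lebesgue_on {0..T}) (\<lambda>t. (norm (v t))\<^sup>2)"

text \<open>
  \<open>H1_deriv T u u'\<close>: \<open>u\<close> is the continuous representative of an element of
  $H^1(0,T;L^2(I))$ and \<open>u'\<close> is its derivative. The integral is a Bochner integral.
\<close>

definition H1_deriv :: "real \<Rightarrow> (real \<Rightarrow> L2) \<Rightarrow> (real \<Rightarrow> L2) \<Rightarrow> bool" where
  "H1_deriv T u u' \<longleftrightarrow> L2_time T u \<and> L2_time T u' \<and>
     (\<forall>t\<in>{0..T}. u t = u 0 + (LINT s|lebesgue_on {0..t}. u' s))"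

text \<open>For continuous \<open>w\<close> the supremum is a maximum.\<close>

definition C_norm :: "real \<Rightarrow> (real \<Rightarrow> L2) \<Rightarrow> real" where
  "C_norm T w = (SUP t\<in>{0..T}. norm (w t))"


section \<open>The continuum limit equation\<close>

text \<open>
  \<open>abs_L2\<close> is meaningful only on square-integrable functions. Both functions below are
  square-integrable, with class independent of the representative of \<open>u\<close>, when \<open>W\<close> is in
  $L^2(I^2)$, \<open>D\<close> is bounded and continuous and \<open>f\<close> is Lipschitz in its first argument.
\<close>

definition coupling :: "(real \<times> real \<Rightarrow> real) \<Rightarrow> (real \<Rightarrow> real) \<Rightarrow> L2 \<Rightarrow> L2" where
  "coupling W D u = abs_L2 (\<lambda>x. LINT y|lebI. W (x, y) * D (rep_L2 u y - rep_L2 u x))"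

definition superposition :: "(real \<Rightarrow> real \<Rightarrow> real) \<Rightarrow> real \<Rightarrow> L2 \<Rightarrow> L2" where
  "superposition f t u = abs_L2 (\<lambda>x. f (rep_L2 u x) t)"

definition weak_solution ::
  "(real \<times> real \<Rightarrow> real) \<Rightarrow> (real \<Rightarrow> real) \<Rightarrow> (real \<Rightarrow> real \<Rightarrow> real) \<Rightarrow> (real \<Rightarrow> real) \<Rightarrow>
    real \<Rightarrow> (real \<Rightarrow> L2) \<Rightarrow> bool" where
  "weak_solution W D f g T u \<longleftrightarrow> (\<exists>u'. H1_deriv T u u' \<and>
     (AE t in lebesgue_on {0..T}.
        \<forall>v. (u' t - coupling W D (u t) - superposition f t (u t)) \<bullet> v = 0) \<and>
     u 0 = abs_L2 g)"


section \<open>Cell averages and the kernel conditions\<close>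

definition cell :: "nat \<Rightarrow> nat \<Rightarrow> real set" where
  "cell n i = {(real i - 1) / real n <.. real i / real n}"

definition cell_avg :: "nat \<Rightarrow> (real \<times> real \<Rightarrow> real) \<Rightarrow> nat \<Rightarrow> nat \<Rightarrow> real" where
  "cell_avg n V i j = (real n)\<^sup>2 * (LINT z:cell n i \<times> cell n j|lebesgue. V z)"

definition step_kernel :: "nat \<Rightarrow> (real \<times> real \<Rightarrow> real) \<Rightarrow> real \<times> real \<Rightarrow> real" where
  "step_kernel n W z = (\<Sum>i=1..n. \<Sum>j=1..n. cell_avg n W i j * indicator (cell n i \<times> cell n j) z)"

definition cond_W1 :: "(real \<times> real \<Rightarrow> real) \<Rightarrow> bool" where
  "cond_W1 W \<longleftrightarrow> bdd_above {LINT x|lebI. step_kernel n W (x, y) | n y. n \<ge> 1 \<and> y \<in> {0..1}}"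

definition cond_W2 :: "(real \<times> real \<Rightarrow> real) \<Rightarrow> bool" where
  "cond_W2 W \<longleftrightarrow> bdd_above {LINT y|lebI. step_kernel n W (x, y) | n x. n \<ge> 1 \<and> x \<in> {0..1}}"


section \<open>The random digraph and the discrete system\<close>

text \<open>\<open>a i j \<omega>\<close> says that the graph realised by \<open>\<omega>\<close> has the edge from \<open>j\<close> to \<open>i\<close>.\<close>

definition random_digraph ::
  "'w measure \<Rightarrow> nat \<Rightarrow> (real \<times> real \<Rightarrow> real) \<Rightarrow> real \<Rightarrow> (nat \<Rightarrow> nat \<Rightarrow> 'w \<Rightarrow> bool) \<Rightarrow> bool" where
  "random_digraph M n W \<alpha> a \<longleftrightarrow>
     prob_space.indep_vars M (\<lambda>_. count_space UNIV) (\<lambda>(i, j). a i j) ({1..n} \<times> {1..n}) \<and>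
     (\<forall>i\<in>{1..n}. \<forall>j\<in>{1..n}.
        measure M {\<omega> \<in> space M. a i j \<omega>} = \<alpha> * cell_avg n (\<lambda>z. min (inverse \<alpha>) (W z)) i j)"

definition kuramoto_solution ::
  "(real \<Rightarrow> real) \<Rightarrow> (real \<Rightarrow> real \<Rightarrow> real) \<Rightarrow> (real \<Rightarrow> real) \<Rightarrow> nat \<Rightarrow> real \<Rightarrow>
    (nat \<Rightarrow> nat \<Rightarrow> bool) \<Rightarrow> real \<Rightarrow> (nat \<Rightarrow> real \<Rightarrow> real) \<Rightarrow> bool" where
  "kuramoto_solution D f g n \<alpha> A T v \<longleftrightarrow> (\<forall>i\<in>{1..n}.
     v i 0 = real n * (LINT x:cell n i|lebesgue. g x) \<and>
     (\<forall>t\<in>{0..T}. (v i has_real_derivative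
        f (v i t) t + 1 / (real n * \<alpha>) * (\<Sum>j=1..n. of_bool (A i j) * D (v j t - v i t)))
        (at t within {0..T})))"

definition step_fun :: "nat \<Rightarrow> (nat \<Rightarrow> real) \<Rightarrow> L2" where
  "step_fun n c = abs_L2 (\<lambda>x. \<Sum>i=1..n. c i * indicator (cell n i) x)"

end

theory Submission
  imports Defs "HOL-Real_Asymp.Real_Asymp"
begin

text \<open>
  The random solution is compared directly with the cell means
  $w_i(t) = n \int_{I_{n,i}} u(t,x)\,dx$ of the weak solution. The difference
  $\varphi_i = u_{n,i} - w_i$ vanishes at time 0, and its derivative splits into a part that is
  Lipschitz in $\varphi$ and three errors. The first two are deterministic, coming from averaging
  $f$ and from averaging and truncating $W$; both are small because cell means converge in $L^2(I)$,
  uniformly on the compact set $u([0,T])$. The third is the noise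
  $Z_i(V) = (n\alpha_n)^{-1} \sum_j (a_{ij} - \mathbb{E} a_{ij}) D(w_j - w_i)$ at $V = u(t)$.
  For a fixed $V$ Hoeffding's inequality and the Borel-Cantelli lemma give
  $\max_i |Z_i(V)| \to 0$ almost surely. The row and column sums of $a_{ij}/(n\alpha_n)$ are
  bounded for the same reason, so by the Schur test $V \mapsto Z(V)$ is Lipschitz uniformly in $n$,
  and the convergence extends from a countable dense set of $V$ to $u([0,T])$ uniformly.
  Gronwall's inequality concludes.
\<close>

section \<open>Cell means\<close>

text \<open>Hoeffding's inequality requires weights that do not depend on the graph. The phases of
  the random system are functions of the same edges, so they cannot be inserted into the noise; the
  cell means of the weak solution are deterministic, and replacing one by the other costs only a
  term that is Lipschitz in their difference. The null set on which concentration fails depends on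
  V, and the trajectory is uncountable: hence the countable dense set and the equicontinuity.
  Conditions (W-1) and (W-2) enter only through the row and column sums. The truncation level
  1/alpha_n tends to infinity, so its effect is a tail of the integral of W^2. Two technical
  obstacles shape the rest. W is measurable for the completed Lebesgue measure on the square, while
  Fubini's theorem is used on the product of two Lebesgue measures, so W is replaced by a Borel
  version. The weak solution has a time derivative that is merely integrable, so Gronwall's
  inequality is needed in integral form.\<close>

lemma prob_space_lebI: "prob_space lebI"
  by (rule prob_spaceI) (simp add: emeasure_restrict_space)

text \<open>Left-open, right-closed cells are the level sets of the ceiling of n x. The index must
  be positive because \<open>nat\<close> sends every nonpositive ceiling to 0.\<close>

lemma mem_cell_iff:
  assumes "n \<ge> 1" "i \<ge> 1"
  shows "x \<in> cell n i \<longleftrightarrow> nat \<lceil>real n * x\<rceil> = i"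
proof -
  have "x \<in> cell n i \<longleftrightarrow> real i - 1 < real n * x \<and> real n * x \<le> real i"
    using assms by (auto simp: cell_def field_simps)
  also have "\<dots> \<longleftrightarrow> \<lceil>real n * x\<rceil> = int i"
    by (simp add: ceiling_eq_iff)
  also have "\<dots> \<longleftrightarrow> nat \<lceil>real n * x\<rceil> = i"
    using assms by auto
  finally show ?thesis .
qed

lemma cell_index:
  assumes "n \<ge> 1" "x \<in> {0<..1}"
  shows "nat \<lceil>real n * x\<rceil> \<in> {1..n}"
proof -
  have "0 < real n * x" "real n * x \<le> real n"
    using assms by (auto simp: mult_left_le)
  then have "0 < \<lceil>real n * x\<rceil>" "\<lceil>real n * x\<rceil> \<le> int n"
    by (auto simp: ceiling_le_iff)
  then have "1 \<le> nat \<lceil>real n * x\<rceil>" "nat \<lceil>real n * x\<rceil> \<le> n"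
    by linarith+
  then show ?thesis by simp
qed

lemma sum_indicator_cell:
  fixes c :: "nat \<Rightarrow> real"
  assumes "n \<ge> 1" "x \<in> {0<..1}"
  shows "(\<Sum>i=1..n. c i * indicator (cell n i) x) = c (nat \<lceil>real n * x\<rceil>)"
proof -
  have "(\<Sum>i=1..n. c i * indicator (cell n i) x)
      = (\<Sum>i=1..n. if i = nat \<lceil>real n * x\<rceil> then c i else 0)"
    using assms by (intro sum.cong) (auto simp: indicator_def mem_cell_iff)
  then show ?thesis
    using cell_index[OF assms] by simp
qed

text \<open>The point 0 lies in no cell, so identities that evaluate a step function through the
  ceiling hold off this null set only.\<close>

lemma AE_lebI_pos: "AE x in lebI. x \<in> {0<..1::real}"
proof -
  have "AE x in lebesgue. x \<notin> {0::real}"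
    by (intro AE_not_in) auto
  then show ?thesis
    by (subst AE_restrict_space_iff) auto
qed

lemma cell_subset:
  assumes "i \<in> {1..n}"
  shows "cell n i \<subseteq> {0<..1}"
proof
  fix x assume x: "x \<in> cell n i"
  have n: "real n > 0" using assms by auto
  have "0 \<le> (real i - 1) / real n" "real i / real n \<le> 1"
    using assms by (auto simp: field_simps)
  then show "x \<in> {0<..1}" using x unfolding cell_def by auto
qed

lemma cell_borel [measurable]: "cell n i \<in> sets borel"
  by (simp add: cell_def)

lemma borel_imp_lebI: "h \<in> borel_measurable borel \<Longrightarrow> h \<in> borel_measurable lebI"
  by (intro measurable_restrict_space1 measurable_completion) simp

lemma measurable_ident_lebI: "(\<lambda>x. x) \<in> lebI \<rightarrow>\<^sub>M borel"
  by (intro measurable_restrict_space1 measurable_completion) simp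

lemma sq_integrable_indicator: "A \<in> sets borel \<Longrightarrow> sq_integrable lebI (indicator A)"
  by (rule sq_integrable_bounded[where B=1])
    (auto intro!: borel_imp_lebI simp: indicator_def)

lemma integral_indicator_cell:
  assumes "i \<in> {1..n}"
  shows "(LINT x|lebI. indicator (cell n i) x) = 1 / real n"
proof -
  have "measure lebI (cell n i) = measure lebesgue (cell n i)"
    using cell_subset[OF assms] by (intro measure_restrict_space) auto
  also have "\<dots> = real i / real n - (real i - 1) / real n"
    unfolding cell_def by (simp add: divide_right_mono)
  also have "\<dots> = 1 / real n"
    by (simp add: diff_divide_distrib)
  finally have "measure lebI (cell n i) = 1 / real n" .
  moreover have "cell n i \<inter> space lebI = cell n i"
    using cell_subset[OF assms] by auto
  ultimately show ?thesis by simp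
qed

definition cell_chi :: "nat \<Rightarrow> nat \<Rightarrow> L2" where
  "cell_chi n i = abs_L2 (indicator (cell n i))"

text \<open>As an inner product the mean is defined on classes, linear and continuous in V, and it
  commutes with Bochner integrals in time.\<close>

definition cell_mean :: "nat \<Rightarrow> L2 \<Rightarrow> nat \<Rightarrow> real" where
  "cell_mean n V i = real n * (V \<bullet> cell_chi n i)"

lemma cell_mean_abs_L2:
  assumes "sq_integrable lebI v"
  shows "cell_mean n (abs_L2 v) i = real n * (LINT x|lebI. v x * indicator (cell n i) x)"
  unfolding cell_mean_def cell_chi_def
  using assms by (subst inner_abs_L2) (auto intro!: sq_integrable_indicator)

lemma cell_mean_diff: "cell_mean n (U - V) i = cell_mean n U i - cell_mean n V i"
  by (simp add: cell_mean_def inner_diff_left right_diff_distrib)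

lemma inner_cell_chi:
  assumes "i \<in> {1..n}" "j \<in> {1..n}"
  shows "cell_chi n i \<bullet> cell_chi n j = (if i = j then 1 / real n else 0)"
proof -
  have n: "n \<ge> 1" using assms by auto
  have "cell_chi n i \<bullet> cell_chi n j
      = (LINT x|lebI. indicator (cell n i) x * indicator (cell n j) x)"
    unfolding cell_chi_def by (intro inner_abs_L2 sq_integrable_indicator) auto
  also have "\<dots> = (LINT x|lebI. (if i = j then indicator (cell n i) x else 0))"
    using n assms by (intro Bochner_Integration.integral_cong) (auto simp: indicator_def mem_cell_iff)
  also have "\<dots> = (if i = j then 1 / real n else 0)"
    using integral_indicator_cell[OF assms(1)] by (cases "i = j") simp_all
  finally show ?thesis .
qed

section \<open>Step functions and orthogonal projection onto them\<close>

lemma sq_integrable_sum: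
  "finite A \<Longrightarrow> (\<And>i. i \<in> A \<Longrightarrow> sq_integrable M (h i)) \<Longrightarrow> sq_integrable M (\<lambda>x. \<Sum>i\<in>A. h i x)"
  by (induction A rule: finite_induct) (auto simp: sq_integrable_zero sq_integrable_add)

lemma sum_abs_L2:
  assumes "finite A" "\<And>i. i \<in> A \<Longrightarrow> sq_integrable lebI (h i)"
  shows "(\<Sum>i\<in>A. abs_L2 (h i)) = abs_L2 (\<lambda>x. \<Sum>i\<in>A. h i x)"
  using assms
proof (induction A rule: finite_induct)
  case empty
  then show ?case by (simp add: zero_L2_def)
next
  case (insert a A)
  then show ?case
    by (simp add: plus_L2.abs_eq sq_integrable_sum)
qed

lemma step_fun_eq_sum: "step_fun n c = (\<Sum>i=1..n. c i *\<^sub>R cell_chi n i)"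
  unfolding step_fun_def cell_chi_def
  by (simp add: scaleR_L2.abs_eq sq_integrable_indicator sum_abs_L2 sq_integrable_scale)

lemma step_fun_diff: "step_fun n c - step_fun n d = step_fun n (\<lambda>i. c i - d i)"
  by (simp add: step_fun_eq_sum scaleR_diff_left sum_subtractf)

lemma sq_integrable_step_function:
  "sq_integrable lebI (\<lambda>x. \<Sum>i=1..n. c i * indicator (cell n i) x)"
  by (intro sq_integrable_sum sq_integrable_scale sq_integrable_indicator) auto

lemma cell_mean_step_fun:
  assumes "i \<in> {1..n}"
  shows "cell_mean n (step_fun n c) i = c i"
proof -
  have "step_fun n c \<bullet> cell_chi n i = (\<Sum>j=1..n. c j * (cell_chi n j \<bullet> cell_chi n i))"
    by (simp add: step_fun_eq_sum inner_sum_left)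
  also have "\<dots> = (\<Sum>j=1..n. if j = i then c j / real n else 0)"
    using assms by (intro sum.cong) (auto simp: inner_cell_chi)
  also have "\<dots> = c i / real n"
    using assms by simp
  finally show ?thesis
    using assms by (simp add: cell_mean_def)
qed

lemma inner_step_fun:
  assumes "n \<ge> 1"
  shows "V \<bullet> step_fun n c = (\<Sum>i=1..n. c i * cell_mean n V i) / real n"
  using assms by (simp add: step_fun_eq_sum inner_sum_right cell_mean_def sum_divide_distrib mult.commute)

text \<open>The dictionary between the Euclidean norm, in which the finite system is estimated, and
  the norm of L2(I); it is the source of every factor sqrt n below.\<close>

lemma norm_step_fun:
  assumes "n \<ge> 1"
  shows "norm (step_fun n c) = L2_set c {1..n} / sqrt (real n)"
proof -
  have "step_fun n c \<bullet> step_fun n c = (\<Sum>i=1..n. (c i)\<^sup>2) / real n"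
    using assms by (simp add: inner_step_fun cell_mean_step_fun power2_eq_square)
  then show ?thesis
    by (simp add: norm_eq_sqrt_inner L2_set_def real_sqrt_divide)
qed

text \<open>Taking cell means is the orthogonal projection P onto step functions: (PV, PV) = (V,
  PV), and Cauchy-Schwarz lets one factor norm(PV) be cancelled.\<close>

lemma norm_step_fun_cell_mean_le:
  assumes "n \<ge> 1"
  shows "norm (step_fun n (cell_mean n V)) \<le> norm V"
proof -
  let ?P = "step_fun n (cell_mean n V)"
  have "(norm ?P)\<^sup>2 = ?P \<bullet> ?P"
    by (simp add: power2_norm_eq_inner)
  also have "\<dots> = V \<bullet> ?P"
    using assms by (simp add: inner_step_fun cell_mean_step_fun)
  also have "\<dots> \<le> norm V * norm ?P"
    by (rule norm_cauchy_schwarz)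
  finally show ?thesis
    by (metis mult_le_cancel_right norm_ge_zero power2_eq_square order_less_le norm_le_zero_iff)
qed

lemma L2_set_cell_mean_le:
  assumes "n \<ge> 1"
  shows "L2_set (cell_mean n V) {1..n} \<le> sqrt (real n) * norm V"
  using norm_step_fun_cell_mean_le[OF assms, of V] assms
  by (simp add: norm_step_fun field_simps)

lemma norm_step_fun_cell_mean_diff_le:
  assumes "n \<ge> 1"
  shows "norm (step_fun n (cell_mean n U) - step_fun n (cell_mean n V)) \<le> norm (U - V)"
  using norm_step_fun_cell_mean_le[OF assms, of "U - V"]
  by (simp add: step_fun_diff cell_mean_diff[abs_def])

text \<open>By uniform continuity h varies by less than e on a cell of width 1/n, so the mean over
  the cell is within e of each value there.\<close>

lemma step_fun_cell_mean_tendsto_continuous: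
  assumes h: "continuous_on {0..1} h" "sq_integrable lebI h" and "e > 0"
  shows "\<forall>\<^sub>F n in sequentially. norm (step_fun n (cell_mean n (abs_L2 h)) - abs_L2 h) \<le> e"
proof -
  interpret prob_space lebI by (rule prob_space_lebI)
  have "uniformly_continuous_on {0..1} h"
    using h by (intro compact_uniformly_continuous) auto
  then obtain d where d: "d > 0"
    "\<And>x y. x \<in> {0..1} \<Longrightarrow> y \<in> {0..1} \<Longrightarrow> dist y x < d \<Longrightarrow> dist (h y) (h x) < e"
    unfolding uniformly_continuous_on_def using \<open>e > 0\<close> by metis
  obtain N where N: "1 / d < real N" using reals_Archimedean2 by blast
  show ?thesis
  proof (rule eventually_sequentiallyI[of "max 1 N"])
    fix n assume "max 1 N \<le> n"
    then have n: "n \<ge> 1" "1 / d < real n" using N by auto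
    then have nd: "1 / real n < d" using d(1) by (simp add: field_simps)
    let ?c = "cell_mean n (abs_L2 h)"
    let ?s = "\<lambda>x. (\<Sum>i=1..n. ?c i * indicator (cell n i) x)"
    have close: "\<bar>?c i - h x\<bar> \<le> e" if i: "i \<in> {1..n}" and x: "x \<in> cell n i" for i x
    proof -
      have int: "integrable lebI (indicator (cell n i) :: real \<Rightarrow> real)"
        using L1_le_norm_L2(1)[OF sq_integrable_indicator] by auto
      have inth: "integrable lebI (\<lambda>y. h y * indicator (cell n i) y)"
        by (intro sq_integrable_mult h sq_integrable_indicator) auto
      have near: "\<bar>h y - h x\<bar> \<le> e" if y: "y \<in> cell n i" for y
      proof -
        have "\<bar>y - x\<bar> \<le> real i / real n - (real i - 1) / real n"
          using x y unfolding cell_def by auto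
        also have "\<dots> = 1 / real n" by (simp add: diff_divide_distrib)
        finally have "dist y x < d" using nd by (simp add: dist_real_def)
        moreover have "x \<in> {0..1}" "y \<in> {0..1}"
          using x y cell_subset[OF i] by (auto simp: subset_eq)
        ultimately show ?thesis
          using d(2)[of x y] by (simp add: dist_real_def)
      qed
      have "\<bar>LINT y|lebI. h y * indicator (cell n i) y - h x * indicator (cell n i) y\<bar>
          \<le> (LINT y|lebI. e * indicator (cell n i) y)"
      proof (rule integral_abs_bound_integral)
        show "\<bar>h y * indicator (cell n i) y - h x * indicator (cell n i) y\<bar>
          \<le> e * indicator (cell n i) y" for y
          using near[of y] by (auto simp: indicator_def)
      qed (use int inth in \<open>auto intro!: Bochner_Integration.integrable_diff\<close>)
      also have "(LINT y|lebI. h y * indicator (cell n i) y - h x * indicator (cell n i) y)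
        = (LINT y|lebI. h y * indicator (cell n i) y) - h x * (1 / real n)"
        using int inth integral_indicator_cell[OF i]
        by (subst Bochner_Integration.integral_diff) auto
      also have "(LINT y|lebI. e * indicator (cell n i) y) = e / real n"
        using integral_indicator_cell[OF i] by simp
      finally have "real n * \<bar>(LINT y|lebI. h y * indicator (cell n i) y) - h x * (1 / real n)\<bar> \<le> e"
        using n by (simp add: field_simps)
      also have "real n * \<bar>(LINT y|lebI. h y * indicator (cell n i) y) - h x * (1 / real n)\<bar>
         = \<bar>real n * ((LINT y|lebI. h y * indicator (cell n i) y) - h x * (1 / real n))\<bar>"
        by (simp add: abs_mult)
      also have "\<dots> = \<bar>?c i - h x\<bar>"
        using n by (simp add: cell_mean_abs_L2 h right_diff_distrib)
      finally show ?thesis .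
    qed
    have sd: "sq_integrable lebI (\<lambda>x. ?s x - h x)"
      by (intro sq_integrable_diff sq_integrable_step_function h)
    have "(LINT x|lebI. (?s x - h x)\<^sup>2) \<le> (LINT x|lebI. e\<^sup>2)"
    proof (rule integral_mono_AE)
      show "integrable lebI (\<lambda>x. (?s x - h x)\<^sup>2)"
        using sd by (simp add: sq_integrable_def)
      show "AE x in lebI. (?s x - h x)\<^sup>2 \<le> e\<^sup>2"
        using AE_lebI_pos
      proof eventually_elim
        case (elim x)
        let ?i = "nat \<lceil>real n * x\<rceil>"
        have i: "?i \<in> {1..n}" by (rule cell_index[OF n(1) elim])
        then have "x \<in> cell n ?i" using n by (subst mem_cell_iff) auto
        from close[OF i this] have "\<bar>?s x - h x\<bar> \<le> e"
          by (simp only: sum_indicator_cell[OF n(1) elim])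
        then show ?case
          using power_mono[of "\<bar>?s x - h x\<bar>" e 2] by simp
      qed
    qed simp
    also have "\<dots> = e\<^sup>2" using prob_space by simp
    finally have "sqrt (LINT x|lebI. (?s x - h x)\<^sup>2) \<le> e"
      using \<open>e > 0\<close> by (intro real_le_lsqrt) auto
    then show "norm (step_fun n ?c - abs_L2 h) \<le> e"
      unfolding step_fun_def
      by (simp only: minus_abs_L2[OF sq_integrable_step_function h(2)] norm_abs_L2[OF sd])
  qed
qed

text \<open>Density of continuous functions suffices because the projections are contractions:
  replacing V by h costs at most norm(V - h) before and after projecting.\<close>

lemma step_fun_cell_mean_tendsto: "(\<lambda>n. norm (step_fun n (cell_mean n V) - V)) \<longlonglongrightarrow> 0"
proof (rule LIMSEQ_I)
  fix r :: real assume "r > 0"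
  \<comment> \<open>Two approximations within r/8 put h within r/4 of V; the three terms of size r/4
    below then stay under r.\<close>
  then have e: "r / 8 > 0" by simp
  obtain g B where g: "g \<in> borel_measurable lebI" "\<And>x. \<bar>g x\<bar> \<le> B"
    "dist (abs_L2 g) (abs_L2 (rep_L2 V)) < r / 8"
    using L2_dense_bounded[OF sq_integrable_rep e] by blast
  obtain h where h: "continuous_on {0..1} h" "sq_integrable lebI h" "dist (abs_L2 h) (abs_L2 g) < r / 8"
    using L2_dense_continuous[OF g(1,2) e] by blast
  have hV: "norm (abs_L2 h - V) \<le> r / 4"
    using g(3) h(3) dist_triangle[of "abs_L2 h" V "abs_L2 g"]
    by (simp add: abs_rep_L2 dist_norm)
  have "\<forall>\<^sub>F n in sequentially. norm (step_fun n (cell_mean n (abs_L2 h)) - abs_L2 h) \<le> r / 4 \<and> n \<ge> 1"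
    using \<open>r > 0\<close>
    by (intro eventually_conj step_fun_cell_mean_tendsto_continuous[OF h(1,2)] eventually_ge_at_top) simp
  then obtain N where N: "\<And>n. n \<ge> N \<Longrightarrow> n \<ge> 1 \<and> norm (step_fun n (cell_mean n (abs_L2 h)) - abs_L2 h) \<le> r / 4"
    by (auto simp: eventually_sequentially)
  have "norm (step_fun n (cell_mean n V) - V) < r" if "n \<ge> N" for n
  proof -
    let ?P = "\<lambda>V. step_fun n (cell_mean n V)"
    have "?P V - V = (?P V - ?P (abs_L2 h)) + (?P (abs_L2 h) - abs_L2 h) + (abs_L2 h - V)"
      by simp
    also have "norm \<dots> \<le> norm (?P V - ?P (abs_L2 h)) + norm (?P (abs_L2 h) - abs_L2 h) + norm (abs_L2 h - V)"
      by (intro norm_triangle_le add_mono) simp_all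
    also have "\<dots> \<le> norm (V - abs_L2 h) + r / 4 + r / 4"
      using N[OF that] hV norm_step_fun_cell_mean_diff_le[of n V "abs_L2 h"] by auto
    also have "\<dots> < r" using hV \<open>r > 0\<close> by (simp add: norm_minus_commute)
    finally show ?thesis .
  qed
  then show "\<exists>N. \<forall>n\<ge>N. norm (norm (step_fun n (cell_mean n V) - V) - 0) < r"
    by auto
qed

section \<open>The product measure on the unit square\<close>

abbreviation lebII :: "(real \<times> real) measure" where
  "lebII \<equiv> lebI \<Otimes>\<^sub>M lebI"

interpretation lebII: pair_prob_space lebI lebI
  unfolding pair_prob_space_def pair_sigma_finite_def
  by (simp add: prob_space_lebI prob_space_imp_sigma_finite)

lemma measurable_ident_lebII: "(\<lambda>z. z) \<in> lebII \<rightarrow>\<^sub>M borel"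
proof -
  have "(\<lambda>z. (fst z, snd z)) \<in> lebII \<rightarrow>\<^sub>M borel \<Otimes>\<^sub>M borel"
    by (intro measurable_Pair measurable_compose[OF measurable_fst measurable_ident_lebI]
        measurable_compose[OF measurable_snd measurable_ident_lebI])
  then show ?thesis by (simp add: borel_prod)
qed

lemma borel_imp_lebII: "h \<in> borel_measurable borel \<Longrightarrow> h \<in> borel_measurable lebII"
  by (rule measurable_compose[OF measurable_ident_lebII])

lemma measurable_ident_lebesgue_on: "(\<lambda>z. z) \<in> lebesgue_on S \<rightarrow>\<^sub>M borel"
  by (intro measurable_restrict_space1 measurable_completion) simp

lemma space_lebII: "space lebII = {0..1} \<times> {0..1}"
  by (simp add: space_pair_measure)

text \<open>Lebesgue measure on the square is a proper completion of the product measure, so the two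
  are compared on the Borel sets.\<close>

lemma distr_lebII:
  "distr lebII borel (\<lambda>z. z) = distr (lebesgue_on ({0..1} \<times> {0..1})) borel (\<lambda>z. z)"
proof (rule measure_eqI)
  fix A :: "(real \<times> real) set"
  assume "A \<in> sets (distr lebII borel (\<lambda>z. z))"
  then have A: "A \<in> sets borel" by simp
  \<comment> \<open>Inside the square all sections lie in [0,1] and are empty outside it, so
    restricted and full measures may be exchanged in both variables.\<close>
  define F where "F = A \<inter> ({0..1} \<times> {0..1})"
  have F: "F \<in> sets borel"
    unfolding F_def using A by (intro sets.Int[OF A] borel_closed closed_Times) auto
  have FP: "F \<in> sets lebII"
    using measurable_sets[OF measurable_ident_lebII F] by (simp add: space_lebII F_def Int_assoc)
  have sec: "Pair x -` F \<in> sets borel" for x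
    by (rule sets_Pair1[where ?M1.0=borel]) (unfold borel_prod, rule F)
  have sub: "Pair x -` F \<subseteq> {0..1}" for x
    by (auto simp: F_def)
  have "emeasure (distr lebII borel (\<lambda>z. z)) A = emeasure lebII F"
    using A by (subst emeasure_distr) (auto simp: space_lebII F_def measurable_ident_lebII)
  also have "\<dots> = (\<integral>\<^sup>+x. emeasure lebI (Pair x -` F) \<partial>lebI)"
    by (rule sigma_finite_measure.emeasure_pair_measure_alt[OF prob_space_imp_sigma_finite[OF prob_space_lebI] FP])
  also have "\<dots> = (\<integral>\<^sup>+x. emeasure lborel (Pair x -` F) \<partial>lebI)"
  proof (rule nn_integral_cong)
    fix x
    have "emeasure lebI (Pair x -` F) = emeasure lebesgue (Pair x -` F)"
      using sub by (intro emeasure_restrict_space) auto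
    then show "emeasure lebI (Pair x -` F) = emeasure lborel (Pair x -` F)"
      using sec by simp
  qed
  also have "\<dots> = (\<integral>\<^sup>+x. emeasure lborel (Pair x -` F) * indicator {0..1} x \<partial>lebesgue)"
    by (rule nn_integral_restrict_space) simp
  also have "\<dots> = (\<integral>\<^sup>+x. emeasure lborel (Pair x -` F) \<partial>lebesgue)"
  proof (rule nn_integral_cong)
    show "emeasure lborel (Pair x -` F) * indicator {0..1} x = emeasure lborel (Pair x -` F)" for x
      by (cases "x \<in> {0..1}") (auto simp: F_def)
  qed
  also have "\<dots> = (\<integral>\<^sup>+x. emeasure lborel (Pair x -` F) \<partial>lborel)"
    by (rule nn_integral_completion)
  also have "\<dots> = emeasure (lborel \<Otimes>\<^sub>M lborel) F"
    using F by (intro lborel.emeasure_pair_measure_alt[symmetric]) (simp only: lborel_prod sets_lborel)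
  also have "\<dots> = emeasure lebesgue F"
    using F by (simp add: lborel_prod)
  also have "\<dots> = emeasure (lebesgue_on ({0..1} \<times> {0..1})) F"
    by (intro emeasure_restrict_space[symmetric]) (auto simp: F_def lmeasurable_iff_integrable closed_Times borel_closed)
  also have "\<dots> = emeasure (distr (lebesgue_on ({0..1} \<times> {0..1})) borel (\<lambda>z. z)) A"
    using A by (subst emeasure_distr) (auto simp: F_def measurable_ident_lebesgue_on)
  finally show "emeasure (distr lebII borel (\<lambda>z. z)) A
      = emeasure (distr (lebesgue_on ({0..1} \<times> {0..1})) borel (\<lambda>z. z)) A" .
qed simp

lemma
  fixes h :: "real \<times> real \<Rightarrow> real"
  assumes h: "h \<in> borel_measurable borel"
  shows integral_lebesgue_square: "(LINT z|lebesgue_on ({0..1} \<times> {0..1}). h z) = (LINT z|lebII. h z)"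
    and integrable_lebesgue_square:
      "integrable (lebesgue_on ({0..1} \<times> {0..1})) h \<longleftrightarrow> integrable lebII h"
proof -
  let ?Q = "lebesgue_on ({0..1} \<times> {0..1}) :: (real \<times> real) measure"
  have "(LINT z|?Q. h z) = (LINT z|distr ?Q borel (\<lambda>z. z). h z)"
    by (rule integral_distr[OF measurable_ident_lebesgue_on h, symmetric])
  also have "\<dots> = (LINT z|lebII. h z)"
    unfolding distr_lebII[symmetric] by (rule integral_distr[OF measurable_ident_lebII h])
  finally show "(LINT z|?Q. h z) = (LINT z|lebII. h z)" .
  have "integrable ?Q h \<longleftrightarrow> integrable (distr ?Q borel (\<lambda>z. z)) h"
    by (rule integrable_distr_eq[OF measurable_ident_lebesgue_on h, symmetric])
  also have "\<dots> \<longleftrightarrow> integrable lebII h"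
    unfolding distr_lebII[symmetric] by (rule integrable_distr_eq[OF measurable_ident_lebII h])
  finally show "integrable ?Q h \<longleftrightarrow> integrable lebII h" .
qed

section \<open>Borel versions of functions and kernels\<close>

lemma AE_lebI_imp_measurable:
  fixes h k :: "real \<Rightarrow> real"
  assumes h: "h \<in> borel_measurable lebI" and ae: "AE x in lebI. k x = h x"
  shows "k \<in> borel_measurable lebI"
proof -
  \<comment> \<open>Completeness makes a function measurable as soon as it agrees almost everywhere
    with a measurable one. The product \<open>lebII\<close> is not complete, so this is applied to
    functions of one variable.\<close>
  interpret complete_measure lebI
  proof
    fix A B assume "A \<subseteq> B" "B \<in> null_sets lebI"
    then have "B \<in> null_sets lebesgue" "B \<subseteq> {0..1}"
      by (auto simp: null_sets_restrict_space)
    then have "A \<in> sets lebesgue" "A \<subseteq> {0..1}"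
      using \<open>A \<subseteq> B\<close> completion.complete[of A B lborel] by auto
    then show "A \<in> sets lebI"
      by (simp add: sets_restrict_space_iff)
  qed
  show ?thesis
  proof (rule measurableI)
    fix S :: "real set" assume S: "S \<in> sets borel"
    show "k -` S \<inter> space lebI \<in> sets lebI"
    proof (rule in_sets_AE)
      show "h -` S \<inter> space lebI \<in> sets lebI"
        by (rule measurable_sets[OF h S])
      show "AE x in lebI. (x \<in> h -` S \<inter> space lebI) = (x \<in> k -` S \<inter> space lebI)"
        using ae by eventually_elim auto
    qed auto
  qed simp
qed

text \<open>Square integrability of \<open>k\<close> is a conclusion: the functions under
  \<open>abs_L2\<close> in \<open>coupling\<close> and \<open>superposition\<close> are built from
  \<open>rep_L2\<close>, known only up to null sets.\<close>

lemma abs_L2_cong_AE: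
  assumes h: "sq_integrable lebI h" and ae: "AE x in lebI. k x = h x"
  shows "sq_integrable lebI k" "abs_L2 k = abs_L2 h"
proof -
  have [measurable]: "h \<in> borel_measurable lebI" using h by (rule sq_integrable_measurable)
  have [measurable]: "k \<in> borel_measurable lebI"
    by (rule AE_lebI_imp_measurable[OF _ ae]) measurable
  have "integrable lebI (\<lambda>x. (k x)\<^sup>2) \<longleftrightarrow> integrable lebI (\<lambda>x. (h x)\<^sup>2)"
    using ae by (intro integrable_cong_AE) auto
  then show k: "sq_integrable lebI k"
    using h by (simp add: sq_integrable_def)
  show "abs_L2 k = abs_L2 h"
    using Quotient3_rel[OF Quotient3_L2, of k h] h k ae by simp
qed

text \<open>The exceptional set is produced explicitly as a Borel null set, since for kernels it has
  to be carried from Lebesgue measure on the square to \<open>lebII\<close>.\<close>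

lemma lebesgue_on_AE_borel:
  fixes h :: "'a::euclidean_space \<Rightarrow> real"
  assumes S: "S \<in> sets lebesgue" and h: "h \<in> borel_measurable (lebesgue_on S)"
  obtains k N where "k \<in> borel_measurable borel" "N \<in> null_sets lborel" "\<And>x. x \<in> S - N \<Longrightarrow> h x = k x"
proof -
  have "(\<lambda>x. if x \<in> S then h x else 0) \<in> borel_measurable lebesgue"
    using h S by (subst borel_measurable_if) auto
  then obtain k where k: "k \<in> borel_measurable lborel" "AE x in lborel. (if x \<in> S then h x else 0) = k x"
    using completion_ex_borel_measurable_real by blast
  from k(2) obtain N where N: "N \<in> null_sets lborel" "{x. (if x \<in> S then h x else 0) \<noteq> k x} \<subseteq> N"
    unfolding eventually_ae_filter by auto
  show thesis
  proof (rule that[OF _ N(1)])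
    show "k \<in> borel_measurable borel" using k(1) by simp
    show "h x = k x" if "x \<in> S - N" for x
    proof (rule ccontr)
      assume "h x \<noteq> k x"
      then have "x \<in> {x. (if x \<in> S then h x else 0) \<noteq> k x}" using that by simp
      with that N(2) show False by blast
    qed
  qed
qed

lemma L2_borel_rep:
  obtains v where "v \<in> borel_measurable borel" "sq_integrable lebI v" "V = abs_L2 v"
    "AE x in lebI. rep_L2 V x = v x"
proof -
  have sq: "sq_integrable lebI (rep_L2 V)" by (rule sq_integrable_rep)
  obtain k N where k: "k \<in> borel_measurable borel" and N: "N \<in> null_sets lborel"
    and eq: "\<And>x. x \<in> {0..1} - N \<Longrightarrow> rep_L2 V x = k x"
    by (rule lebesgue_on_AE_borel[OF _ sq_integrable_measurable[OF sq]]) auto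
  have "AE x in lebesgue. x \<notin> N"
    using N by (intro AE_completion AE_not_in)
  then have ae: "AE x in lebI. rep_L2 V x = k x"
    by (subst AE_restrict_space_iff) (auto elim!: eventually_mono intro!: eq)
  then have ae': "AE x in lebI. k x = rep_L2 V x" by eventually_elim simp
  show thesis
    using abs_L2_cong_AE[OF sq ae'] ae k by (intro that[of k]) (simp_all add: abs_rep_L2)
qed

lemma square_lebesgue [simp]: "{0..1::real} \<times> {0..1::real} \<in> sets lebesgue"
  by (intro sets_completionI_sets) (simp add: borel_closed closed_Times)

text \<open>Makes Fubini's theorem on \<open>lebII\<close> available. Agreement is recorded twice:
  almost everywhere on the square for the cell averages, and on almost every section for the
  coupling integral. Cutting at 0 turns nonnegativity almost everywhere into nonnegativity
  everywhere.\<close>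

lemma kernel_borel_version:
  assumes W: "sq_integrable (lebesgue_on ({0..1} \<times> {0..1})) W"
    and nonneg: "AE z in lebesgue_on ({0..1} \<times> {0..1}). 0 \<le> W z"
  obtains W' where "W' \<in> borel_measurable borel" "\<And>z. 0 \<le> W' z" "integrable lebII (\<lambda>z. (W' z)\<^sup>2)"
    "AE z in lebesgue_on ({0..1} \<times> {0..1}). W z = W' z"
    "AE x in lebI. AE y in lebI. W (x, y) = W' (x, y)"
proof -
  let ?Q = "{0..1} \<times> {0..1} :: (real \<times> real) set"
  have Wm: "W \<in> borel_measurable (lebesgue_on ?Q)"
    using W by (rule sq_integrable_measurable)
  obtain k N where k [measurable]: "k \<in> borel_measurable borel" and N: "N \<in> null_sets lborel"
    and eq: "\<And>z. z \<in> ?Q - N \<Longrightarrow> W z = k z"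
    by (rule lebesgue_on_AE_borel[OF _ Wm]) auto
  have aeN: "AE z in lebesgue_on ?Q. z \<notin> N"
    using AE_completion[OF AE_not_in[OF N]] by (subst AE_restrict_space_iff) (auto elim!: eventually_mono)
  have "AE z in lebesgue_on ?Q. 0 \<le> k z"
    using aeN nonneg AE_space by eventually_elim (use eq in force)
  \<comment> \<open>\<open>N\<close> and \<open>k\<close> are Borel, so the statement can be read on
    the common Borel image of both measures and pulled back to \<open>lebII\<close>.\<close>
  then have "AE z in distr (lebesgue_on ?Q) borel (\<lambda>z. z). z \<notin> N \<and> 0 \<le> k z"
    using N aeN by (subst AE_distr_iff[OF measurable_ident_lebesgue_on])
      (auto simp: null_sets_def intro!: eventually_conj)
  then have "AE z in lebII. z \<notin> N \<and> 0 \<le> k z"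
    unfolding distr_lebII[symmetric] using N
    by (subst (asm) AE_distr_iff[OF measurable_ident_lebII]) (auto simp: null_sets_def)
  then have ae2: "AE x in lebI. AE y in lebI. (x, y) \<notin> N \<and> 0 \<le> k (x, y)"
    by (rule lebII.AE_pair)
  let ?W = "\<lambda>z. max 0 (k z)"
  have Wae: "AE z in lebesgue_on ?Q. W z = ?W z"
    using aeN nonneg AE_space by eventually_elim (use eq in force)
  show thesis
  proof (rule that[of ?W])
    have "integrable (lebesgue_on ?Q) (\<lambda>z. (?W z)\<^sup>2) \<longleftrightarrow> integrable (lebesgue_on ?Q) (\<lambda>z. (W z)\<^sup>2)"
    proof (rule integrable_cong_AE)
      show "(\<lambda>z. (?W z)\<^sup>2) \<in> borel_measurable (lebesgue_on ?Q)"
        by (rule measurable_compose[OF measurable_ident_lebesgue_on]) simp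
      show "(\<lambda>z. (W z)\<^sup>2) \<in> borel_measurable (lebesgue_on ?Q)"
        using Wm by simp
      show "AE z in lebesgue_on ?Q. (?W z)\<^sup>2 = (W z)\<^sup>2"
        using Wae by eventually_elim simp
    qed
    then show "integrable lebII (\<lambda>z. (?W z)\<^sup>2)"
      using W by (simp add: integrable_lebesgue_square sq_integrable_def)
    show "AE x in lebI. AE y in lebI. W (x, y) = ?W (x, y)"
      using ae2 AE_space
    proof eventually_elim
      case (elim x)
      from elim(1) AE_space show ?case
      proof eventually_elim
        case (elim y)
        then show ?case using eq[of "(x, y)"] \<open>x \<in> space lebI\<close> by auto
      qed
    qed
  qed (use Wae in auto)
qed

lemma indicator_cell_Times:
  "indicator (cell n i \<times> cell n j) z = (indicator (cell n i) (fst z) * indicator (cell n j) (snd z) :: real)"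
  by (cases z) (auto simp: indicator_def)

text \<open>The bridge from averages over completed Lebesgue measure to integrals over
  \<open>lebII\<close>. Only the version \<open>V'\<close> has to be Borel.\<close>

lemma cell_avg_cong:
  assumes V: "V \<in> borel_measurable (lebesgue_on ({0..1} \<times> {0..1}))"
    and V': "V' \<in> borel_measurable borel"
    and ae: "AE z in lebesgue_on ({0..1} \<times> {0..1}). V z = V' z"
    and ij: "i \<in> {1..n}" "j \<in> {1..n}"
  shows "cell_avg n V i j
    = (real n)\<^sup>2 * (LINT z|lebII. V' z * (indicator (cell n i) (fst z) * indicator (cell n j) (snd z)))"
proof -
  let ?Q = "{0..1} \<times> {0..1} :: (real \<times> real) set"
  let ?I = "indicator (cell n i \<times> cell n j) :: real \<times> real \<Rightarrow> real"
  have I [measurable]: "?I \<in> borel_measurable borel"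
    unfolding borel_prod[symmetric] by measurable
  have IQ: "?I \<in> borel_measurable (lebesgue_on ?Q)"
    by (rule measurable_compose[OF measurable_ident_lebesgue_on I])
  have V'Q: "V' \<in> borel_measurable (lebesgue_on ?Q)"
    by (rule measurable_compose[OF measurable_ident_lebesgue_on V'])
  have sub: "cell n i \<times> cell n j \<subseteq> ?Q"
    using cell_subset[OF ij(1)] cell_subset[OF ij(2)] by (auto simp: subset_eq)
  have "(LINT z:cell n i \<times> cell n j|lebesgue. V z) = (LINT z|lebesgue. indicator ?Q z *\<^sub>R (?I z * V z))"
    unfolding set_lebesgue_integral_def using sub
    by (intro Bochner_Integration.integral_cong) (auto simp: indicator_def)
  also have "\<dots> = (LINT z|lebesgue_on ?Q. ?I z * V z)"
    by (rule integral_restrict_space[symmetric]) simp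
  also have "\<dots> = (LINT z|lebesgue_on ?Q. V' z * ?I z)"
    using V V'Q IQ ae by (intro integral_cong_AE) auto
  also have "\<dots> = (LINT z|lebII. V' z * ?I z)"
    using V' by (intro integral_lebesgue_square borel_measurable_times I)
  finally show ?thesis
    by (simp add: cell_avg_def indicator_cell_Times)
qed

text \<open>Jensen's inequality in the second variable followed by Fubini.\<close>

lemma
  assumes H [measurable]: "H \<in> borel_measurable lebII" and int: "integrable lebII (\<lambda>z. (H z)\<^sup>2)"
  shows sq_integrable_partial: "sq_integrable lebI (\<lambda>x. LINT y|lebI. H (x, y))"
    and norm_partial_le: "norm (abs_L2 (\<lambda>x. LINT y|lebI. H (x, y))) \<le> sqrt (LINT z|lebII. (H z)\<^sup>2)"
    and AE_sq_integrable_partial: "AE x in lebI. sq_integrable lebI (\<lambda>y. H (x, y))"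
proof -
  let ?h = "\<lambda>x. LINT y|lebI. H (x, y)"
  have hm [measurable]: "?h \<in> borel_measurable lebI"
    by measurable
  show sec: "AE x in lebI. sq_integrable lebI (\<lambda>y. H (x, y))"
    using lebII.AE_integrable_fst'[OF int] AE_space
    by eventually_elim (auto simp: sq_integrable_def intro!: measurable_Pair2[OF H])
  have le: "AE x in lebI. (?h x)\<^sup>2 \<le> (LINT y|lebI. (H (x, y))\<^sup>2)"
    using sec
  proof eventually_elim
    case (elim x)
    have "\<bar>?h x\<bar> \<le> (LINT y|lebI. \<bar>H (x, y)\<bar>)"
      by (rule integral_abs_bound)
    also have "\<dots> \<le> sqrt (LINT y|lebI. (H (x, y))\<^sup>2)"
      using L1_le_norm_L2(2)[OF elim] by (simp add: norm_abs_L2[OF elim])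
    finally have "(\<bar>?h x\<bar>)\<^sup>2 \<le> (sqrt (LINT y|lebI. (H (x, y))\<^sup>2))\<^sup>2"
      by (intro power_mono) auto
    then show ?case by simp
  qed
  have int2: "integrable lebI (\<lambda>x. LINT y|lebI. (H (x, y))\<^sup>2)"
    by (rule lebII.integrable_fst'[OF int])
  have inth: "integrable lebI (\<lambda>x. (?h x)\<^sup>2)"
    using le by (intro Bochner_Integration.integrable_bound[OF int2]) (auto elim!: eventually_mono)
  then show sqh: "sq_integrable lebI ?h"
    by (simp add: sq_integrable_def)
  have "(LINT x|lebI. (?h x)\<^sup>2) \<le> (LINT x|lebI. (LINT y|lebI. (H (x, y))\<^sup>2))"
    by (rule integral_mono_AE[OF inth int2 le])
  also have "\<dots> = (LINT z|lebII. (H z)\<^sup>2)"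
    by (rule lebII.integral_fst'[OF int])
  finally show "norm (abs_L2 ?h) \<le> sqrt (LINT z|lebII. (H z)\<^sup>2)"
    by (simp add: norm_abs_L2[OF sqh])
qed

lemma integrable_sq_diff:
  assumes "sq_integrable M h" "sq_integrable M k"
  shows "integrable M (\<lambda>x. (h x - k x)\<^sup>2)"
  using sq_integrable_diff[OF assms] by (simp add: sq_integrable_def)

text \<open>The two inner integrals may be subtracted where both sections are integrable, that is
  for almost every x, and classes ignore the other points.\<close>

lemma norm_partial_diff_le:
  assumes H: "sq_integrable lebII H" and K: "sq_integrable lebII K"
  shows "norm (abs_L2 (\<lambda>x. LINT y|lebI. H (x, y)) - abs_L2 (\<lambda>x. LINT y|lebI. K (x, y)))
    \<le> sqrt (LINT z|lebII. (H z - K z)\<^sup>2)"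
proof -
  note H' = H[unfolded sq_integrable_def, THEN conjunct1] H[unfolded sq_integrable_def, THEN conjunct2]
  note K' = K[unfolded sq_integrable_def, THEN conjunct1] K[unfolded sq_integrable_def, THEN conjunct2]
  have d: "sq_integrable lebII (\<lambda>z. H z - K z)" by (rule sq_integrable_diff[OF H K])
  note d' = d[unfolded sq_integrable_def, THEN conjunct1] d[unfolded sq_integrable_def, THEN conjunct2]
  have ae: "AE x in lebI. (LINT y|lebI. H (x, y)) - (LINT y|lebI. K (x, y)) = (LINT y|lebI. H (x, y) - K (x, y))"
    using AE_sq_integrable_partial[OF H'] AE_sq_integrable_partial[OF K']
    by eventually_elim (simp add: L1_le_norm_L2(1))
  have "abs_L2 (\<lambda>x. LINT y|lebI. H (x, y)) - abs_L2 (\<lambda>x. LINT y|lebI. K (x, y))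
    = abs_L2 (\<lambda>x. (LINT y|lebI. H (x, y)) - (LINT y|lebI. K (x, y)))"
    by (intro minus_abs_L2 sq_integrable_partial H' K')
  also have "\<dots> = abs_L2 (\<lambda>x. LINT y|lebI. H (x, y) - K (x, y))"
    by (rule abs_L2_cong_AE(2)[OF sq_integrable_partial[OF d'] ae])
  finally show ?thesis
    using norm_partial_le[OF d'] by simp
qed

section \<open>Marginals of the product measure\<close>

lemma emeasure_lebI_Times:
  "A \<in> sets lebI \<Longrightarrow> B \<in> sets lebI \<Longrightarrow> emeasure lebII (A \<times> B) = emeasure lebI A * emeasure lebI B"
  by (rule sigma_finite_measure.emeasure_pair_measure_Times[OF prob_space_imp_sigma_finite[OF prob_space_lebI]])

lemma distr_lebII_fst: "distr lebII lebI fst = lebI"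
proof (rule measure_eqI)
  fix A assume "A \<in> sets (distr lebII lebI fst)"
  then have A: "A \<in> sets lebI" by simp
  then have "fst -` A \<inter> space lebII = A \<times> space lebI"
    using sets.sets_into_space[OF A] by (auto simp: space_pair_measure)
  then have "emeasure (distr lebII lebI fst) A = emeasure lebI A * emeasure lebI (space lebI)"
    by (simp only: emeasure_distr[OF measurable_fst A] emeasure_lebI_Times[OF A sets.top])
  then show "emeasure (distr lebII lebI fst) A = emeasure lebI A"
    by (simp only: prob_space.emeasure_space_1[OF prob_space_lebI] mult_1 mult_1_right)
qed simp

lemma distr_lebII_snd: "distr lebII lebI snd = lebI"
proof (rule measure_eqI)
  fix A assume "A \<in> sets (distr lebII lebI snd)"
  then have A: "A \<in> sets lebI" by simp
  then have "snd -` A \<inter> space lebII = space lebI \<times> A"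
    using sets.sets_into_space[OF A] by (auto simp: space_pair_measure)
  then have "emeasure (distr lebII lebI snd) A = emeasure lebI (space lebI) * emeasure lebI A"
    by (simp only: emeasure_distr[OF measurable_snd A] emeasure_lebI_Times[OF sets.top A])
  then show "emeasure (distr lebII lebI snd) A = emeasure lebI A"
    by (simp only: prob_space.emeasure_space_1[OF prob_space_lebI] mult_1 mult_1_right)
qed simp

lemma
  fixes h :: "real \<Rightarrow> real"
  assumes h: "integrable lebI h"
  shows integrable_lebII_fst: "integrable lebII (\<lambda>z. h (fst z))"
    and integral_lebII_fst: "(LINT z|lebII. h (fst z)) = (LINT x|lebI. h x)"
    and integrable_lebII_snd: "integrable lebII (\<lambda>z. h (snd z))"
    and integral_lebII_snd: "(LINT z|lebII. h (snd z)) = (LINT x|lebI. h x)"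
proof -
  have m: "h \<in> borel_measurable lebI" using h by simp
  show "integrable lebII (\<lambda>z. h (fst z))"
    using integrable_distr_eq[OF measurable_fst[of lebI lebI] m] h by (simp add: distr_lebII_fst)
  show "(LINT z|lebII. h (fst z)) = (LINT x|lebI. h x)"
    using integral_distr[OF measurable_fst[of lebI lebI] m] by (simp add: distr_lebII_fst)
  show "integrable lebII (\<lambda>z. h (snd z))"
    using integrable_distr_eq[OF measurable_snd[of lebI lebI] m] h by (simp add: distr_lebII_snd)
  show "(LINT z|lebII. h (snd z)) = (LINT x|lebI. h x)"
    using integral_distr[OF measurable_snd[of lebI lebI] m] by (simp add: distr_lebII_snd)
qed

section \<open>The superposition operator\<close>

lemma lipschitz_borel_measurable:
  fixes \<phi> :: "real \<Rightarrow> real"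
  assumes "L-lipschitz_on UNIV \<phi>"
  shows "\<phi> \<in> borel_measurable borel"
  using lipschitz_on_continuous_on[OF assms] by (rule borel_measurable_continuous_onI)

lemma lipschitz_on_UNIV_abs:
  fixes \<phi> :: "real \<Rightarrow> real"
  assumes "L-lipschitz_on UNIV \<phi>"
  shows "\<bar>\<phi> x - \<phi> y\<bar> \<le> L * \<bar>x - y\<bar>"
  using lipschitz_onD[OF assms, of x y] by (simp add: dist_real_def)

text \<open>A Lipschitz function grows at most linearly, and constants are square integrable on a
  probability space.\<close>

lemma sq_integrable_lipschitz:
  fixes \<phi> :: "real \<Rightarrow> real"
  assumes \<phi>: "L-lipschitz_on UNIV \<phi>" and v: "sq_integrable lebI v"
  shows "sq_integrable lebI (\<lambda>x. \<phi> (v x))"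
  unfolding sq_integrable_def
proof
  show m: "(\<lambda>x. \<phi> (v x)) \<in> borel_measurable lebI"
    by (rule measurable_compose[OF sq_integrable_measurable[OF v] lipschitz_borel_measurable[OF \<phi>]])
  have b: "(\<phi> y)\<^sup>2 \<le> 2 * (\<phi> 0)\<^sup>2 + 2 * L\<^sup>2 * y\<^sup>2" for y
  proof -
    have "\<bar>\<phi> y - \<phi> 0\<bar>\<^sup>2 \<le> (L * \<bar>y\<bar>)\<^sup>2"
      using lipschitz_on_UNIV_abs[OF \<phi>, of y 0] by (intro power_mono) auto
    then have "(\<phi> y - \<phi> 0)\<^sup>2 \<le> L\<^sup>2 * y\<^sup>2" by (simp add: power_mult_distrib)
    moreover have "(\<phi> y)\<^sup>2 \<le> 2 * (\<phi> 0)\<^sup>2 + 2 * (\<phi> y - \<phi> 0)\<^sup>2"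
      using zero_le_power2[of "\<phi> y - 2 * \<phi> 0"] by (simp add: power2_eq_square algebra_simps)
    ultimately show ?thesis by simp
  qed
  interpret prob_space lebI by (rule prob_space_lebI)
  show "integrable lebI (\<lambda>x. (\<phi> (v x))\<^sup>2)"
  proof (rule Bochner_Integration.integrable_bound)
    show "integrable lebI (\<lambda>x. 2 * (\<phi> 0)\<^sup>2 + 2 * L\<^sup>2 * (v x)\<^sup>2)"
      using v by (auto simp: sq_integrable_def)
    show "AE x in lebI. norm ((\<phi> (v x))\<^sup>2) \<le> norm (2 * (\<phi> 0)\<^sup>2 + 2 * L\<^sup>2 * (v x)\<^sup>2)"
      using b by (intro AE_I2) (auto intro: order_trans[OF _ abs_ge_self])
  qed (use m in auto)
qed

lemma norm_superposition_diff_le: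
  assumes f: "L-lipschitz_on UNIV (\<lambda>v. f v t)"
  shows "norm (superposition f t U - superposition f t V) \<le> L * norm (U - V)"
proof -
  let ?u = "rep_L2 U" and ?v = "rep_L2 V"
  have sq: "sq_integrable lebI (\<lambda>x. f (?u x) t)" "sq_integrable lebI (\<lambda>x. f (?v x) t)"
    by (intro sq_integrable_lipschitz[OF f] sq_integrable_rep)+
  have L: "0 \<le> L" by (rule lipschitz_on_nonneg[OF f])
  have d: "sq_integrable lebI (\<lambda>x. ?u x - ?v x)"
    by (intro sq_integrable_diff sq_integrable_rep)
  have "(LINT x|lebI. (f (?u x) t - f (?v x) t)\<^sup>2) \<le> (LINT x|lebI. L\<^sup>2 * (?u x - ?v x)\<^sup>2)"
  proof (rule integral_mono)
    show "integrable lebI (\<lambda>x. (f (?u x) t - f (?v x) t)\<^sup>2)"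
      by (rule integrable_sq_diff[OF sq])
    show "integrable lebI (\<lambda>x. L\<^sup>2 * (?u x - ?v x)\<^sup>2)"
      using d by (auto simp: sq_integrable_def)
    show "(f (?u x) t - f (?v x) t)\<^sup>2 \<le> L\<^sup>2 * (?u x - ?v x)\<^sup>2" for x
      using power_mono[OF lipschitz_on_UNIV_abs[OF f, of "?u x" "?v x"], of 2]
      by (simp add: power_mult_distrib)
  qed
  then have "sqrt (LINT x|lebI. (f (?u x) t - f (?v x) t)\<^sup>2) \<le> sqrt (L\<^sup>2 * (LINT x|lebI. (?u x - ?v x)\<^sup>2))"
    by simp
  also have "\<dots> = L * sqrt (LINT x|lebI. (?u x - ?v x)\<^sup>2)"
    using L by (simp add: real_sqrt_mult)
  also have "sqrt (LINT x|lebI. (?u x - ?v x)\<^sup>2) = norm (abs_L2 ?u - abs_L2 ?v)"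
    using d by (simp add: minus_abs_L2 sq_integrable_rep norm_abs_L2)
  finally show ?thesis
    using sq by (simp add: superposition_def minus_abs_L2 norm_abs_L2 sq_integrable_diff abs_rep_L2)
qed

text \<open>A step function has a single value on each cell, so nothing is left to average.\<close>

lemma cell_mean_superposition_step_fun:
  assumes f: "L-lipschitz_on UNIV (\<lambda>v. f v t)" and i: "i \<in> {1..n}"
  shows "cell_mean n (superposition f t (step_fun n c)) i = f (c i) t"
proof -
  let ?s = "\<lambda>x. \<Sum>k=1..n. c k * indicator (cell n k) x"
  have n: "n \<ge> 1" using i by auto
  have sq: "sq_integrable lebI (\<lambda>x. f (?s x) t)"
    by (rule sq_integrable_lipschitz[OF f sq_integrable_step_function])
  have ae: "AE x in lebI. f (rep_L2 (step_fun n c) x) t = f (?s x) t"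
    using rep_abs_L2[OF sq_integrable_step_function[where n=n and c=c]] unfolding step_fun_def
    by eventually_elim (rule arg_cong)
  have "cell_mean n (superposition f t (step_fun n c)) i = cell_mean n (abs_L2 (\<lambda>x. f (?s x) t)) i"
    unfolding superposition_def by (simp only: abs_L2_cong_AE(2)[OF sq ae])
  also have "\<dots> = real n * (LINT x|lebI. f (?s x) t * indicator (cell n i) x)"
    by (rule cell_mean_abs_L2[OF sq])
  also have "(LINT x|lebI. f (?s x) t * indicator (cell n i) x) = (LINT x|lebI. f (c i) t * indicator (cell n i) x)"
  proof (rule Bochner_Integration.integral_cong[OF refl])
    show "f (?s x) t * indicator (cell n i) x = f (c i) t * indicator (cell n i) x" for x
    proof (cases "x \<in> cell n i")
      case True
      then have "x \<in> {0<..1}" using cell_subset[OF i] by auto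
      moreover have "nat \<lceil>real n * x\<rceil> = i" using True mem_cell_iff[of n i x] i by auto
      ultimately show ?thesis by (simp only: sum_indicator_cell[OF n])
    qed simp
  qed
  also have "\<dots> = f (c i) t / real n"
    using integral_indicator_cell[OF i] by simp
  finally show ?thesis using n by simp
qed

text \<open>f at a cell mean is exactly the cell mean of the superposition at the projected state
  \<open>?P\<close>. The error is therefore the vector of cell means of a difference of two
  superpositions, and contraction and the Lipschitz bound apply.\<close>

lemma superposition_consistency:
  assumes f: "L-lipschitz_on UNIV (\<lambda>v. f v t)" and n: "n \<ge> 1"
  shows "L2_set (\<lambda>i. f (cell_mean n V i) t - cell_mean n (superposition f t V) i) {1..n}
    \<le> sqrt (real n) * (L * norm (step_fun n (cell_mean n V) - V))"
proof -
  let ?P = "step_fun n (cell_mean n V)"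
  have "L2_set (\<lambda>i. f (cell_mean n V i) t - cell_mean n (superposition f t V) i) {1..n}
      = L2_set (cell_mean n (superposition f t ?P - superposition f t V)) {1..n}"
    by (intro L2_set_cong refl) (simp only: cell_mean_diff cell_mean_superposition_step_fun[where f=f and t=t, OF f])
  also have "\<dots> \<le> sqrt (real n) * norm (superposition f t ?P - superposition f t V)"
    by (rule L2_set_cell_mean_le[OF n])
  also have "\<dots> \<le> sqrt (real n) * (L * norm (?P - V))"
    by (intro mult_left_mono norm_superposition_diff_le[where f=f and t=t, OF f]) simp
  finally show ?thesis .
qed

section \<open>The coupling operator\<close>

text \<open>\<open>W\<close> stands for a Borel version of the kernel with pointwise properties; the
  given kernel appears in the lemmas as \<open>W'\<close>, tied to it on almost every
  section.\<close>

locale coupling_kernel =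
  fixes W :: "real \<times> real \<Rightarrow> real" and D :: "real \<Rightarrow> real" and L :: real
  assumes W_borel: "W \<in> borel_measurable borel"
    and W_nonneg: "0 \<le> W z"
    and W_sq_int: "integrable lebII (\<lambda>z. (W z)\<^sup>2)"
    and D_lipschitz: "L-lipschitz_on UNIV D"
    and D_le_1: "\<bar>D x\<bar> \<le> 1"
begin

lemma W_measurable [measurable]: "W \<in> borel_measurable lebII"
  by (rule borel_imp_lebII[OF W_borel])

lemma L_nonneg: "0 \<le> L"
  by (rule lipschitz_on_nonneg[OF D_lipschitz])

lemma W_integrable: "integrable lebII W"
proof (rule Bochner_Integration.integrable_bound)
  show "integrable lebII (\<lambda>z. 1 + (W z)\<^sup>2)"
    by (intro Bochner_Integration.integrable_add W_sq_int) simp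
  have "W z \<le> 1 + (W z)\<^sup>2" for z
    using zero_le_power2[of "W z - 1"] W_nonneg[of z] by (simp add: power2_eq_square algebra_simps)
  then show "AE z in lebII. norm (W z) \<le> norm (1 + (W z)\<^sup>2)"
    using W_nonneg by (intro AE_I2) (auto intro: order_trans[OF _ abs_ge_self])
qed measurable

lemma coupling_integrand_measurable:
  assumes K: "K \<in> borel_measurable borel" and q: "q \<in> borel_measurable borel"
  shows "(\<lambda>z. K z * D (q (snd z) - q (fst z))) \<in> borel_measurable lebII"
proof -
  have [measurable]: "K \<in> borel_measurable lebII" by (rule borel_imp_lebII[OF K])
  have [measurable]: "q \<in> borel_measurable lebI" by (rule borel_imp_lebI[OF q])
  have [measurable]: "D \<in> borel_measurable borel" by (rule lipschitz_borel_measurable[OF D_lipschitz])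
  show ?thesis by measurable
qed

lemma sq_integrable_coupling_integrand:
  assumes K: "K \<in> borel_measurable borel" "\<And>z. \<bar>K z\<bar> \<le> W z" and q: "q \<in> borel_measurable borel"
  shows "sq_integrable lebII (\<lambda>z. K z * D (q (snd z) - q (fst z)))"
  unfolding sq_integrable_def
proof
  show m: "(\<lambda>z. K z * D (q (snd z) - q (fst z))) \<in> borel_measurable lebII"
    by (rule coupling_integrand_measurable[OF K(1) q])
  show "integrable lebII (\<lambda>z. (K z * D (q (snd z) - q (fst z)))\<^sup>2)"
  proof (rule Bochner_Integration.integrable_bound[OF W_sq_int])
    have "\<bar>K z * D (q (snd z) - q (fst z))\<bar> \<le> W z" for z
      using mult_mono[OF K(2) D_le_1, of z] W_nonneg[of z] by (simp add: abs_mult)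
    then have "(\<bar>K z * D (q (snd z) - q (fst z))\<bar>)\<^sup>2 \<le> (W z)\<^sup>2" for z
      by (intro power_mono) auto
    then show "AE z in lebII. norm ((K z * D (q (snd z) - q (fst z)))\<^sup>2) \<le> norm ((W z)\<^sup>2)"
      by (intro AE_I2) simp
  qed (use m in auto)
qed

text \<open>\<open>coupling\<close> involves the given kernel and an arbitrary representative. For
  almost every x its inner integrand agrees with the Borel one for almost every y, which determines
  the class.\<close>

lemma coupling_eq:
  assumes v: "v \<in> borel_measurable borel" "AE x in lebI. rep_L2 V x = v x"
    and W': "AE x in lebI. AE y in lebI. W' (x, y) = W (x, y)"
  shows "coupling W' D V = abs_L2 (\<lambda>x. LINT y|lebI. W (x, y) * D (v y - v x))"
proof -
  let ?H = "\<lambda>z. W z * D (v (snd z) - v (fst z))"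
  have H: "sq_integrable lebII ?H"
    using W_nonneg by (intro sq_integrable_coupling_integrand W_borel v) auto
  then have Hm: "?H \<in> borel_measurable lebII" and Hi: "integrable lebII (\<lambda>z. (?H z)\<^sup>2)"
    by (auto simp: sq_integrable_def)
  have sq: "sq_integrable lebI (\<lambda>x. LINT y|lebI. W (x, y) * D (v y - v x))"
    using sq_integrable_partial[OF Hm Hi] by simp
  have "AE x in lebI. (LINT y|lebI. W' (x, y) * D (rep_L2 V y - rep_L2 V x))
      = (LINT y|lebI. W (x, y) * D (v y - v x))"
    using W' v(2) AE_space
  proof eventually_elim
    case (elim x)
    have m: "(\<lambda>y. W (x, y) * D (v y - v x)) \<in> borel_measurable lebI"
      using measurable_Pair2[OF Hm elim(3)] by simp
    have ae: "AE y in lebI. W' (x, y) * D (rep_L2 V y - rep_L2 V x) = W (x, y) * D (v y - v x)"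
      using elim(1) v(2) by eventually_elim (simp add: elim(2))
    show ?case
      by (rule integral_cong_AE[OF AE_lebI_imp_measurable[OF m ae] m ae])
  qed
  then show ?thesis
    unfolding coupling_def by (rule abs_L2_cong_AE(2)[OF sq])
qed

lemma cell_avg_eq:
  assumes K: "K \<in> borel_measurable borel" and ij: "i \<in> {1..n}" "j \<in> {1..n}"
  shows "cell_avg n K i j
    = (real n)\<^sup>2 * (LINT z|lebII. K z * (indicator (cell n i) (fst z) * indicator (cell n j) (snd z)))"
  by (rule cell_avg_cong[OF _ K _ ij]) (auto intro: measurable_compose[OF measurable_ident_lebesgue_on K])

lemma integrable_cell_integrand:
  assumes K: "K \<in> borel_measurable borel" "\<And>z. \<bar>K z\<bar> \<le> W z"
  shows "integrable lebII (\<lambda>z. K z * (indicator (cell n i) (fst z) * indicator (cell n j) (snd z)))"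
proof (rule Bochner_Integration.integrable_bound[OF W_integrable])
  have [measurable]: "K \<in> borel_measurable lebII" by (rule borel_imp_lebII[OF K(1)])
  have [measurable]: "(indicator (cell n i) :: real \<Rightarrow> real) \<in> borel_measurable lebI" for i
    by (rule sq_integrable_measurable[OF sq_integrable_indicator]) simp
  show "(\<lambda>z. K z * (indicator (cell n i) (fst z) * indicator (cell n j) (snd z))) \<in> borel_measurable lebII"
    by measurable
  show "AE z in lebII. norm (K z * (indicator (cell n i) (fst z) * indicator (cell n j) (snd z))) \<le> norm (W z)"
    using K(2) W_nonneg by (intro AE_I2) (auto simp: indicator_def)
qed

text \<open>At a step state the phase difference is constant on every product of cells, so averaging
  the integral coupling gives the finite coupling with averaged weights without error. The
  discretisation error thus becomes a distance between two elements of L2(I).\<close>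

lemma cell_mean_coupling_step:
  fixes c :: "nat \<Rightarrow> real"
  assumes K: "K \<in> borel_measurable borel" "\<And>z. \<bar>K z\<bar> \<le> W z" and i: "i \<in> {1..n}"
  defines "s \<equiv> \<lambda>x. \<Sum>k=1..n. c k * indicator (cell n k) x"
  shows "cell_mean n (abs_L2 (\<lambda>x. LINT y|lebI. K (x, y) * D (s y - s x))) i
    = (\<Sum>j=1..n. cell_avg n K i j * D (c j - c i)) / real n"
proof -
  have n: "n \<ge> 1" using i by auto
  let ?H = "\<lambda>z. K z * D (s (snd z) - s (fst z))"
  let ?I = "\<lambda>i x. indicator (cell n i) x :: real"
  have sb: "s \<in> borel_measurable borel"
    unfolding s_def by measurable
  have H: "sq_integrable lebII ?H"
    by (intro sq_integrable_coupling_integrand K sb)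
  then have Hm [measurable]: "?H \<in> borel_measurable lebII" and Hi: "integrable lebII (\<lambda>z. (?H z)\<^sup>2)"
    by (auto simp: sq_integrable_def)
  have [measurable]: "?I i \<in> borel_measurable lebI" for i
    by (rule sq_integrable_measurable[OF sq_integrable_indicator]) simp
  have [measurable]: "K \<in> borel_measurable lebII" by (rule borel_imp_lebII[OF K(1)])
  have sq: "sq_integrable lebI (\<lambda>x. LINT y|lebI. K (x, y) * D (s y - s x))"
    using sq_integrable_partial[OF Hm Hi] by simp
  have int: "integrable lebII (\<lambda>z. ?H z * ?I i (fst z))"
  proof (rule Bochner_Integration.integrable_bound[OF W_integrable])
    have "\<bar>?H z\<bar> \<le> W z" for z
      using mult_mono[OF K(2) D_le_1, of z] W_nonneg[of z] by (simp add: abs_mult)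
    then show "AE z in lebII. norm (?H z * ?I i (fst z)) \<le> norm (W z)"
      using W_nonneg by (intro AE_I2) (auto simp: indicator_def)
  qed measurable
  have "cell_mean n (abs_L2 (\<lambda>x. LINT y|lebI. K (x, y) * D (s y - s x))) i
      = real n * (LINT x|lebI. (LINT y|lebI. K (x, y) * D (s y - s x)) * ?I i x)"
    by (rule cell_mean_abs_L2[OF sq])
  also have "(LINT x|lebI. (LINT y|lebI. K (x, y) * D (s y - s x)) * ?I i x)
      = (LINT x|lebI. (LINT y|lebI. ?H (x, y) * ?I i (fst (x, y))))"
    by simp
  also have "\<dots> = (LINT z|lebII. ?H z * ?I i (fst z))"
    by (rule lebII.integral_fst'[OF int])
  also have "\<dots> = (LINT z|lebII. (\<Sum>j=1..n. D (c j - c i) * (K z * (?I i (fst z) * ?I j (snd z)))))"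
  proof (rule integral_cong_AE)
    \<comment> \<open>Removes y = 0, which lies in no cell; x needs no such care because the
      indicator of cell i already confines it.\<close>
    have "AE z in lebII. snd z \<in> {0<..1}"
    proof -
      have "AE y in distr lebII lebI snd. y \<in> {0<..1}"
        unfolding distr_lebII_snd by (rule AE_lebI_pos)
      then show ?thesis
        by (subst (asm) AE_distr_iff) (auto simp: sets_restrict_space_iff intro!: sets.Int)
    qed
    then show "AE z in lebII. ?H z * ?I i (fst z)
        = (\<Sum>j=1..n. D (c j - c i) * (K z * (?I i (fst z) * ?I j (snd z))))"
    proof eventually_elim
      case (elim z)
      show ?case
      proof (cases "fst z \<in> cell n i")
        case True
        then have pos: "fst z \<in> {0<..1}" using cell_subset[OF i] by auto
        have "nat \<lceil>real n * fst z\<rceil> = i" using True mem_cell_iff[of n i "fst z"] i by auto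
        then have s1: "s (fst z) = c i"
          unfolding s_def by (simp only: sum_indicator_cell[OF n pos])
        have s2: "s (snd z) = c (nat \<lceil>real n * snd z\<rceil>)"
          unfolding s_def by (simp only: sum_indicator_cell[OF n elim])
        have "(\<Sum>j=1..n. D (c j - c i) * (K z * (?I i (fst z) * ?I j (snd z))))
          = (\<Sum>j=1..n. (D (c j - c i) * K z) * ?I j (snd z))"
          using True by (simp add: mult.assoc)
        also have "\<dots> = D (c (nat \<lceil>real n * snd z\<rceil>) - c i) * K z"
          by (rule sum_indicator_cell[OF n elim])
        finally show ?thesis using True s1 s2 by simp
      qed simp
    qed
  qed measurable
  also have "\<dots> = (\<Sum>j=1..n. D (c j - c i) * (LINT z|lebII. K z * (?I i (fst z) * ?I j (snd z))))"
    using integrable_cell_integrand[OF K]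
    by (subst Bochner_Integration.integral_sum) auto
  \<comment> \<open>The mean over x supplies one factor n and \<open>cell_avg\<close> contains n^2,
    which leaves the division by n.\<close>
  also have "real n * \<dots> = (\<Sum>j=1..n. cell_avg n K i j * D (c j - c i)) / real n"
    using n by (simp add: cell_avg_eq[OF K(1) i] sum_distrib_left sum_divide_distrib power2_eq_square
        mult.commute mult.left_commute)
  finally show ?thesis .
qed

text \<open>The excess of W^2 over the level k plays the part of the tail: it bounds the squared
  truncation error and also gives W^2 <= k + excess.\<close>

lemma tail_tendsto: "(\<lambda>k. LINT z|lebII. max 0 ((W z)\<^sup>2 - real k)) \<longlonglongrightarrow> 0"
proof -
  have "(\<lambda>k. LINT z|lebII. max 0 ((W z)\<^sup>2 - real k)) \<longlonglongrightarrow> (LINT z|lebII. 0)"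
  proof (rule integral_dominated_convergence[OF _ _ W_sq_int])
    show "AE z in lebII. (\<lambda>k. max 0 ((W z)\<^sup>2 - real k)) \<longlonglongrightarrow> 0"
    proof (rule AE_I2)
      fix z
      obtain N :: nat where "(W z)\<^sup>2 \<le> real N" using real_arch_simple by blast
      then have "\<forall>\<^sub>F k in sequentially. max 0 ((W z)\<^sup>2 - real k) = 0"
        by (intro eventually_sequentiallyI[of N]) auto
      then show "(\<lambda>k. max 0 ((W z)\<^sup>2 - real k)) \<longlonglongrightarrow> 0" by (rule tendsto_eventually)
    qed
    show "AE z in lebII. norm (max 0 ((W z)\<^sup>2 - real k)) \<le> (W z)\<^sup>2" for k
      by (intro AE_I2) auto
  qed measurable
  then show ?thesis by simp
qed

text \<open>Split the difference as (min c w - w) d1 + w (d1 - d2), and let m be the excess of w^2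
  over R. The first factor has square at most m because (c - w)^2 <= w^2 - c^2 for w > c. In the
  second, w^2 <= R + m, with the bound 4 for (d1 - d2)^2 on m and the Lipschitz bound on R. This
  gives 2 + 2 * 4 = 10 and 2 * 2 = 4.\<close>

lemma truncated_kernel_bound:
  fixes w c R d1 d2 p q :: real
  assumes "0 \<le> w" "0 \<le> c" "0 \<le> R" "R \<le> c\<^sup>2" "\<bar>d1\<bar> \<le> 1" "\<bar>d2\<bar> \<le> 1"
    and d: "\<bar>d1 - d2\<bar> \<le> L * (\<bar>p\<bar> + \<bar>q\<bar>)"
  shows "(min c w * d1 - w * d2)\<^sup>2 \<le> 10 * max 0 (w\<^sup>2 - R) + 4 * R * L\<^sup>2 * (p\<^sup>2 + q\<^sup>2)"
proof -
  define m where "m = max 0 (w\<^sup>2 - R)"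
  have m: "0 \<le> m" "w\<^sup>2 \<le> R + m" by (auto simp: m_def)
  have t1: "(min c w - w)\<^sup>2 \<le> m"
  proof (cases "w \<le> c")
    case False
    then have "c * c \<le> c * w" using assms by (intro mult_left_mono) auto
    then have "(c - w)\<^sup>2 \<le> w\<^sup>2 - c\<^sup>2"
      by (simp add: power2_eq_square algebra_simps)
    then show ?thesis using False assms(4) by (simp add: m_def)
  qed (simp add: m)
  have d12: "d1\<^sup>2 \<le> 1" using assms(5) by (simp add: abs_square_le_1)
  have e1: "(d1 - d2)\<^sup>2 \<le> 4"
    using power_mono[of "\<bar>d1 - d2\<bar>" 2 2] assms(5,6) by auto
  have "\<bar>d1 - d2\<bar>\<^sup>2 \<le> (L * (\<bar>p\<bar> + \<bar>q\<bar>))\<^sup>2"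
    using d by (intro power_mono) auto
  then have "(d1 - d2)\<^sup>2 \<le> L\<^sup>2 * (\<bar>p\<bar> + \<bar>q\<bar>)\<^sup>2"
    by (simp add: power_mult_distrib)
  also have "\<dots> \<le> L\<^sup>2 * (2 * (p\<^sup>2 + q\<^sup>2))"
  proof (rule mult_left_mono)
    show "(\<bar>p\<bar> + \<bar>q\<bar>)\<^sup>2 \<le> 2 * (p\<^sup>2 + q\<^sup>2)"
      using sum_squares_bound[of "\<bar>p\<bar>" "\<bar>q\<bar>"] by (simp add: power2_sum)
  qed simp
  finally have e2: "(d1 - d2)\<^sup>2 \<le> 2 * L\<^sup>2 * (p\<^sup>2 + q\<^sup>2)" by (simp only: mult_ac)
  have "min c w * d1 - w * d2 = (min c w - w) * d1 + w * (d1 - d2)"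
    by (simp add: algebra_simps)
  also have "\<dots>\<^sup>2 \<le> 2 * ((min c w - w) * d1)\<^sup>2 + 2 * (w * (d1 - d2))\<^sup>2"
    using sum_squares_bound[of "(min c w - w) * d1" "w * (d1 - d2)"] by (simp add: power2_sum)
  also have "\<dots> = 2 * ((min c w - w)\<^sup>2 * d1\<^sup>2) + 2 * (w\<^sup>2 * (d1 - d2)\<^sup>2)"
    by (simp add: power_mult_distrib)
  also have "\<dots> \<le> 2 * (m * 1) + 2 * ((R + m) * (d1 - d2)\<^sup>2)"
    using t1 d12 m by (intro add_mono mult_left_mono mult_mono mult_right_mono) auto
  also have "(R + m) * (d1 - d2)\<^sup>2 = R * (d1 - d2)\<^sup>2 + m * (d1 - d2)\<^sup>2"
    by (simp add: algebra_simps)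
  also have "2 * (m * 1) + 2 * (R * (d1 - d2)\<^sup>2 + m * (d1 - d2)\<^sup>2)
    \<le> 2 * (m * 1) + 2 * (R * (2 * L\<^sup>2 * (p\<^sup>2 + q\<^sup>2)) + m * 4)"
    using e1 e2 m assms(3) by (intro add_mono mult_left_mono) auto
  finally show ?thesis unfolding m_def[symmetric] by (simp add: algebra_simps)
qed

text \<open>Since \<open>W\<close> is only square integrable, the coupling operator is handled by cutting \<open>W\<close> off:
  the bounded part is Lipschitz, the tail is small because \<open>D\<close> is bounded.\<close>

lemma coupling_estimate:
  assumes n: "n \<ge> 1" and c: "0 \<le> c" and R: "0 \<le> R" "R \<le> c\<^sup>2"
    and W': "AE x in lebI. AE y in lebI. W' (x, y) = W (x, y)"
  shows "L2_set (\<lambda>i. (\<Sum>j=1..n. cell_avg n (\<lambda>z. min c (W z)) i j * D (cell_mean n V j - cell_mean n V i)) / real n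
      - cell_mean n (coupling W' D V) i) {1..n}
    \<le> sqrt (real n) * sqrt (10 * (LINT z|lebII. max 0 ((W z)\<^sup>2 - R))
        + 8 * R * L\<^sup>2 * (norm (step_fun n (cell_mean n V) - V))\<^sup>2)"
proof -
  obtain v where v: "v \<in> borel_measurable borel" "sq_integrable lebI v" "V = abs_L2 v"
    "AE x in lebI. rep_L2 V x = v x"
    by (rule L2_borel_rep)
  let ?w = "cell_mean n V"
  let ?K = "\<lambda>z. min c (W z)"
  define s where "s = (\<lambda>x. \<Sum>k=1..n. ?w k * indicator (cell n k) x)"
  have K: "?K \<in> borel_measurable borel" "\<bar>?K z\<bar> \<le> W z" for z
    using W_borel W_nonneg[of z] c by auto
  have sb: "s \<in> borel_measurable borel"
    unfolding s_def by measurable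
  have ss: "sq_integrable lebI s"
    unfolding s_def by (rule sq_integrable_step_function)
  let ?A = "abs_L2 (\<lambda>x. LINT y|lebI. ?K (x, y) * D (s y - s x))"
  let ?H1 = "\<lambda>z. ?K z * D (s (snd z) - s (fst z))"
  let ?H2 = "\<lambda>z. W z * D (v (snd z) - v (fst z))"
  have H: "sq_integrable lebII ?H1" "sq_integrable lebII ?H2"
    using W_nonneg by (intro sq_integrable_coupling_integrand K sb W_borel v; simp)+
  have C: "coupling W' D V = abs_L2 (\<lambda>x. LINT y|lebI. W (x, y) * D (v y - v x))"
    by (rule coupling_eq[OF v(1,4) W'])
  let ?e = "\<lambda>x. s x - v x"
  have e: "sq_integrable lebI ?e" by (rule sq_integrable_diff[OF ss v(2)])
  then have ei: "integrable lebI (\<lambda>x. (?e x)\<^sup>2)" by (simp add: sq_integrable_def)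
  have en: "(LINT x|lebI. (?e x)\<^sup>2) = (norm (step_fun n ?w - V))\<^sup>2"
  proof -
    have "step_fun n ?w - V = abs_L2 s - abs_L2 v"
      unfolding step_fun_def s_def[symmetric] by (simp only: v(3))
    then have "norm (step_fun n ?w - V) = sqrt (LINT x|lebI. (?e x)\<^sup>2)"
      by (simp only: minus_abs_L2[OF ss v(2)] norm_abs_L2[OF e])
    then show ?thesis by simp
  qed
  have Wi: "integrable lebII (\<lambda>z. max 0 ((W z)\<^sup>2 - R))"
    by (rule Bochner_Integration.integrable_bound[OF W_sq_int]) (use R in \<open>auto intro!: AE_I2\<close>)
  have pt: "(?H1 z - ?H2 z)\<^sup>2 \<le> 10 * max 0 ((W z)\<^sup>2 - R) + 4 * R * L\<^sup>2 * ((?e (fst z))\<^sup>2 + (?e (snd z))\<^sup>2)" for z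
  proof (rule truncated_kernel_bound[OF W_nonneg c R D_le_1 D_le_1])
    have "\<bar>D (s (snd z) - s (fst z)) - D (v (snd z) - v (fst z))\<bar>
      \<le> L * \<bar>s (snd z) - s (fst z) - (v (snd z) - v (fst z))\<bar>"
      by (rule lipschitz_on_UNIV_abs[OF D_lipschitz])
    also have "\<dots> \<le> L * (\<bar>?e (fst z)\<bar> + \<bar>?e (snd z)\<bar>)"
      by (intro mult_left_mono L_nonneg) linarith
    finally show "\<bar>D (s (snd z) - s (fst z)) - D (v (snd z) - v (fst z))\<bar>
      \<le> L * (\<bar>?e (fst z)\<bar> + \<bar>?e (snd z)\<bar>)" .
  qed
  have "(LINT z|lebII. (?H1 z - ?H2 z)\<^sup>2)
      \<le> (LINT z|lebII. 10 * max 0 ((W z)\<^sup>2 - R) + 4 * R * L\<^sup>2 * ((?e (fst z))\<^sup>2 + (?e (snd z))\<^sup>2))"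
    using pt integrable_lebII_fst[OF ei] integrable_lebII_snd[OF ei] Wi
    by (intro integral_mono integrable_sq_diff[OF H]) auto
  also have "\<dots> = 10 * (LINT z|lebII. max 0 ((W z)\<^sup>2 - R))
      + 4 * R * L\<^sup>2 * ((LINT x|lebI. (?e x)\<^sup>2) + (LINT x|lebI. (?e x)\<^sup>2))"
    using integrable_lebII_fst[OF ei] integrable_lebII_snd[OF ei] Wi integral_lebII_fst[OF ei] integral_lebII_snd[OF ei]
    by simp
  \<comment> \<open>Both marginals contribute the same squared projection error, so 4 becomes
    8.\<close>
  also have "\<dots> = 10 * (LINT z|lebII. max 0 ((W z)\<^sup>2 - R)) + 8 * R * L\<^sup>2 * (norm (step_fun n ?w - V))\<^sup>2"
    by (simp only: en) simp
  finally have est: "(LINT z|lebII. (?H1 z - ?H2 z)\<^sup>2)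
      \<le> 10 * (LINT z|lebII. max 0 ((W z)\<^sup>2 - R)) + 8 * R * L\<^sup>2 * (norm (step_fun n ?w - V))\<^sup>2" .
  have "L2_set (\<lambda>i. (\<Sum>j=1..n. cell_avg n ?K i j * D (?w j - ?w i)) / real n
      - cell_mean n (coupling W' D V) i) {1..n} = L2_set (cell_mean n (?A - coupling W' D V)) {1..n}"
    by (intro L2_set_cong refl) (simp only: cell_mean_diff s_def cell_mean_coupling_step[OF K])
  also have "\<dots> \<le> sqrt (real n) * norm (?A - coupling W' D V)"
    by (rule L2_set_cell_mean_le[OF n])
  also have "\<dots> \<le> sqrt (real n) * sqrt (LINT z|lebII. (?H1 z - ?H2 z)\<^sup>2)"
    unfolding C using norm_partial_diff_le[OF H] by (intro mult_left_mono) simp_all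
  also have "\<dots> \<le> sqrt (real n) * sqrt (10 * (LINT z|lebII. max 0 ((W z)\<^sup>2 - R))
      + 8 * R * L\<^sup>2 * (norm (step_fun n ?w - V))\<^sup>2)"
    using est by (intro mult_left_mono) simp_all
  finally show ?thesis .
qed

text \<open>The cut-off level k is chosen first from the tail, then d in terms of k. Since V enters
  only through its projection error, the bound is uniform along any set of states on which that
  error is small.\<close>

lemma coupling_consistency:
  assumes "e > 0" and W': "AE x in lebI. AE y in lebI. W' (x, y) = W (x, y)"
  shows "\<exists>d>0. \<exists>c0. \<forall>n\<ge>1. \<forall>c\<ge>c0. \<forall>V. norm (step_fun n (cell_mean n V) - V) \<le> d \<longrightarrow>
    L2_set (\<lambda>i. (\<Sum>j=1..n. cell_avg n (\<lambda>z. min c (W z)) i j * D (cell_mean n V j - cell_mean n V i)) / real n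
      - cell_mean n (coupling W' D V) i) {1..n} \<le> sqrt (real n) * e"
proof -
  have "\<forall>\<^sub>F k in sequentially. (LINT z|lebII. max 0 ((W z)\<^sup>2 - real k)) < e\<^sup>2 / 20"
    using \<open>e > 0\<close> by (intro order_tendstoD(2)[OF tail_tendsto]) simp
  then obtain k where k: "(LINT z|lebII. max 0 ((W z)\<^sup>2 - real k)) < e\<^sup>2 / 20"
    by (auto simp: eventually_sequentially)
  \<comment> \<open>Chosen so that 8 ((k + 1) (L + 1) d)^2 = e^2 / 2; the tail takes the other half,
    10 * e^2 / 20. The added ones keep the denominator positive.\<close>
  define d where "d = e / (4 * (real k + 1) * (L + 1))"
  have d: "d > 0" unfolding d_def using \<open>e > 0\<close> L_nonneg by (intro divide_pos_pos mult_pos_pos) auto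
  have kd: "8 * real k * L\<^sup>2 * d\<^sup>2 \<le> e\<^sup>2 / 2"
  proof -
    have "real k * L\<^sup>2 \<le> (real k + 1)\<^sup>2 * (L + 1)\<^sup>2"
      using L_nonneg by (intro mult_mono power_mono) (auto simp: power2_eq_square algebra_simps)
    then have "8 * (real k * L\<^sup>2) * d\<^sup>2 \<le> 8 * ((real k + 1)\<^sup>2 * (L + 1)\<^sup>2) * d\<^sup>2"
      by (intro mult_right_mono mult_left_mono) auto
    also have "\<dots> = 8 * ((real k + 1) * (L + 1) * d)\<^sup>2"
      by (simp add: power_mult_distrib)
    also have "(real k + 1) * (L + 1) * d = e / 4"
    proof -
      have "(real k + 1) * (L + 1) \<noteq> 0" using L_nonneg by auto
      moreover have "A * (e / (4 * A)) = e / 4" if "A \<noteq> 0" for A :: real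
        using that by simp
      ultimately show ?thesis unfolding d_def by (metis mult.assoc)
    qed
    finally show ?thesis by (simp add: power_divide mult.assoc)
  qed
  \<comment> \<open>With c >= k + 1 >= 1 the truncation lies above the cut-off: k <= c^2.\<close>
  show ?thesis
  proof (rule exI[of _ d], rule conjI[OF d], rule exI[of _ "real k + 1"], intro allI impI)
    fix n c V
    assume n: "n \<ge> (1::nat)" and c: "c \<ge> real k + 1" and V: "norm (step_fun n (cell_mean n V) - V) \<le> d"
    have "real k \<le> c\<^sup>2"
    proof -
      have "1 \<le> c" using c by simp
      then have "1 * c \<le> c * c" by (intro mult_right_mono) auto
      then show ?thesis unfolding power2_eq_square using c by linarith
    qed
    then have "L2_set (\<lambda>i. (\<Sum>j=1..n. cell_avg n (\<lambda>z. min c (W z)) i j * D (cell_mean n V j - cell_mean n V i)) / real n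
      - cell_mean n (coupling W' D V) i) {1..n} 
       \<le> sqrt (real n) * sqrt (10 * (LINT z|lebII. max 0 ((W z)\<^sup>2 - real k))
        + 8 * real k * L\<^sup>2 * (norm (step_fun n (cell_mean n V) - V))\<^sup>2)"
      using c by (intro coupling_estimate[OF n _ _ _ W']) auto
    also have "\<dots> \<le> sqrt (real n) * e"
    proof (intro mult_left_mono real_le_lsqrt)
      have "8 * real k * L\<^sup>2 * (norm (step_fun n (cell_mean n V) - V))\<^sup>2 \<le> 8 * real k * L\<^sup>2 * d\<^sup>2"
        using V by (intro mult_left_mono power_mono) auto
      then show "10 * (LINT z|lebII. max 0 ((W z)\<^sup>2 - real k))
        + 8 * real k * L\<^sup>2 * (norm (step_fun n (cell_mean n V) - V))\<^sup>2 \<le> e\<^sup>2"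
        using k kd by linarith
    qed (use \<open>e > 0\<close> in auto)
    finally show "L2_set (\<lambda>i. (\<Sum>j=1..n. cell_avg n (\<lambda>z. min c (W z)) i j * D (cell_mean n V j - cell_mean n V i)) / real n
      - cell_mean n (coupling W' D V) i) {1..n} \<le> sqrt (real n) * e" .
  qed
qed

end

section \<open>Concentration of the random adjacency matrices\<close>

text \<open>The shape of the union bound: n rows, each with Hoeffding's two-sided factor 2.\<close>

lemma summable_n_exp_powr:
  fixes c b :: real
  assumes "c > 0" "b > 0"
  shows "summable (\<lambda>n. 2 * real n * exp (- (c * real n powr b)))"
proof (rule summable_comparison_test_bigo)
  show "summable (\<lambda>n. norm (real n powr (-2)))"
    by (simp add: summable_real_powr_iff)
  show "(\<lambda>n. 2 * real n * exp (- (c * real n powr b))) \<in> O(\<lambda>n. real n powr (-2))"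
    using assms by real_asymp
qed

text \<open>Injectivity makes the singletons \<open>{h j}\<close> disjoint, so independence of
  blocks applies. Used to extract a single row or column from the array of edges.\<close>

lemma (in prob_space) indep_vars_inj_reindex:
  assumes X: "indep_vars N X I" and h: "inj_on h J" "h ` J \<subseteq> I"
  shows "indep_vars (\<lambda>j. N (h j)) (\<lambda>j. X (h j)) J"
proof -
  have "indep_vars (\<lambda>j. PiM {h j} N) (\<lambda>j \<omega>. restrict (\<lambda>i. X i \<omega>) {h j}) J"
    using h by (intro indep_vars_restrict[OF X]) (auto simp: disjoint_family_on_def inj_on_def)
  then have "indep_vars (\<lambda>j. N (h j)) (\<lambda>j \<omega>. (restrict (\<lambda>i. X i \<omega>) {h j}) (h j)) J"
    by (rule indep_vars_compose2) (rule measurable_component_singleton, simp)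
  then show ?thesis by simp
qed

text \<open>Hoeffding's inequality makes the probability of a deviation \<open>\<epsilon>\<close> in some row of order
  \<open>n exp (- \<epsilon>\<^sup>2 n\<^bsup>1-2\<gamma>\<^esup> / 2)\<close>, which is summable because \<open>\<gamma> < 1/2\<close>.\<close>

lemma (in prob_space) weighted_row_sums_concentrate:
  fixes a :: "nat \<Rightarrow> nat \<Rightarrow> nat \<Rightarrow> 'a \<Rightarrow> bool" and c :: "nat \<Rightarrow> nat \<Rightarrow> nat \<Rightarrow> real"
  assumes \<gamma>: "\<gamma> < 1 / 2"
    and indep: "\<And>n i. n \<ge> 1 \<Longrightarrow> i \<in> {1..n} \<Longrightarrow> indep_vars (\<lambda>_. count_space UNIV) (a n i) {1..n}"
    and prob_a: "\<And>n i j. n \<ge> 1 \<Longrightarrow> i \<in> {1..n} \<Longrightarrow> j \<in> {1..n} \<Longrightarrow> prob {\<omega> \<in> space M. a n i j \<omega>} = p n i j"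
    and c: "\<And>n i j. \<bar>c n i j\<bar> \<le> 1"
    and e: "e > 0"
  shows "AE \<omega> in M. \<forall>\<^sub>F n in sequentially. \<forall>i\<in>{1..n}.
    \<bar>\<Sum>j=1..n. (of_bool (a n i j \<omega>) - p n i j) * c n i j\<bar> < e * (real n * real n powr (- \<gamma>))"
proof -
  define S where "S n i \<omega> = (\<Sum>j=1..n. (of_bool (a n i j \<omega>) - p n i j) * c n i j)" for n i \<omega>
  define A where "A n = {\<omega> \<in> space M. \<exists>i\<in>{1..n}. e * (real n * real n powr (- \<gamma>)) \<le> \<bar>S n i \<omega>\<bar>}" for n
  have am [measurable]: "a n i j \<in> M \<rightarrow>\<^sub>M count_space UNIV" if "i \<in> {1..n}" "j \<in> {1..n}" for n i j
    using indep[of n i] that unfolding indep_vars_def by auto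
  have Sm [measurable]: "S n i \<in> borel_measurable M" if "i \<in> {1..n}" for n i
    unfolding S_def
  proof (intro borel_measurable_sum borel_measurable_times borel_measurable_diff borel_measurable_const)
    fix j assume "j \<in> {1..n}"
    show "(\<lambda>\<omega>. of_bool (a n i j \<omega>) :: real) \<in> borel_measurable M"
      by (rule measurable_compose[OF am[OF that \<open>j \<in> {1..n}\<close>]]) simp
  qed
  have single: "prob {\<omega> \<in> space M. e * (real n * real n powr (- \<gamma>)) \<le> \<bar>S n i \<omega>\<bar>}
      \<le> 2 * exp (- (e\<^sup>2 / 2 * real n powr (1 - 2 * \<gamma>)))" if i: "i \<in> {1..n}" for n i
  proof -
    have n: "n \<ge> 1" using i by auto
    let ?X = "\<lambda>j \<omega>. of_bool (a n i j \<omega>) * c n i j"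
    have ex: "expectation (?X j) = p n i j * c n i j" if j: "j \<in> {1..n}" for j
    proof -
      have "{\<omega> \<in> space M. a n i j \<omega>} \<in> events"
        using measurable_sets[OF am[OF i j], of "{True}"] by (auto simp: vimage_def Int_def conj_commute)
      moreover have "expectation (?X j) = expectation (\<lambda>\<omega>. indicator {\<omega> \<in> space M. a n i j \<omega>} \<omega> * c n i j)"
        by (intro Bochner_Integration.integral_cong) (auto simp: indicator_def)
      ultimately show ?thesis
        using prob_a[OF n i j] by (simp add: Int_absorb1 Collect_subset)
    qed
    \<comment> \<open>Each term lies in [-1, 1], an interval of length 2, so the squared lengths sum
      to 4n and the exponent is -t^2 / (2n). With t = e n^(1 - \<gamma>) this is -(e^2 / 2) n^(1 - 2
      \<gamma>).\<close>
    interpret H: Hoeffding_ineq M "{1..n}" ?X "\<lambda>_. -1" "\<lambda>_. 1" "\<Sum>j=1..n. expectation (?X j)"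
    proof unfold_locales
      show "indep_vars (\<lambda>_. borel) ?X {1..n}"
        by (rule indep_vars_compose2[OF indep[OF n i], where Y="\<lambda>j b. of_bool b * c n i j"]) simp
      fix j assume "j \<in> {1..n}"
      show "AE \<omega> in M. ?X j \<omega> \<in> {-1..1}"
        using c[of n i j] by (intro AE_I2) auto
    qed simp_all
    let ?t = "e * (real n * real n powr (- \<gamma>))"
    have S: "S n i \<omega> = (\<Sum>j=1..n. ?X j \<omega>) - (\<Sum>j=1..n. expectation (?X j))" for \<omega>
      unfolding S_def sum_subtractf[symmetric] by (intro sum.cong refl) (simp only: ex left_diff_distrib)
    have "prob {\<omega> \<in> space M. ?t \<le> \<bar>S n i \<omega>\<bar>} \<le> 2 * exp (-2 * ?t\<^sup>2 / (\<Sum>j=1..n. (1 - (-1))\<^sup>2))"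
      unfolding S using e n by (intro H.Hoeffding_ineq_abs_ge) auto
    also have "-2 * ?t\<^sup>2 / (\<Sum>j=1..n. (1 - (-1))\<^sup>2) = - (e\<^sup>2 / 2 * real n powr (1 - 2 * \<gamma>))"
    proof -
      have "(real n powr (- \<gamma>))\<^sup>2 = real n powr (- 2 * \<gamma>)"
        using n by (simp add: power2_eq_square powr_add[symmetric])
      then have "?t\<^sup>2 / real n = e\<^sup>2 * (real n * real n powr (- 2 * \<gamma>))"
        using n by (simp add: power_mult_distrib power2_eq_square)
      also have "real n * real n powr (- 2 * \<gamma>) = real n powr (1 - 2 * \<gamma>)"
        using n by (simp add: powr_diff powr_minus field_simps)
      finally show ?thesis by simp
    qed
    finally show ?thesis .
  qed
  have Ameas: "A n \<in> events" for n
  proof -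
    have "A n = (\<Union>i\<in>{1..n}. {\<omega> \<in> space M. e * (real n * real n powr (- \<gamma>)) \<le> \<bar>S n i \<omega>\<bar>})"
      unfolding A_def by auto
    moreover have "{\<omega> \<in> space M. e * (real n * real n powr (- \<gamma>)) \<le> \<bar>S n i \<omega>\<bar>} \<in> events"
      if i: "i \<in> {1..n}" for i
    proof -
      note [measurable] = Sm[OF i]
      show ?thesis by measurable
    qed
    ultimately show ?thesis by auto
  qed
  have Aprob: "prob (A n) \<le> 2 * real n * exp (- (e\<^sup>2 / 2 * real n powr (1 - 2 * \<gamma>)))" for n
  proof -
    have "A n = (\<Union>i\<in>{1..n}. {\<omega> \<in> space M. e * (real n * real n powr (- \<gamma>)) \<le> \<bar>S n i \<omega>\<bar>})"
      unfolding A_def by auto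
    also have "prob \<dots> \<le> (\<Sum>i\<in>{1..n}. prob {\<omega> \<in> space M. e * (real n * real n powr (- \<gamma>)) \<le> \<bar>S n i \<omega>\<bar>})"
    proof (rule finite_measure_subadditive_finite)
      show "(\<lambda>i. {\<omega> \<in> space M. e * (real n * real n powr (- \<gamma>)) \<le> \<bar>S n i \<omega>\<bar>}) ` {1..n} \<subseteq> events"
      proof safe
        fix i assume i: "i \<in> {1..n}"
        note [measurable] = Sm[OF i]
        show "{\<omega> \<in> space M. e * (real n * real n powr (- \<gamma>)) \<le> \<bar>S n i \<omega>\<bar>} \<in> events"
          by measurable
      qed
    qed simp
    also have "\<dots> \<le> (\<Sum>i\<in>{1..n}. 2 * exp (- (e\<^sup>2 / 2 * real n powr (1 - 2 * \<gamma>))))"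
      by (intro sum_mono single)
    finally show ?thesis by simp
  qed
  \<comment> \<open>Borel-Cantelli uses the sum of the probabilities alone, so graphs of different
    sizes may depend on each other in any way.\<close>
  have "AE \<omega> in M. \<forall>\<^sub>F n in sequentially. \<omega> \<in> space M - A n"
  proof (rule borel_cantelli_AE1[OF Ameas])
    show "summable (\<lambda>n. prob (A n))"
      by (rule summable_comparison_test'[OF summable_n_exp_powr[of "e\<^sup>2 / 2" "1 - 2 * \<gamma>"], of 0])
        (use e \<gamma> Aprob in auto)
  qed (simp add: emeasure_eq_measure)
  then show ?thesis
  proof eventually_elim
    case (elim \<omega>)
    then show ?case
      by eventually_elim (auto simp: A_def S_def not_le)
  qed
qed

section \<open>Schur test and Gronwall inequality\<close>

lemma L2_set_abs_cong: "L2_set (\<lambda>i. \<bar>x i\<bar>) A = L2_set x A"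
  by (simp add: L2_set_def)

lemma L2_set_mono_abs: "(\<And>i. i \<in> A \<Longrightarrow> \<bar>x i\<bar> \<le> y i) \<Longrightarrow> L2_set x A \<le> L2_set y A"
  using L2_set_mono[of A "\<lambda>i. \<bar>x i\<bar>" y] by (simp add: L2_set_abs_cong)

text \<open>Cauchy-Schwarz with b = sqrt b * sqrt b uses up the row sum; after exchanging the order
  of summation the column sum gives the second factor r.\<close>

lemma L2_set_schur:
  fixes b :: "'i \<Rightarrow> 'i \<Rightarrow> real"
  assumes A: "finite A" and b: "\<And>i j. i \<in> A \<Longrightarrow> j \<in> A \<Longrightarrow> 0 \<le> b i j" and r: "0 \<le> r"
    and row: "\<And>i. i \<in> A \<Longrightarrow> (\<Sum>j\<in>A. b i j) \<le> r" and col: "\<And>j. j \<in> A \<Longrightarrow> (\<Sum>i\<in>A. b i j) \<le> r"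
  shows "L2_set (\<lambda>i. \<Sum>j\<in>A. b i j * \<bar>x j\<bar>) A \<le> r * L2_set x A"
proof -
  have cs: "(\<Sum>j\<in>A. b i j * \<bar>x j\<bar>)\<^sup>2 \<le> r * (\<Sum>j\<in>A. b i j * (x j)\<^sup>2)" if i: "i \<in> A" for i
  proof -
    have "(\<Sum>j\<in>A. b i j * \<bar>x j\<bar>) = (\<Sum>j\<in>A. \<bar>sqrt (b i j)\<bar> * \<bar>sqrt (b i j) * x j\<bar>)"
      using b[OF i] by (intro sum.cong) (auto simp: abs_mult simp flip: mult.assoc)
    also have "\<dots> \<le> L2_set (\<lambda>j. sqrt (b i j)) A * L2_set (\<lambda>j. sqrt (b i j) * x j) A"
      by (rule L2_set_mult_ineq)
    finally have "(\<Sum>j\<in>A. b i j * \<bar>x j\<bar>)\<^sup>2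
        \<le> (L2_set (\<lambda>j. sqrt (b i j)) A * L2_set (\<lambda>j. sqrt (b i j) * x j) A)\<^sup>2"
      using b[OF i] by (intro power_mono sum_nonneg) auto
    also have "\<dots> = (\<Sum>j\<in>A. b i j) * (\<Sum>j\<in>A. b i j * (x j)\<^sup>2)"
      using b[OF i] by (simp add: power_mult_distrib L2_set_def sum_nonneg)
    also have "\<dots> \<le> r * (\<Sum>j\<in>A. b i j * (x j)\<^sup>2)"
      using row[OF i] b[OF i] by (intro mult_right_mono sum_nonneg) auto
    finally show ?thesis .
  qed
  have "(\<Sum>i\<in>A. (\<Sum>j\<in>A. b i j * \<bar>x j\<bar>)\<^sup>2) \<le> (\<Sum>i\<in>A. r * (\<Sum>j\<in>A. b i j * (x j)\<^sup>2))"
    by (intro sum_mono cs)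
  also have "\<dots> = r * (\<Sum>j\<in>A. (\<Sum>i\<in>A. b i j) * (x j)\<^sup>2)"
  proof -
    have "(\<Sum>i\<in>A. \<Sum>j\<in>A. b i j * (x j)\<^sup>2) = (\<Sum>j\<in>A. \<Sum>i\<in>A. b i j * (x j)\<^sup>2)"
      by (rule sum.swap)
    then show ?thesis by (simp only: sum_distrib_left[symmetric] sum_distrib_right[symmetric])
  qed
  also have "\<dots> \<le> r * (\<Sum>j\<in>A. r * (x j)\<^sup>2)"
    using r col by (intro mult_left_mono sum_mono mult_right_mono) auto
  also have "\<dots> = r\<^sup>2 * (\<Sum>j\<in>A. (x j)\<^sup>2)"
    by (simp add: sum_distrib_left power2_eq_square mult.assoc)
  finally have "L2_set (\<lambda>i. \<Sum>j\<in>A. b i j * \<bar>x j\<bar>) A \<le> sqrt (r\<^sup>2 * (\<Sum>j\<in>A. (x j)\<^sup>2))"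
    unfolding L2_set_def by (rule real_sqrt_le_mono)
  then show ?thesis
    using r by (simp add: real_sqrt_mult L2_set_def)
qed

text \<open>The change of \<open>D\<close> is at most L (|x_j| + |x_i|). The x_j part is Schur's
  test and the x_i part needs row sums only; each contributes L r.\<close>

lemma L2_set_coupling_lipschitz:
  fixes b :: "'i \<Rightarrow> 'i \<Rightarrow> real"
  assumes D: "L-lipschitz_on UNIV D"
    and A: "finite A" and b: "\<And>i j. i \<in> A \<Longrightarrow> j \<in> A \<Longrightarrow> 0 \<le> b i j" and r: "0 \<le> r"
    and row: "\<And>i. i \<in> A \<Longrightarrow> (\<Sum>j\<in>A. b i j) \<le> r" and col: "\<And>j. j \<in> A \<Longrightarrow> (\<Sum>i\<in>A. b i j) \<le> r"
  shows "L2_set (\<lambda>i. \<Sum>j\<in>A. b i j * (D (u j - u i) - D (w j - w i))) A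
    \<le> 2 * L * r * L2_set (\<lambda>i. u i - w i) A"
proof -
  have L: "0 \<le> L" by (rule lipschitz_on_nonneg[OF D])
  let ?x = "\<lambda>i. u i - w i"
  have "L2_set (\<lambda>i. \<Sum>j\<in>A. b i j * (D (u j - u i) - D (w j - w i))) A
      \<le> L2_set (\<lambda>i. L * (\<Sum>j\<in>A. b i j * \<bar>?x j\<bar>) + (L * r) * \<bar>?x i\<bar>) A"
  proof (rule L2_set_mono_abs)
    fix i assume i: "i \<in> A"
    have "\<bar>\<Sum>j\<in>A. b i j * (D (u j - u i) - D (w j - w i))\<bar>
        \<le> (\<Sum>j\<in>A. \<bar>b i j * (D (u j - u i) - D (w j - w i))\<bar>)"
      by (rule sum_abs)
    also have "\<dots> \<le> (\<Sum>j\<in>A. b i j * (L * (\<bar>?x j\<bar> + \<bar>?x i\<bar>)))"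
    proof (rule sum_mono)
      fix j assume j: "j \<in> A"
      have "\<bar>D (u j - u i) - D (w j - w i)\<bar> \<le> L * \<bar>u j - u i - (w j - w i)\<bar>"
        by (rule lipschitz_on_UNIV_abs[OF D])
      also have "\<dots> \<le> L * (\<bar>?x j\<bar> + \<bar>?x i\<bar>)"
        using L by (intro mult_left_mono) auto
      finally show "\<bar>b i j * (D (u j - u i) - D (w j - w i))\<bar> \<le> b i j * (L * (\<bar>?x j\<bar> + \<bar>?x i\<bar>))"
        using b[OF i j] by (simp add: abs_mult mult_left_mono)
    qed
    also have "\<dots> = L * (\<Sum>j\<in>A. b i j * \<bar>?x j\<bar>) + (\<Sum>j\<in>A. b i j) * (L * \<bar>?x i\<bar>)"
    proof -
      have "b i j * (L * (\<bar>?x j\<bar> + \<bar>?x i\<bar>)) = L * (b i j * \<bar>?x j\<bar>) + b i j * (L * \<bar>?x i\<bar>)" for j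
        by (simp add: algebra_simps)
      then show ?thesis
        by (simp only: sum.distrib sum_distrib_left[symmetric] sum_distrib_right[symmetric])
    qed
    also have "\<dots> \<le> L * (\<Sum>j\<in>A. b i j * \<bar>?x j\<bar>) + r * (L * \<bar>?x i\<bar>)"
      using row[OF i] L by (intro add_left_mono mult_right_mono) auto
    finally show "\<bar>\<Sum>j\<in>A. b i j * (D (u j - u i) - D (w j - w i))\<bar>
        \<le> L * (\<Sum>j\<in>A. b i j * \<bar>?x j\<bar>) + (L * r) * \<bar>?x i\<bar>"
      by (simp add: mult_ac)
  qed
  also have "\<dots> \<le> L2_set (\<lambda>i. L * (\<Sum>j\<in>A. b i j * \<bar>?x j\<bar>)) A + L2_set (\<lambda>i. (L * r) * \<bar>?x i\<bar>) A"
    by (rule L2_set_triangle_ineq)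
  also have "\<dots> = L * L2_set (\<lambda>i. \<Sum>j\<in>A. b i j * \<bar>?x j\<bar>) A + L * r * L2_set ?x A"
    using L r by (simp add: L2_set_right_distrib[symmetric] L2_set_abs_cong)
  also have "\<dots> \<le> L * (r * L2_set ?x A) + L * r * L2_set ?x A"
    using L by (intro add_right_mono mult_left_mono L2_set_schur A b r row col)
  finally show ?thesis by simp
qed

text \<open>With q the right-hand integral, exp(-C t) q(t) - e t is nonincreasing: its derivative is
  C exp(-C t) (p - q) + (exp(-C t) - 1) e. Working with q avoids differentiating p.\<close>

lemma gronwall_integral:
  fixes p :: "real \<Rightarrow> real"
  assumes p: "continuous_on {0..T} p" and C: "0 \<le> C" and e: "0 \<le> e"
    and le: "\<And>t. t \<in> {0..T} \<Longrightarrow> p t \<le> integral {0..t} (\<lambda>s. C * p s + e)"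
    and t: "t \<in> {0..T}"
  shows "p t \<le> e * T * exp (C * T)"
proof -
  define q where "q t = integral {0..t} (\<lambda>s. C * p s + e)" for t
  define h where "h t = exp (- C * t) * q t - e * t" for t
  have dq: "(q has_real_derivative C * p s + e) (at s within {0..T})" if "s \<in> {0..T}" for s
    unfolding q_def using p that by (intro integral_has_real_derivative continuous_intros)
  have dh: "(h has_real_derivative exp (- C * s) * (C * p s + e) - C * exp (- C * s) * q s - e) (at s within {0..T})"
    if "s \<in> {0..T}" for s
    unfolding h_def by (rule derivative_eq_intros dq[OF that] refl | simp)+
  have "h t \<le> h 0"
  proof (rule DERIV_nonpos_imp_decreasing_open[where f=h and a=0 and b=t])
    show "0 \<le> t" using t by simp
    show "continuous_on {0..t} h"
      using t by (intro continuous_on_subset[OF DERIV_continuous_on[OF dh]]) auto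
    fix s assume s: "0 < s" "s < t"
    then have sT: "s \<in> {0..T}" "at s within {0..T} = at s" using t by (auto intro!: at_within_Icc_at)
    have "exp (- C * s) * (C * p s + e) - C * exp (- C * s) * q s - e
        = exp (- C * s) * C * (p s - q s) + (exp (- C * s) - 1) * e"
      by (simp add: algebra_simps)
    also have "\<dots> \<le> 0"
    proof -
      have "exp (- C * s) * C * (p s - q s) \<le> 0"
        using le[OF sT(1)] C by (intro mult_nonneg_nonpos) (auto simp: q_def)
      moreover have "(exp (- C * s) - 1) * e \<le> 0"
        using C e s by (intro mult_nonpos_nonneg) auto
      ultimately show ?thesis by linarith
    qed
    finally show "\<exists>y. (h has_real_derivative y) (at s) \<and> y \<le> 0"
      using dh[OF sT(1)] unfolding sT(2) by blast
  qed
  then have "exp (- C * t) * q t \<le> e * t"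
    by (simp add: h_def q_def)
  then have "q t \<le> e * t * exp (C * t)"
    by (simp add: exp_minus field_simps)
  also have "\<dots> \<le> e * T * exp (C * T)"
    using t e C by (intro mult_mono mult_left_mono) (auto intro!: mult_left_mono)
  finally show ?thesis using le[OF t] by (simp add: q_def)
qed

lemma L2_set_gronwall:
  fixes \<phi> R :: "'i \<Rightarrow> real \<Rightarrow> real"
  assumes \<phi>: "\<And>i. i \<in> A \<Longrightarrow> continuous_on {0..T} (\<phi> i)"
    and R: "\<And>i t. i \<in> A \<Longrightarrow> t \<in> {0..T} \<Longrightarrow> integrable (lebesgue_on {0..t}) (R i)"
    and \<phi>R: "\<And>i t. i \<in> A \<Longrightarrow> t \<in> {0..T} \<Longrightarrow> \<phi> i t = (LINT s|lebesgue_on {0..t}. R i s)"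
    and C: "0 \<le> C" and e: "0 \<le> e"
    and le: "AE s in lebesgue_on {0..T}. L2_set (\<lambda>i. R i s) A \<le> C * L2_set (\<lambda>i. \<phi> i s) A + e"
    and t: "t \<in> {0..T}"
  shows "L2_set (\<lambda>i. \<phi> i t) A \<le> e * T * exp (C * T)"
proof (rule gronwall_integral[OF _ C e _ t, of "\<lambda>t. L2_set (\<lambda>i. \<phi> i t) A"])
  let ?p = "\<lambda>t. L2_set (\<lambda>i. \<phi> i t) A"
  show cont: "continuous_on {0..T} ?p"
    unfolding L2_set_def using \<phi> by (intro continuous_intros) auto
  fix t assume t: "t \<in> {0..T}"
  let ?q = "integral {0..t} (\<lambda>s. C * ?p s + e)"
  have qc: "continuous_on {0..t} (\<lambda>s. C * ?p s + e)"
    using t by (intro continuous_intros continuous_on_subset[OF cont]) auto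
  have qi: "integrable (lebesgue_on {0..t}) (\<lambda>s. C * ?p s + e)"
    by (rule continuous_imp_integrable_real[OF qc])
  have q: "(LINT s|lebesgue_on {0..t}. C * ?p s + e) = ?q"
    by (rule lebesgue_integral_eq_integral[OF qi]) simp
  have "AE s in lebesgue. s \<in> {0..T} \<longrightarrow> L2_set (\<lambda>i. R i s) A \<le> C * ?p s + e"
    using le by (subst (asm) AE_restrict_space_iff) auto
  then have ae: "AE s in lebesgue_on {0..t}. L2_set (\<lambda>i. R i s) A \<le> C * ?p s + e"
    using t by (subst AE_restrict_space_iff) (auto elim!: eventually_mono)
  have "(?p t)\<^sup>2 = (\<Sum>i\<in>A. \<phi> i t * \<phi> i t)"
    by (simp add: L2_set_def sum_nonneg power2_eq_square)
  also have "\<dots> = (\<Sum>i\<in>A. \<phi> i t * (LINT s|lebesgue_on {0..t}. R i s))"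
    using t by (intro sum.cong refl arg_cong2[where f="(*)"] \<phi>R)
  also have "\<dots> = (LINT s|lebesgue_on {0..t}. (\<Sum>i\<in>A. \<phi> i t * R i s))"
    using R t by (subst Bochner_Integration.integral_sum) auto
  also have "\<dots> \<le> (LINT s|lebesgue_on {0..t}. ?p t * (C * ?p s + e))"
  proof (rule integral_mono_AE)
    show "integrable (lebesgue_on {0..t}) (\<lambda>s. \<Sum>i\<in>A. \<phi> i t * R i s)"
      using R t by (intro Bochner_Integration.integrable_sum integrable_mult_right) auto
    show "integrable (lebesgue_on {0..t}) (\<lambda>s. ?p t * (C * ?p s + e))"
      using qi by (intro integrable_mult_right)
    show "AE s in lebesgue_on {0..t}. (\<Sum>i\<in>A. \<phi> i t * R i s) \<le> ?p t * (C * ?p s + e)"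
      using ae
    proof eventually_elim
      case (elim s)
      have "(\<Sum>i\<in>A. \<phi> i t * R i s) \<le> (\<Sum>i\<in>A. \<bar>\<phi> i t\<bar> * \<bar>R i s\<bar>)"
        by (intro sum_mono) (simp flip: abs_mult)
      also have "\<dots> \<le> ?p t * L2_set (\<lambda>i. R i s) A"
        by (rule L2_set_mult_ineq)
      also have "\<dots> \<le> ?p t * (C * ?p s + e)"
        using elim by (intro mult_left_mono) auto
      finally show ?case .
    qed
  qed
  also have "\<dots> = ?p t * ?q"
    using q by simp
  finally have "?p t * ?p t \<le> ?p t * ?q"
    by (simp add: power2_eq_square)
  \<comment> \<open>Settles the case \<open>?p t = 0\<close>, in which the factor cannot be
    cancelled.\<close>
  moreover have "0 \<le> ?q"
    unfolding q[symmetric] using C e by (intro Bochner_Integration.integral_nonneg) auto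
  ultimately show "?p t \<le> ?q"
    by (cases "?p t = 0") (auto simp: mult_le_cancel_left order.strict_iff_order)
qed

text \<open>Compactness reduces \<open>E\<close> to finitely many centres, on which pointwise
  convergence is uniform; the common Lipschitz constant carries it to the balls around them.\<close>

lemma equi_lipschitz_tendsto_compact:
  fixes F :: "nat \<Rightarrow> 'a::metric_space \<Rightarrow> real"
  assumes S: "compact S" and dense: "\<And>x e. e > 0 \<Longrightarrow> \<exists>d\<in>E. dist d x < e"
    and lim: "\<And>d. d \<in> E \<Longrightarrow> (\<lambda>n. F n d) \<longlonglongrightarrow> 0"
    and lip: "\<forall>\<^sub>F n in sequentially. \<forall>x y. \<bar>F n x - F n y\<bar> \<le> C * dist x y"
    and C: "0 \<le> C" and e: "e > 0"
  shows "\<forall>\<^sub>F n in sequentially. \<forall>x\<in>S. \<bar>F n x\<bar> \<le> e"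
proof -
  \<comment> \<open>Keeps C r <= e / 2, also when C = 0.\<close>
  define r where "r = e / (2 * (C + 1))"
  have r: "r > 0" using C e by (simp add: r_def)
  have Cr: "C * r \<le> e / 2"
    using C e by (simp add: r_def field_simps)
  have "S \<subseteq> (\<Union>d\<in>E. ball d r)"
    using dense[OF r] by force
  then obtain E' where E': "E' \<subseteq> E" "finite E'" "S \<subseteq> (\<Union>d\<in>E'. ball d r)"
    by (rule compactE_image[OF S, rotated]) auto
  have "\<forall>\<^sub>F n in sequentially. \<forall>d\<in>E'. \<bar>F n d\<bar> < e / 2"
  proof (rule eventually_ball_finite[OF E'(2)], rule ballI)
    fix d assume "d \<in> E'"
    then have "(\<lambda>n. \<bar>F n d\<bar>) \<longlonglongrightarrow> 0"
      using lim E'(1) by (intro tendsto_rabs_zero) auto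
    then show "\<forall>\<^sub>F n in sequentially. \<bar>F n d\<bar> < e / 2"
      using e by (intro order_tendstoD(2)) auto
  qed
  then show ?thesis
    using lip
  proof eventually_elim
    case (elim n)
    show ?case
    proof
      fix x assume "x \<in> S"
      then obtain d where d: "d \<in> E'" "dist d x < r" using E'(3) by auto
      have "\<bar>F n x\<bar> \<le> \<bar>F n d\<bar> + \<bar>F n d - F n x\<bar>" by linarith
      also have "\<dots> \<le> e / 2 + C * dist d x"
        using elim d(1) by (intro add_mono) (auto intro: less_imp_le)
      also have "\<dots> \<le> e / 2 + C * r"
        using d(2) C by (intro add_left_mono mult_left_mono) auto
      finally show "\<bar>F n x\<bar> \<le> e" using Cr by simp
    qed
  qed
qed

section \<open>Weak solutions\<close>

instance L2 :: banach ..

lemma L2_time_integrable: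
  assumes "L2_time T v"
  shows "integrable (lebesgue_on {0..T}) v"
proof -
  interpret finite_measure "lebesgue_on {0..T}" by (rule finite_measure_lebesgue_on) simp
  have m: "v \<in> borel_measurable (lebesgue_on {0..T})" and i: "integrable (lebesgue_on {0..T}) (\<lambda>t. (norm (v t))\<^sup>2)"
    using assms by (auto simp: L2_time_def)
  have b: "norm x \<le> 1 + (norm x)\<^sup>2" for x :: L2
  proof -
    have "2 * norm x \<le> (norm x)\<^sup>2 + 1"
      using zero_le_power2[of "norm x - 1"] by (simp add: power2_diff)
    then show ?thesis using norm_ge_zero[of x] by linarith
  qed
  show ?thesis
  proof (rule Bochner_Integration.integrable_bound[OF _ m])
    show "integrable (lebesgue_on {0..T}) (\<lambda>t. 1 + (norm (v t))\<^sup>2)"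
      using i by simp
    show "AE t in lebesgue_on {0..T}. norm (v t) \<le> norm (1 + (norm (v t))\<^sup>2)"
      using b by (intro AE_I2) auto
  qed
qed

text \<open>Moves the upper limit from the measure into the integrand, so that dominated convergence
  can act on a fixed measure.\<close>

lemma integrable_lebesgue_on_Icc_subset:
  fixes v :: "real \<Rightarrow> L2"
  assumes v: "integrable (lebesgue_on {0..T}) v" and t: "t \<in> {0..T}"
  shows "integrable (lebesgue_on {0..t}) v"
    and "(LINT s|lebesgue_on {0..t}. v s) = (LINT s|lebesgue_on {0..T}. indicator {0..t} s *\<^sub>R v s)"
proof -
  have eq: "(indicator {0..T} s * indicator {0..t} s) *\<^sub>R v s = indicator {0..t} s *\<^sub>R v s" for s :: real
    using t by (auto simp: indicator_def)
  have "integrable (lebesgue_on {0..T}) (\<lambda>s. indicator {0..t} s *\<^sub>R v s)"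
    using v by (intro integrable_mult_indicator) (use t in \<open>auto simp: sets_restrict_space_iff\<close>)
  then show "integrable (lebesgue_on {0..t}) v"
    by (simp add: integrable_restrict_space eq)
  show "(LINT s|lebesgue_on {0..t}. v s) = (LINT s|lebesgue_on {0..T}. indicator {0..t} s *\<^sub>R v s)"
    by (simp add: integral_restrict_space eq)
qed

text \<open>Makes the trajectory compact. As the upper limit tends to a, the indicators converge at
  every s other than a, dominated by the norm of the derivative.\<close>

lemma H1_deriv_continuous:
  assumes H: "H1_deriv T u u'"
  shows "continuous_on {0..T} u"
proof -
  have u': "integrable (lebesgue_on {0..T}) u'"
    using H by (intro L2_time_integrable) (simp add: H1_deriv_def)
  have "continuous_on {0..T} (\<lambda>t. LINT s|lebesgue_on {0..T}. indicator {0..t} s *\<^sub>R u' s)"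
    unfolding continuous_on_sequentially
  proof (intro allI ballI impI, elim conjE)
    fix x :: "nat \<Rightarrow> real" and a
    assume a: "a \<in> {0..T}" and x: "\<forall>n. x n \<in> {0..T}" and lim: "x \<longlonglongrightarrow> a"
    have "(\<lambda>n. LINT s|lebesgue_on {0..T}. indicator {0..x n} s *\<^sub>R u' s)
      \<longlonglongrightarrow> (LINT s|lebesgue_on {0..T}. indicator {0..a} s *\<^sub>R u' s)"
    proof (rule integral_dominated_convergence)
      show "integrable (lebesgue_on {0..T}) (\<lambda>s. norm (u' s))"
        using u' by simp
      have "(\<lambda>s. indicator {0..t} s *\<^sub>R u' s) \<in> borel_measurable (lebesgue_on {0..T})" if "t \<in> {0..T}" for t
        using integrable_mult_indicator[OF _ u', of "{0..t}"] that
        by (auto simp: sets_restrict_space_iff)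
      then show "(\<lambda>s. indicator {0..a} s *\<^sub>R u' s) \<in> borel_measurable (lebesgue_on {0..T})"
        "(\<lambda>s. indicator {0..x n} s *\<^sub>R u' s) \<in> borel_measurable (lebesgue_on {0..T})" for n
        using a x by auto
      show "AE s in lebesgue_on {0..T}. norm (indicator {0..x n} s *\<^sub>R u' s) \<le> norm (u' s)" for n
        by (intro AE_I2) (auto simp: indicator_def)
      have "AE s in lebesgue. s \<notin> {a}"
        by (intro AE_not_in) auto
      then have "AE s in lebesgue_on {0..T}. s \<noteq> a"
        by (subst AE_restrict_space_iff) auto
      then show "AE s in lebesgue_on {0..T}. (\<lambda>n. indicator {0..x n} s *\<^sub>R u' s) \<longlonglongrightarrow> indicator {0..a} s *\<^sub>R u' s"
      proof eventually_elim
        case (elim s)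
        have "\<forall>\<^sub>F n in sequentially. indicator {0..x n} s *\<^sub>R u' s = indicator {0..a} s *\<^sub>R u' s"
        proof (cases "s < a")
          case True
          then have "\<forall>\<^sub>F n in sequentially. s < x n" by (rule order_tendstoD(1)[OF lim])
          then show ?thesis by eventually_elim (use True in \<open>auto simp: indicator_def\<close>)
        next
          case False
          then have "\<forall>\<^sub>F n in sequentially. x n < s" using elim by (intro order_tendstoD(2)[OF lim]) auto
          then show ?thesis by eventually_elim (use False elim in \<open>auto simp: indicator_def\<close>)
        qed
        then show ?case by (rule tendsto_eventually)
      qed
    qed
    then show "((\<lambda>t. LINT s|lebesgue_on {0..T}. indicator {0..t} s *\<^sub>R u' s) \<circ> x)
      \<longlonglongrightarrow> (LINT s|lebesgue_on {0..T}. indicator {0..a} s *\<^sub>R u' s)"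
      by (simp add: o_def)
  qed
  then have "continuous_on {0..T} (\<lambda>t. u 0 + (LINT s|lebesgue_on {0..T}. indicator {0..t} s *\<^sub>R u' s))"
    by (intro continuous_intros)
  moreover have "u t = u 0 + (LINT s|lebesgue_on {0..T}. indicator {0..t} s *\<^sub>R u' s)" if "t \<in> {0..T}" for t
  proof -
    have "u t = u 0 + (LINT s|lebesgue_on {0..t}. u' s)"
      using H that unfolding H1_deriv_def by blast
    then show ?thesis
      by (simp only: integrable_lebesgue_on_Icc_subset(2)[OF u' that])
  qed
  ultimately show ?thesis
    by (subst continuous_on_cong[OF refl, where g="\<lambda>t. u 0 + (LINT s|lebesgue_on {0..T}. indicator {0..t} s *\<^sub>R u' s)"])
qed

lemma H1_deriv_cell_mean:
  assumes H: "H1_deriv T u u'" and t: "t \<in> {0..T}"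
  shows "integrable (lebesgue_on {0..t}) (\<lambda>s. cell_mean n (u' s) i)"
    and "cell_mean n (u t) i = cell_mean n (u 0) i + (LINT s|lebesgue_on {0..t}. cell_mean n (u' s) i)"
proof -
  have u': "integrable (lebesgue_on {0..t}) u'"
    using H by (intro integrable_lebesgue_on_Icc_subset(1)[OF L2_time_integrable t]) (simp add: H1_deriv_def)
  then show "integrable (lebesgue_on {0..t}) (\<lambda>s. cell_mean n (u' s) i)"
    unfolding cell_mean_def by simp
  have "u t = u 0 + (LINT s|lebesgue_on {0..t}. u' s)"
    using H t unfolding H1_deriv_def by blast
  then show "cell_mean n (u t) i = cell_mean n (u 0) i + (LINT s|lebesgue_on {0..t}. cell_mean n (u' s) i)"
    using u' unfolding cell_mean_def by (simp add: inner_add_left distrib_left)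
qed

section \<open>The finite system\<close>

lemma cell_mean_initial:
  assumes g: "sq_integrable lebI g" and i: "i \<in> {1..n}"
  shows "real n * (LINT x:cell n i|lebesgue. g x) = cell_mean n (abs_L2 g) i"
proof -
  have "(LINT x:cell n i|lebesgue. g x) = (LINT x|lebesgue. indicator {0..1} x *\<^sub>R (g x * indicator (cell n i) x))"
    unfolding set_lebesgue_integral_def using cell_subset[OF i]
    by (intro Bochner_Integration.integral_cong) (auto simp: indicator_def subset_eq)
  also have "\<dots> = (LINT x|lebI. g x * indicator (cell n i) x)"
    by (rule integral_restrict_space[symmetric]) simp
  finally show ?thesis
    by (simp add: cell_mean_abs_L2[OF g])
qed

lemma continuous_on_superposition:
  fixes f :: "real \<Rightarrow> real \<Rightarrow> real"
  assumes lip: "\<And>t. L-lipschitz_on UNIV (\<lambda>v. f v t)" and cont: "\<And>v. continuous_on UNIV (\<lambda>t. f v t)"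
    and v: "continuous_on S v"
  shows "continuous_on S (\<lambda>t. f (v t) t)"
  unfolding continuous_on_def
proof
  fix t assume t: "t \<in> S"
  have vt: "(v \<longlongrightarrow> v t) (at t within S)"
    using v t by (simp add: continuous_on_def)
  have "(\<lambda>s. f (v t) s) \<midarrow>t\<rightarrow> f (v t) t"
    using cont[of "v t"] by (simp add: continuous_on_def)
  then have 1: "((\<lambda>s. f (v t) s) \<longlongrightarrow> f (v t) t) (at t within S)"
    by (rule tendsto_within_subset) simp
  have "((\<lambda>s. f (v s) s - f (v t) s) \<longlongrightarrow> 0) (at t within S)"
  proof (rule Lim_null_comparison)
    show "\<forall>\<^sub>F s in at t within S. norm (f (v s) s - f (v t) s) \<le> L * \<bar>v s - v t\<bar>"
      using lipschitz_on_UNIV_abs[where \<phi>="\<lambda>v. f v s" for s, OF lip] by (intro always_eventually) simp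
    have "((\<lambda>s. L * \<bar>v s - v t\<bar>) \<longlongrightarrow> L * \<bar>v t - v t\<bar>) (at t within S)"
      by (intro tendsto_intros vt)
    then show "((\<lambda>s. L * \<bar>v s - v t\<bar>) \<longlongrightarrow> 0) (at t within S)" by simp
  qed
  from tendsto_add[OF this 1] show "((\<lambda>s. f (v s) s) \<longlongrightarrow> f (v t) t) (at t within S)"
    by simp
qed

lemma L2_set_uminus: "L2_set (\<lambda>i. - x i) A = L2_set x A"
  by (simp add: L2_set_def)

lemma L2_set_triangle_diff: "L2_set (\<lambda>i. x i - y i) A \<le> L2_set x A + L2_set y A"
  using L2_set_triangle_ineq[of x "\<lambda>i. - y i" A] by (simp add: L2_set_uminus)

lemma L2_set_diff_abs_le: "\<bar>L2_set x A - L2_set y A\<bar> \<le> L2_set (\<lambda>i. x i - y i) A"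
  using L2_set_triangle_ineq[of "\<lambda>i. x i - y i" y A] L2_set_triangle_ineq[of "\<lambda>i. y i - x i" x A]
    L2_set_uminus[of "\<lambda>i. x i - y i" A] by simp

section \<open>Row and column sums from (W-1) and (W-2)\<close>

lemma integral_step_function:
  "(LINT y|lebI. (\<Sum>j=1..n. c j * indicator (cell n j) y)) = (\<Sum>j=1..n. c j) / real n"
proof -
  have ii: "integrable lebI (indicator (cell n j) :: real \<Rightarrow> real)" for j
    by (rule L1_le_norm_L2(1)[OF sq_integrable_indicator]) simp
  have "(LINT y|lebI. (\<Sum>j=1..n. c j * indicator (cell n j) y))
      = (\<Sum>j=1..n. LINT y|lebI. c j * indicator (cell n j) y)"
    by (rule Bochner_Integration.integral_sum) (rule integrable_mult_right[OF ii])
  also have "\<dots> = (\<Sum>j=1..n. c j / real n)"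
  proof (rule sum.cong[OF refl])
    fix j assume "j \<in> {1..n}"
    then show "(LINT y|lebI. c j * indicator (cell n j) y) = c j / real n"
      by (simp only: integral_mult_right_zero integral_indicator_cell times_divide_eq_right mult_1_right)
  qed
  finally show ?thesis by (simp only: sum_divide_distrib)
qed

text \<open>Cells contain their right endpoints, so evaluating at i/n selects exactly row or column
  i.\<close>

lemma step_kernel_row_integral:
  assumes n: "n \<ge> 1" and i: "i \<in> {1..n}"
  shows "(LINT y|lebI. step_kernel n W (real i / real n, y)) = (\<Sum>j=1..n. cell_avg n W i j) / real n"
    and "(LINT x|lebI. step_kernel n W (x, real i / real n)) = (\<Sum>j=1..n. cell_avg n W j i) / real n"
proof -
  let ?x = "real i / real n"
  have x: "?x \<in> {0<..1}" using i n by (auto simp: field_simps)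
  have idx: "nat \<lceil>real n * ?x\<rceil> = i" using n by simp
  have "step_kernel n W (?x, y) = (\<Sum>j=1..n. cell_avg n W i j * indicator (cell n j) y)" for y
  proof -
    have "step_kernel n W (?x, y)
      = (\<Sum>j=1..n. \<Sum>i'=1..n. (cell_avg n W i' j * indicator (cell n j) y) * indicator (cell n i') ?x)"
      unfolding step_kernel_def indicator_cell_Times by (subst sum.swap) (simp add: mult_ac)
    then show ?thesis by (simp only: sum_indicator_cell[OF n x] idx)
  qed
  then show "(LINT y|lebI. step_kernel n W (?x, y)) = (\<Sum>j=1..n. cell_avg n W i j) / real n"
    by (simp only: integral_step_function)
  have "step_kernel n W (y, ?x) = (\<Sum>j=1..n. cell_avg n W j i * indicator (cell n j) y)" for y
  proof -
    have "step_kernel n W (y, ?x)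
      = (\<Sum>j=1..n. \<Sum>i'=1..n. (cell_avg n W j i' * indicator (cell n j) y) * indicator (cell n i') ?x)"
      unfolding step_kernel_def indicator_cell_Times by (simp add: mult_ac)
    then show ?thesis by (simp only: sum_indicator_cell[OF n x] idx)
  qed
  then show "(LINT y|lebI. step_kernel n W (y, ?x)) = (\<Sum>j=1..n. cell_avg n W j i) / real n"
    by (simp only: integral_step_function)
qed

text \<open>(W-1) integrates over the first variable and controls columns, (W-2) controls rows. The
  common bound is made nonnegative for Schur's test.\<close>

lemma cond_W_sums_bounded:
  assumes "cond_W1 W" "cond_W2 W"
  obtains B where "0 \<le> B" "\<And>n i. i \<in> {1..n} \<Longrightarrow> (\<Sum>j=1..n. cell_avg n W i j) / real n \<le> B"
    "\<And>n i. i \<in> {1..n} \<Longrightarrow> (\<Sum>j=1..n. cell_avg n W j i) / real n \<le> B"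
proof -
  from assms(1) obtain B1 where
    B1: "\<forall>z\<in>{LINT x|lebI. step_kernel n W (x, y) | n y. n \<ge> 1 \<and> y \<in> {0..1}}. z \<le> B1"
    unfolding cond_W1_def bdd_above_def ..
  from assms(2) obtain B2 where
    B2: "\<forall>z\<in>{LINT y|lebI. step_kernel n W (x, y) | n x. n \<ge> 1 \<and> x \<in> {0..1}}. z \<le> B2"
    unfolding cond_W2_def bdd_above_def ..
  have mem: "real i / real n \<in> {0..1}" "n \<ge> 1" if "i \<in> {1..n}" for i n :: nat
    using that by (auto simp: field_simps)
  show thesis
  proof (rule that[of "max 0 (max B1 B2)"])
    fix n i :: nat assume i: "i \<in> {1..n}"
    have "(LINT y|lebI. step_kernel n W (real i / real n, y)) \<le> B2"
      by (intro B2[rule_format] CollectI exI conjI) (rule refl, use mem[OF i] in simp_all)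
    then show "(\<Sum>j=1..n. cell_avg n W i j) / real n \<le> max 0 (max B1 B2)"
      by (simp only: step_kernel_row_integral(1)[OF mem(2)[OF i] i] le_max_iff_disj simp_thms)
    have "(LINT x|lebI. step_kernel n W (x, real i / real n)) \<le> B1"
      by (intro B1[rule_format] CollectI exI conjI) (rule refl, use mem[OF i] in simp_all)
    then show "(\<Sum>j=1..n. cell_avg n W j i) / real n \<le> max 0 (max B1 B2)"
      by (simp only: step_kernel_row_integral(2)[OF mem(2)[OF i] i] le_max_iff_disj simp_thms)
  qed simp
qed

context coupling_kernel
begin

lemma cell_avg_min:
  assumes c: "0 \<le> c" and ij: "i \<in> {1..n}" "j \<in> {1..n}"
  shows "0 \<le> cell_avg n (\<lambda>z. min c (W z)) i j"
    and "cell_avg n (\<lambda>z. min c (W z)) i j \<le> cell_avg n W i j"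
proof -
  have K: "(\<lambda>z. min c (W z)) \<in> borel_measurable borel" "\<bar>min c (W z)\<bar> \<le> W z" for z
    using W_borel W_nonneg[of z] c by auto
  show "0 \<le> cell_avg n (\<lambda>z. min c (W z)) i j"
    unfolding cell_avg_eq[OF K(1) ij] using c W_nonneg
    by (intro mult_nonneg_nonneg Bochner_Integration.integral_nonneg) auto
  show "cell_avg n (\<lambda>z. min c (W z)) i j \<le> cell_avg n W i j"
    unfolding cell_avg_eq[OF K(1) ij] cell_avg_eq[OF W_borel ij]
  proof (intro mult_left_mono integral_mono)
    show "integrable lebII (\<lambda>z. min c (W z) * (indicator (cell n i) (fst z) * indicator (cell n j) (snd z)))"
      by (rule integrable_cell_integrand[OF K])
    show "integrable lebII (\<lambda>z. W z * (indicator (cell n i) (fst z) * indicator (cell n j) (snd z)))"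
      using W_nonneg by (intro integrable_cell_integrand W_borel) simp
  qed (auto simp: indicator_def)
qed

text \<open>A deterministic estimate for one graph: \<open>b\<close> holds the realised weights,
  \<open>q\<close> the expected ones. The factors sqrt n cancel on returning to L2(I), and the last
  \<delta> is the distance from the solution to its own cell means.\<close>

lemma finite_system_error:
  fixes b q :: "nat \<Rightarrow> nat \<Rightarrow> real"
  assumes n: "n \<ge> 1"
    and b: "\<And>i j. i \<in> {1..n} \<Longrightarrow> j \<in> {1..n} \<Longrightarrow> 0 \<le> b i j" and r: "0 \<le> r"
    and row: "\<And>i. i \<in> {1..n} \<Longrightarrow> (\<Sum>j=1..n. b i j) \<le> r"
    and col: "\<And>j. j \<in> {1..n} \<Longrightarrow> (\<Sum>i=1..n. b i j) \<le> r"
    and f: "\<And>t. Lf-lipschitz_on UNIV (\<lambda>v. f v t)" "\<And>v. continuous_on UNIV (\<lambda>t. f v t)"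
    and H: "H1_deriv T U U'"
    and eq: "AE t in lebesgue_on {0..T}. U' t = coupling W' D (U t) + superposition f t (U t)"
    and v0: "\<And>i. i \<in> {1..n} \<Longrightarrow> v i 0 = cell_mean n (U 0) i"
    and v: "\<And>i t. i \<in> {1..n} \<Longrightarrow> t \<in> {0..T} \<Longrightarrow> (v i has_real_derivative
        f (v i t) t + (\<Sum>j=1..n. b i j * D (v j t - v i t))) (at t within {0..T})"
    and \<delta>: "\<And>t. t \<in> {0..T} \<Longrightarrow> norm (step_fun n (cell_mean n (U t)) - U t) \<le> \<delta>"
    and \<zeta>: "\<And>t. t \<in> {0..T} \<Longrightarrow> L2_set (\<lambda>i. \<Sum>j=1..n. (b i j - q i j) *
        D (cell_mean n (U t) j - cell_mean n (U t) i)) {1..n} \<le> sqrt (real n) * \<zeta>"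
    and \<eta>: "\<And>t. t \<in> {0..T} \<Longrightarrow> L2_set (\<lambda>i. (\<Sum>j=1..n. q i j * D (cell_mean n (U t) j - cell_mean n (U t) i))
        - cell_mean n (coupling W' D (U t)) i) {1..n} \<le> sqrt (real n) * \<eta>"
    and nonneg: "0 \<le> \<delta>" "0 \<le> \<zeta>" "0 \<le> \<eta>"
    and t: "t \<in> {0..T}"
  shows "norm (step_fun n (\<lambda>i. v i t) - U t) \<le> (Lf * \<delta> + \<zeta> + \<eta>) * T * exp ((Lf + 2 * L * r) * T) + \<delta>"
proof -
  let ?A = "{1..n}"
  let ?w = "\<lambda>i t. cell_mean n (U t) i"
  let ?\<phi> = "\<lambda>i t. v i t - ?w i t"
  let ?rhs = "\<lambda>i t. f (v i t) t + (\<Sum>j=1..n. b i j * D (v j t - v i t))"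
  let ?R = "\<lambda>i t. ?rhs i t - cell_mean n (U' t) i"
  let ?C = "Lf + 2 * L * r" and ?e = "sqrt (real n) * (Lf * \<delta> + \<zeta> + \<eta>)"
  have Lf: "0 \<le> Lf" by (rule lipschitz_on_nonneg[OF f(1)])
  have Dc: "continuous_on UNIV D" by (rule lipschitz_on_continuous_on[OF D_lipschitz])
  have Uc: "continuous_on {0..T} U" by (rule H1_deriv_continuous[OF H])
  have vc: "continuous_on {0..T} (v i)" if "i \<in> ?A" for i
    by (rule DERIV_continuous_on[OF v[OF that]])
  have wc: "continuous_on {0..T} (?w i)" for i
    unfolding cell_mean_def by (intro continuous_intros Uc)
  have rc: "continuous_on {0..T} (?rhs i)" if i: "i \<in> ?A" for i
    by (intro continuous_intros continuous_on_superposition[OF f] vc[OF i]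
        continuous_on_compose2[OF Dc] continuous_on_diff vc) auto
  have ri: "integrable (lebesgue_on {0..t}) (?rhs i)"
    and rv: "v i t = v i 0 + (LINT s|lebesgue_on {0..t}. ?rhs i s)"
    if i: "i \<in> ?A" and t: "t \<in> {0..T}" for i t
  proof -
    have sub: "{0..t} \<subseteq> {0..T}" using t by auto
    show int: "integrable (lebesgue_on {0..t}) (?rhs i)"
      by (rule continuous_imp_integrable_real[OF continuous_on_subset[OF rc[OF i] sub]])
    have "(?rhs i has_integral v i t - v i 0) {0..t}"
    proof (rule fundamental_theorem_of_calculus)
      show "0 \<le> t" using t by simp
      fix s assume s: "s \<in> {0..t}"
      then have "(v i has_real_derivative ?rhs i s) (at s within {0..t})"
        using sub by (intro DERIV_subset[OF v[OF i]]) auto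
      then show "(v i has_vector_derivative ?rhs i s) (at s within {0..t})"
        by (simp add: has_real_derivative_iff_has_vector_derivative)
    qed
    then have "(LINT s|lebesgue_on {0..t}. ?rhs i s) = v i t - v i 0"
      using lebesgue_integral_eq_integral[OF int] by (simp add: integral_unique)
    then show "v i t = v i 0 + (LINT s|lebesgue_on {0..t}. ?rhs i s)" by simp
  qed
  have "AE s in lebesgue_on {0..T}. L2_set (\<lambda>i. ?R i s) ?A \<le> ?C * L2_set (\<lambda>i. ?\<phi> i s) ?A + ?e"
    using eq AE_space
  proof eventually_elim
    case (elim s)
    then have s: "s \<in> {0..T}" by simp
    define w where "w i = cell_mean n (U s) i" for i
    \<comment> \<open>\<open>?E1\<close> and \<open>?E3\<close> are Lipschitz in the difference and
      feed Gronwall; \<open>?E2\<close>, \<open>?E4\<close> and \<open>?E5\<close> are the averaging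
      error of f, the noise and the coupling error.\<close>
    let ?E1 = "\<lambda>i. f (v i s) s - f (w i) s"
    let ?E2 = "\<lambda>i. f (w i) s - cell_mean n (superposition f s (U s)) i"
    let ?E3 = "\<lambda>i. \<Sum>j=1..n. b i j * (D (v j s - v i s) - D (w j - w i))"
    let ?E4 = "\<lambda>i. \<Sum>j=1..n. (b i j - q i j) * D (w j - w i)"
    let ?E5 = "\<lambda>i. (\<Sum>j=1..n. q i j * D (w j - w i)) - cell_mean n (coupling W' D (U s)) i"
    have R: "?R i s = ?E1 i + ?E2 i + ?E3 i + ?E4 i + ?E5 i" for i
    proof -
      have "cell_mean n (U' s) i = cell_mean n (coupling W' D (U s)) i + cell_mean n (superposition f s (U s)) i"
        unfolding elim(1) cell_mean_def by (simp add: inner_add_left distrib_left)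
      moreover have "?E3 i + ?E4 i = (\<Sum>j=1..n. b i j * D (v j s - v i s)) - (\<Sum>j=1..n. q i j * D (w j - w i))"
        unfolding sum.distrib[symmetric] sum_subtractf[symmetric]
        by (intro sum.cong refl) (simp add: algebra_simps)
      ultimately show ?thesis by simp
    qed
    have "L2_set (\<lambda>i. ?R i s) ?A \<le> L2_set ?E1 ?A + L2_set ?E2 ?A + L2_set ?E3 ?A + L2_set ?E4 ?A + L2_set ?E5 ?A"
      unfolding R by (intro order_trans[OF L2_set_triangle_ineq] add_right_mono order_refl)
    moreover have "L2_set ?E1 ?A \<le> Lf * L2_set (\<lambda>i. ?\<phi> i s) ?A"
    proof -
      have "L2_set ?E1 ?A \<le> L2_set (\<lambda>i. Lf * \<bar>?\<phi> i s\<bar>) ?A"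
        unfolding w_def using lipschitz_on_UNIV_abs[where \<phi>="\<lambda>v. f v s", OF f(1)]
        by (intro L2_set_mono_abs) auto
      then show ?thesis using Lf by (simp add: L2_set_right_distrib[symmetric] L2_set_abs_cong)
    qed
    moreover have "L2_set ?E2 ?A \<le> sqrt (real n) * (Lf * \<delta>)"
    proof -
      have "L2_set ?E2 ?A \<le> sqrt (real n) * (Lf * norm (step_fun n (cell_mean n (U s)) - U s))"
        unfolding w_def by (rule superposition_consistency[where f=f and t=s, OF f(1) n])
      also have "\<dots> \<le> sqrt (real n) * (Lf * \<delta>)"
        using Lf \<delta>[OF s] by (intro mult_left_mono) auto
      finally show ?thesis .
    qed
    moreover have "L2_set ?E3 ?A \<le> 2 * L * r * L2_set (\<lambda>i. ?\<phi> i s) ?A"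
      using L2_set_coupling_lipschitz[OF D_lipschitz _ b r row col, where u="\<lambda>i. v i s" and w=w]
      by (simp add: w_def)
    moreover have "L2_set ?E4 ?A \<le> sqrt (real n) * \<zeta>"
      unfolding w_def by (rule \<zeta>[OF s])
    moreover have "L2_set ?E5 ?A \<le> sqrt (real n) * \<eta>"
      unfolding w_def by (rule \<eta>[OF s])
    moreover have "?C * L2_set (\<lambda>i. ?\<phi> i s) ?A + ?e
      = Lf * L2_set (\<lambda>i. ?\<phi> i s) ?A + sqrt (real n) * (Lf * \<delta>) + 2 * L * r * L2_set (\<lambda>i. ?\<phi> i s) ?A
        + sqrt (real n) * \<zeta> + sqrt (real n) * \<eta>"
      by (simp only: distrib_left distrib_right)
    ultimately show ?case by linarith
  qed
  then have "L2_set (\<lambda>i. ?\<phi> i t) ?A \<le> ?e * T * exp (?C * T)"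
  proof (rule L2_set_gronwall[rotated -2, OF _ t])
    show "0 \<le> ?C" using Lf L_nonneg r by simp
    show "0 \<le> ?e" using Lf nonneg by simp
    show "continuous_on {0..T} (?\<phi> i)" if "i \<in> ?A" for i
      by (intro continuous_intros vc[OF that] wc)
    fix i t assume i: "i \<in> ?A" and t: "t \<in> {0..T}"
    show "integrable (lebesgue_on {0..t}) (?R i)"
      by (intro Bochner_Integration.integrable_diff ri[OF i t] H1_deriv_cell_mean(1)[OF H t])
    show "?\<phi> i t = (LINT s|lebesgue_on {0..t}. ?R i s)"
      using rv[OF i t] H1_deriv_cell_mean(2)[OF H t, of n i] v0[OF i]
      by (subst Bochner_Integration.integral_diff[OF ri[OF i t] H1_deriv_cell_mean(1)[OF H t]]) linarith
  qed
  then have "norm (step_fun n (\<lambda>i. ?\<phi> i t)) \<le> (?e * T * exp (?C * T)) / sqrt (real n)"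
    using n by (simp only: norm_step_fun) (intro divide_right_mono, auto)
  also have "\<dots> = (Lf * \<delta> + \<zeta> + \<eta>) * T * exp (?C * T)"
    using n by simp
  finally have "norm (step_fun n (\<lambda>i. v i t) - step_fun n (cell_mean n (U t))) \<le> (Lf * \<delta> + \<zeta> + \<eta>) * T * exp (?C * T)"
    by (simp add: step_fun_diff)
  then show ?thesis
    using \<delta>[OF t] norm_triangle_ineq[of "step_fun n (\<lambda>i. v i t) - step_fun n (cell_mean n (U t))"
        "step_fun n (cell_mean n (U t)) - U t"] by simp
qed

end

section \<open>The limit\<close>

text \<open>The supremum is at least its entry at time 0 only because the set of norms is bounded,
  so nonnegativity too rests on the hypothesis \<open>le\<close>.\<close>

lemma abs_C_norm_le:
  assumes T: "0 \<le> T" and le: "\<And>t. t \<in> {0..T} \<Longrightarrow> norm (w t) \<le> e"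
  shows "\<bar>C_norm T w\<bar> \<le> e"
proof -
  have "C_norm T w \<le> e"
    unfolding C_norm_def using T le by (intro cSUP_least) auto
  moreover have "0 \<le> C_norm T w"
    unfolding C_norm_def
  proof (rule cSUP_upper2[of _ _ 0])
    show "bdd_above ((\<lambda>t. norm (w t)) ` {0..T})"
      by (rule bdd_aboveI2[of _ _ e]) (rule le)
  qed (use T in auto)
  ultimately show ?thesis by simp
qed

context coupling_kernel
begin

text \<open>Everything random is fixed here: what remains of the graphs is the bound on their sums
  and the vanishing noise at each state in \<open>E\<close>.\<close>

lemma system_limit:
  fixes b :: "nat \<Rightarrow> nat \<Rightarrow> nat \<Rightarrow> real" and c :: "nat \<Rightarrow> real"
  defines "q \<equiv> \<lambda>n i j. cell_avg n (\<lambda>z. min (c n) (W z)) i j / real n"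
  assumes r: "0 \<le> r" and T: "0 \<le> T"
    and b: "\<And>n i j. 0 \<le> b n i j"
    and c: "\<And>n. 0 \<le> c n" "filterlim c at_top sequentially"
    and b_sums: "\<forall>\<^sub>F n in sequentially. \<forall>i\<in>{1..n}. (\<Sum>j=1..n. b n i j) \<le> r \<and> (\<Sum>j=1..n. b n j i) \<le> r"
    and q_sums: "\<And>n i. i \<in> {1..n} \<Longrightarrow> (\<Sum>j=1..n. q n i j) \<le> r \<and> (\<Sum>j=1..n. q n j i) \<le> r"
    and dense: "\<And>V e. e > 0 \<Longrightarrow> \<exists>d\<in>E. dist d V < e"
    and noise: "\<And>V. V \<in> E \<Longrightarrow> (\<lambda>n. L2_set (\<lambda>i. \<Sum>j=1..n. (b n i j - q n i j) *
        D (cell_mean n V j - cell_mean n V i)) {1..n} / sqrt (real n)) \<longlonglongrightarrow> 0"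
    and f: "\<And>t. Lf-lipschitz_on UNIV (\<lambda>v. f v t)" "\<And>v. continuous_on UNIV (\<lambda>t. f v t)"
    and W': "AE x in lebI. AE y in lebI. W' (x, y) = W (x, y)"
    and H: "H1_deriv T U U'"
    and eq: "AE t in lebesgue_on {0..T}. U' t = coupling W' D (U t) + superposition f t (U t)"
    and v0: "\<And>n i. i \<in> {1..n} \<Longrightarrow> v n i 0 = cell_mean n (U 0) i"
    and v: "\<And>n i t. i \<in> {1..n} \<Longrightarrow> t \<in> {0..T} \<Longrightarrow> (v n i has_real_derivative
        f (v n i t) t + (\<Sum>j=1..n. b n i j * D (v n j t - v n i t))) (at t within {0..T})"
  shows "(\<lambda>n. C_norm T (\<lambda>t. step_fun n (\<lambda>i. v n i t) - U t)) \<longlonglongrightarrow> 0"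
proof (rule LIMSEQ_I)
  fix e :: real assume e: "e > 0"
  have Lf: "0 \<le> Lf" by (rule lipschitz_on_nonneg[OF f(1)])
  \<comment> \<open>If the three errors are all at most k, the total error is at most m k; the
    choice of k makes this e / 2.\<close>
  define m where "m = (Lf + 2) * T * exp ((Lf + 2 * L * r) * T) + 1"
  have m: "m > 0" unfolding m_def using Lf T by (intro add_nonneg_pos mult_nonneg_nonneg) auto
  define k where "k = e / (2 * m)"
  have k: "k > 0" using e m by (simp add: k_def)
  obtain d c0 where d: "d > 0"
    and cons: "\<forall>n\<ge>1. \<forall>c\<ge>c0. \<forall>V. norm (step_fun n (cell_mean n V) - V) \<le> d \<longrightarrow>
      L2_set (\<lambda>i. (\<Sum>j=1..n. cell_avg n (\<lambda>z. min c (W z)) i j * D (cell_mean n V j - cell_mean n V i)) / real n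
      - cell_mean n (coupling W' D V) i) {1..n} \<le> sqrt (real n) * k"
    using coupling_consistency[OF k W'] by (elim exE conjE) (rule that)
  have S: "compact (U ` {0..T})"
    by (intro compact_continuous_image H1_deriv_continuous[OF H]) simp
  have "\<forall>\<^sub>F n in sequentially. \<forall>V\<in>U ` {0..T}. \<bar>norm (step_fun n (cell_mean n V) - V)\<bar> \<le> min k d"
  \<comment> \<open>Projection errors vanish at every state, so the dense set is everything; P and
    the identity are both contractive, whence the constant 2. The bound d is what
    \<open>cons\<close> demands.\<close>
  proof (rule equi_lipschitz_tendsto_compact[OF S, of UNIV _ 2])
    show "\<exists>V'\<in>UNIV. dist V' V < e'" if "e' > 0" for V :: L2 and e'
      using that by (intro bexI[of _ V]) auto
    show "\<forall>\<^sub>F n in sequentially. \<forall>V V'. \<bar>norm (step_fun n (cell_mean n V) - V)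
        - norm (step_fun n (cell_mean n V') - V')\<bar> \<le> 2 * dist V V'"
      using eventually_ge_at_top[of 1]
    proof eventually_elim
      case (elim n)
      show ?case
      proof (intro allI)
        fix V V'
        let ?P = "\<lambda>V. step_fun n (cell_mean n V)"
        have "\<bar>norm (?P V - V) - norm (?P V' - V')\<bar> \<le> norm ((?P V - V) - (?P V' - V'))"
          by (rule norm_triangle_ineq3)
        also have "(?P V - V) - (?P V' - V') = (?P V - ?P V') - (V - V')" by simp
        also have "norm \<dots> \<le> norm (?P V - ?P V') + norm (V - V')" by (rule norm_triangle_ineq4)
        also have "\<dots> \<le> 2 * dist V V'"
          using norm_step_fun_cell_mean_diff_le[OF elim, of V V'] by (simp add: dist_norm)
        finally show "\<bar>norm (?P V - V) - norm (?P V' - V')\<bar> \<le> 2 * dist V V'" .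
      qed
    qed
  qed (use k d step_fun_cell_mean_tendsto in auto)
  moreover have "\<forall>\<^sub>F n in sequentially. \<forall>V\<in>U ` {0..T}. \<bar>L2_set (\<lambda>i. \<Sum>j=1..n. (b n i j - q n i j) *
        D (cell_mean n V j - cell_mean n V i)) {1..n} / sqrt (real n)\<bar> \<le> k"
  \<comment> \<open>The realised and the expected weights contribute 2 L r each.\<close>
  proof (rule equi_lipschitz_tendsto_compact[OF S dense noise, of _ "4 * L * r"])
    show "\<forall>\<^sub>F n in sequentially. \<forall>V V'. \<bar>L2_set (\<lambda>i. \<Sum>j=1..n. (b n i j - q n i j) *
        D (cell_mean n V j - cell_mean n V i)) {1..n} / sqrt (real n) - L2_set (\<lambda>i. \<Sum>j=1..n. (b n i j - q n i j) *
        D (cell_mean n V' j - cell_mean n V' i)) {1..n} / sqrt (real n)\<bar> \<le> 4 * L * r * dist V V'"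
      using b_sums eventually_ge_at_top[of 1]
    proof eventually_elim
      case (elim n)
      show ?case
      proof (intro allI)
        fix V V'
        let ?w = "cell_mean n V" and ?w' = "cell_mean n V'"
        let ?Z = "\<lambda>w i. \<Sum>j=1..n. (b n i j - q n i j) * D (w j - w i)"
        let ?X = "\<lambda>b i. \<Sum>j=1..n. b n i j * (D (?w j - ?w i) - D (?w' j - ?w' i))"
        have qnn: "0 \<le> q n i j" if "i \<in> {1..n}" "j \<in> {1..n}" for i j
          unfolding q_def using cell_avg_min(1)[OF c(1) that] by simp
        have "L2_set (\<lambda>i. ?Z ?w i - ?Z ?w' i) {1..n} = L2_set (\<lambda>i. ?X b i - ?X q i) {1..n}"
          unfolding sum_subtractf[symmetric]
          by (intro L2_set_cong refl sum.cong) (simp add: algebra_simps)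
        also have "\<dots> \<le> L2_set (?X b) {1..n} + L2_set (?X q) {1..n}"
          by (rule L2_set_triangle_diff)
        also have "\<dots> \<le> 2 * L * r * L2_set (\<lambda>i. ?w i - ?w' i) {1..n} + 2 * L * r * L2_set (\<lambda>i. ?w i - ?w' i) {1..n}"
          using elim(1) q_sums b qnn
          by (intro add_mono L2_set_coupling_lipschitz[OF D_lipschitz _ _ r]) auto
        also have "\<dots> = 4 * L * r * L2_set (cell_mean n (V - V')) {1..n}"
          by (simp add: cell_mean_diff[abs_def])
        also have "\<dots> \<le> 4 * L * r * (sqrt (real n) * norm (V - V'))"
          using L_nonneg r elim(2) by (intro mult_left_mono L2_set_cell_mean_le) auto
        finally have le: "L2_set (\<lambda>i. ?Z ?w i - ?Z ?w' i) {1..n} \<le> 4 * L * r * dist V V' * sqrt (real n)"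
          by (simp add: dist_norm mult_ac)
        have "\<bar>L2_set (?Z ?w) {1..n} / sqrt (real n) - L2_set (?Z ?w') {1..n} / sqrt (real n)\<bar>
          = \<bar>L2_set (?Z ?w) {1..n} - L2_set (?Z ?w') {1..n}\<bar> / sqrt (real n)"
          by (simp add: diff_divide_distrib[symmetric])
        also have "\<dots> \<le> (4 * L * r * dist V V' * sqrt (real n)) / sqrt (real n)"
          using order_trans[OF L2_set_diff_abs_le le] by (intro divide_right_mono) auto
        also have "\<dots> = 4 * L * r * dist V V'"
          using elim(2) by simp
        finally show "\<bar>L2_set (?Z ?w) {1..n} / sqrt (real n) - L2_set (?Z ?w') {1..n} / sqrt (real n)\<bar>
          \<le> 4 * L * r * dist V V'" .
      qed
    qed
  qed (use L_nonneg r k in auto)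
  moreover have "\<forall>\<^sub>F n in sequentially. c0 \<le> c n"
    using c(2) by (simp add: filterlim_at_top)
  ultimately have "\<forall>\<^sub>F n in sequentially. norm (C_norm T (\<lambda>t. step_fun n (\<lambda>i. v n i t) - U t) - 0) < e"
    using b_sums eventually_ge_at_top[of 1]
  proof eventually_elim
    case (elim n)
    have n: "n \<ge> 1" by (rule elim(5))
    have \<delta>: "norm (step_fun n (cell_mean n (U t)) - U t) \<le> k" "norm (step_fun n (cell_mean n (U t)) - U t) \<le> d"
      if "t \<in> {0..T}" for t
      using elim(1) that by auto
    have bound: "norm (step_fun n (\<lambda>i. v n i t) - U t) \<le> (Lf * k + k + k) * T * exp ((Lf + 2 * L * r) * T) + k"
      if t: "t \<in> {0..T}" for t
    proof (rule finite_system_error[OF n, where b="b n" and q="q n" and v="v n"])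
      show "L2_set (\<lambda>i. \<Sum>j=1..n. (b n i j - q n i j) *
        D (cell_mean n (U t) j - cell_mean n (U t) i)) {1..n} \<le> sqrt (real n) * k" if "t \<in> {0..T}" for t
        using elim(2)[rule_format, of "U t"] that n by (simp add: field_simps)
      show "L2_set (\<lambda>i. (\<Sum>j=1..n. q n i j * D (cell_mean n (U t) j - cell_mean n (U t) i))
        - cell_mean n (coupling W' D (U t)) i) {1..n} \<le> sqrt (real n) * k" if "t \<in> {0..T}" for t
        using cons[rule_format, OF n elim(3) \<delta>(2)[OF that]] by (simp add: q_def sum_divide_distrib)
    qed (use b r elim(4) f H eq v0 v \<delta>(1) k t in auto)
    have mk: "(Lf * k + k + k) * T * exp ((Lf + 2 * L * r) * T) + k = e / 2"
    proof -
      have "(Lf * k + k + k) * T * exp ((Lf + 2 * L * r) * T) + k = m * k"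
        by (simp add: m_def algebra_simps)
      then show ?thesis using m by (simp add: k_def)
    qed
    have "\<bar>C_norm T (\<lambda>t. step_fun n (\<lambda>i. v n i t) - U t)\<bar> \<le> e / 2"
      by (rule abs_C_norm_le[OF T bound[unfolded mk]])
    then show ?case using e by simp
  qed
  then show "\<exists>N. \<forall>n\<ge>N. norm (C_norm T (\<lambda>t. step_fun n (\<lambda>i. v n i t) - U t) - 0) < e"
    by (simp add: eventually_sequentially)
qed

end

theorem theorem3p1:
  fixes W :: "real \<times> real \<Rightarrow> real" and D :: "real \<Rightarrow> real" and f :: "real \<Rightarrow> real \<Rightarrow> real"
    and g :: "real \<Rightarrow> real" and \<gamma> :: real and \<alpha> :: "nat \<Rightarrow> real"
    and M :: "'w measure" and a :: "nat \<Rightarrow> nat \<Rightarrow> nat \<Rightarrow> 'w \<Rightarrow> bool"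
    and u :: "nat \<Rightarrow> 'w \<Rightarrow> nat \<Rightarrow> real \<Rightarrow> real" and U :: "real \<Rightarrow> L2" and T :: real
  assumes D_periodic: "\<And>x. D (x + 2 * pi) = D x"
    and D_lipschitz: "\<exists>L. L-lipschitz_on UNIV D"
    and D_max: "\<And>x. \<bar>D x\<bar> \<le> 1" "\<exists>x. \<bar>D x\<bar> = 1"
    and f_lipschitz: "\<exists>L. \<forall>t. L-lipschitz_on UNIV (\<lambda>v. f v t)"
    and f_continuous: "\<And>v. continuous_on UNIV (\<lambda>t. f v t)"
    and W_L2: "sq_integrable (lebesgue_on ({0..1} \<times> {0..1})) W"
    and W_nonneg: "AE z in lebesgue_on ({0..1} \<times> {0..1}). 0 \<le> W z"
    and W1: "cond_W1 W" and W2: "cond_W2 W"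
    and g_L2: "sq_integrable lebI g"
    and \<gamma>: "0 < \<gamma>" "\<gamma> < 1 / 2"
    and \<alpha>: "\<And>n. n \<ge> 1 \<Longrightarrow> \<alpha> n = real n powr (- \<gamma>)"
    and M: "prob_space M"
    and graph: "\<And>n. n \<ge> 1 \<Longrightarrow> random_digraph M n W (\<alpha> n) (a n)"
    and T: "0 < T"
    and u: "\<And>n \<omega>. n \<ge> 1 \<Longrightarrow> \<omega> \<in> space M \<Longrightarrow>
      kuramoto_solution D f g n (\<alpha> n) (\<lambda>i j. a n i j \<omega>) T (u n \<omega>)"
    and U: "weak_solution W D f g T U"
  shows "AE \<omega> in M. (\<lambda>n. C_norm T (\<lambda>t. step_fun n (\<lambda>i. u n \<omega> i t) - U t)) \<longlonglongrightarrow> 0"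
proof -
  interpret prob_space M by (rule M)
  obtain L where L: "L-lipschitz_on UNIV D" using D_lipschitz ..
  obtain Lf where Lf: "\<And>t. Lf-lipschitz_on UNIV (\<lambda>v. f v t)" using f_lipschitz by blast
  obtain W' where W': "W' \<in> borel_measurable borel" "\<And>z. 0 \<le> W' z" "integrable lebII (\<lambda>z. (W' z)\<^sup>2)"
    and W'_ae: "AE z in lebesgue_on ({0..1} \<times> {0..1}). W z = W' z"
    and W'_ae2: "AE x in lebI. AE y in lebI. W (x, y) = W' (x, y)"
    by (rule kernel_borel_version[OF W_L2 W_nonneg]) blast
  \<comment> \<open>Names are exchanged: the Borel version \<open>W'\<close> is the \<open>W\<close>
    of the locale, and the given kernel is its \<open>W'\<close>.\<close>
  interpret K: coupling_kernel W' D L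
    by unfold_locales (use W' L D_max(1) in auto)
  have W_meas: "W \<in> borel_measurable (lebesgue_on ({0..1} \<times> {0..1}))"
    using W_L2 by (rule sq_integrable_measurable)
  have avg: "cell_avg n W i j = cell_avg n W' i j" if "i \<in> {1..n}" "j \<in> {1..n}" for n i j
    using cell_avg_cong[OF W_meas W'(1) W'_ae that] K.cell_avg_eq[OF W'(1) that] by simp
  have avg_min: "cell_avg n (\<lambda>z. min c (W z)) i j = cell_avg n (\<lambda>z. min c (W' z)) i j"
    if "i \<in> {1..n}" "j \<in> {1..n}" for n i j c
  proof -
    have m': "(\<lambda>z. min c (W' z)) \<in> borel_measurable borel" using W'(1) by simp
    have ae: "AE z in lebesgue_on ({0..1} \<times> {0..1}). min c (W z) = min c (W' z)"
      using W'_ae by eventually_elim simp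
    have "(\<lambda>z. min c (W z)) \<in> borel_measurable (lebesgue_on ({0..1} \<times> {0..1}))"
      using W_meas by simp
    from cell_avg_cong[OF this m' ae that] K.cell_avg_eq[OF m' that] show ?thesis by simp
  qed
  obtain B where B: "0 \<le> B" "\<And>n i. i \<in> {1..n} \<Longrightarrow> (\<Sum>j=1..n. cell_avg n W i j) / real n \<le> B"
    "\<And>n i. i \<in> {1..n} \<Longrightarrow> (\<Sum>j=1..n. cell_avg n W j i) / real n \<le> B"
    by (rule cond_W_sums_bounded[OF W1 W2]) blast
  \<comment> \<open>c n = 1/alpha_n is the truncation level, s n = n alpha_n the normalisation, p
    the edge probability and q = p / s the expected weight.\<close>
  define c where "c n = real n powr \<gamma>" for n
  define q where "q n i j = cell_avg n (\<lambda>z. min (c n) (W' z)) i j / real n" for n i j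
  define p where "p n i j = real n powr (- \<gamma>) * cell_avg n (\<lambda>z. min (c n) (W' z)) i j" for n i j
  define s where "s n = real n * real n powr (- \<gamma>)" for n
  have c_nonneg: "0 \<le> c n" for n by (simp add: c_def)
  have c_lim: "filterlim c at_top sequentially"
    unfolding c_def using \<gamma>(1) by real_asymp
  have s_pos: "0 < s n" if "n \<ge> 1" for n
    using that by (simp add: s_def)
  have pq: "p n i j = s n * q n i j" if "n \<ge> 1" for n i j
    using that by (simp add: p_def q_def s_def)
  have inv: "inverse (real n powr (- \<gamma>)) = c n" for n
    by (simp add: c_def powr_minus)
  have q_sums: "(\<Sum>j=1..n. q n i j) \<le> B \<and> (\<Sum>j=1..n. q n j i) \<le> B" if i: "i \<in> {1..n}" for n i
  proof
    have "(\<Sum>j=1..n. q n i j) \<le> (\<Sum>j=1..n. cell_avg n W i j) / real n"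
      unfolding q_def sum_divide_distrib using i
      by (intro sum_mono divide_right_mono) (auto simp: avg intro: K.cell_avg_min(2)[OF c_nonneg])
    then show "(\<Sum>j=1..n. q n i j) \<le> B" using B(2)[OF i] by linarith
    have "(\<Sum>j=1..n. q n j i) \<le> (\<Sum>j=1..n. cell_avg n W j i) / real n"
      unfolding q_def sum_divide_distrib using i
      by (intro sum_mono divide_right_mono) (auto simp: avg intro: K.cell_avg_min(2)[OF c_nonneg])
    then show "(\<Sum>j=1..n. q n j i) \<le> B" using B(3)[OF i] by linarith
  qed
  have indep: "indep_vars (\<lambda>_. count_space UNIV) (\<lambda>(i, j). a n i j) ({1..n} \<times> {1..n})"
    and edge_prob: "\<And>i j. i \<in> {1..n} \<Longrightarrow> j \<in> {1..n} \<Longrightarrow> prob {\<omega> \<in> space M. a n i j \<omega>} = p n i j"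
    if "n \<ge> 1" for n
    using graph[OF that] that by (auto simp: random_digraph_def p_def inv avg_min \<alpha>)
  have indep_row: "indep_vars (\<lambda>_. count_space UNIV) (a n i) {1..n}" if "n \<ge> 1" "i \<in> {1..n}" for n i
  proof -
    have "inj_on (\<lambda>j. (i, j)) {1..n}" "(\<lambda>j. (i, j)) ` {1..n} \<subseteq> {1..n} \<times> {1..n}"
      using that(2) by (auto simp: inj_on_def)
    from indep_vars_inj_reindex[OF indep[OF that(1)] this] show ?thesis by simp
  qed
  have indep_col: "indep_vars (\<lambda>_. count_space UNIV) (\<lambda>j. a n j i) {1..n}" if "n \<ge> 1" "i \<in> {1..n}" for n i
  proof -
    have "inj_on (\<lambda>j. (j, i)) {1..n}" "(\<lambda>j. (j, i)) ` {1..n} \<subseteq> {1..n} \<times> {1..n}"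
      using that(2) by (auto simp: inj_on_def)
    from indep_vars_inj_reindex[OF indep[OF that(1)] this] show ?thesis by simp
  qed
  obtain E :: "L2 set" where E: "countable E" "\<And>X. open X \<Longrightarrow> X \<noteq> {} \<Longrightarrow> \<exists>d\<in>E. d \<in> X"
    by (rule countable_dense_setE) blast
  have dense: "\<exists>d\<in>E. dist d V < e" if "e > 0" for V e
    using E(2)[of "ball V e"] that by (auto simp: dist_commute)
  \<comment> \<open>Unit weights and deviation 1: a realised row sum exceeds the expected one by
    less than 1, which is where B + 1 comes from.\<close>
  have rows: "AE \<omega> in M. \<forall>\<^sub>F n in sequentially. \<forall>i\<in>{1..n}.
      \<bar>\<Sum>j=1..n. (of_bool (a n i j \<omega>) - p n i j) * 1\<bar> < 1 * (real n * real n powr (- \<gamma>))"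
    by (rule weighted_row_sums_concentrate[OF \<gamma>(2) indep_row edge_prob]) auto
  have cols: "AE \<omega> in M. \<forall>\<^sub>F n in sequentially. \<forall>i\<in>{1..n}.
      \<bar>\<Sum>j=1..n. (of_bool (a n j i \<omega>) - p n j i) * 1\<bar> < 1 * (real n * real n powr (- \<gamma>))"
    by (rule weighted_row_sums_concentrate[OF \<gamma>(2), where a="\<lambda>n i j. a n j i" and p="\<lambda>n i j. p n j i",
          OF indep_col edge_prob]) auto
  have "AE \<omega> in M. \<forall>\<^sub>F n in sequentially. \<forall>i\<in>{1..n}.
      \<bar>\<Sum>j=1..n. (of_bool (a n i j \<omega>) - p n i j) * D (cell_mean n V j - cell_mean n V i)\<bar>
        < 1 / real (Suc k) * (real n * real n powr (- \<gamma>))" for V k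
    using D_max(1)
    by (intro weighted_row_sums_concentrate[OF \<gamma>(2) indep_row edge_prob]) auto
  \<comment> \<open>Countably many states and countably many levels 1/(k + 1), so a single null set
    serves all of them.\<close>
  then have noise: "AE \<omega> in M. \<forall>V\<in>E. \<forall>k. \<forall>\<^sub>F n in sequentially. \<forall>i\<in>{1..n}.
      \<bar>\<Sum>j=1..n. (of_bool (a n i j \<omega>) - p n i j) * D (cell_mean n V j - cell_mean n V i)\<bar>
        < 1 / real (Suc k) * (real n * real n powr (- \<gamma>))"
    using E(1) by (simp add: AE_ball_countable AE_all_countable)
  obtain U' where H: "H1_deriv T U U'"
    and weak: "AE t in lebesgue_on {0..T}. \<forall>v. (U' t - coupling W D (U t) - superposition f t (U t)) \<bullet> v = 0"
    and U0: "U 0 = abs_L2 g"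
    using U unfolding weak_solution_def by blast
  \<comment> \<open>All test functions are quantified inside the almost-everywhere statement, so the
    residual may be tested against itself.\<close>
  have eq: "AE t in lebesgue_on {0..T}. U' t = coupling W D (U t) + superposition f t (U t)"
    using weak
  proof eventually_elim
    case (elim t)
    then have "U' t - coupling W D (U t) - superposition f t (U t) = 0"
      by (metis inner_eq_zero_iff)
    then show ?case by (simp add: algebra_simps)
  qed
  show ?thesis
    using rows cols noise AE_space
  proof eventually_elim
    case (elim \<omega>)
    define b where "b n i j = of_bool (a n i j \<omega>) / s n" for n i j
    \<comment> \<open>The index maps \<open>k\<close> and \<open>l\<close> let one identity serve
      both rows and columns.\<close>
    have bq: "(\<Sum>j\<in>J. (b n (k j) (l j) - q n (k j) (l j)) * d j)
        = (\<Sum>j\<in>J. (of_bool (a n (k j) (l j) \<omega>) - p n (k j) (l j)) * d j) / s n"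
      if "n \<ge> 1" for n J and k l :: "nat \<Rightarrow> nat" and d :: "nat \<Rightarrow> real"
      unfolding sum_divide_distrib using s_pos[OF that]
      by (intro sum.cong refl) (simp add: b_def pq[OF that] field_simps)
    show ?case
    proof (rule K.system_limit[where b=b and c=c and r="B + 1" and E=E and U'=U' and W'=W])
      show "\<forall>\<^sub>F n in sequentially. \<forall>i\<in>{1..n}. (\<Sum>j=1..n. b n i j) \<le> B + 1 \<and> (\<Sum>j=1..n. b n j i) \<le> B + 1"
        using elim(1,2) eventually_ge_at_top[of 1]
      proof eventually_elim
        case (elim n)
        have sn: "s n > 0" by (rule s_pos[OF elim(3)])
        show ?case
        proof (intro ballI conjI)
          fix i assume i: "i \<in> {1..n}"
          have "(\<Sum>j=1..n. (of_bool (a n i j \<omega>) - p n i j) * 1) / s n \<le> 1"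
            using elim(1)[rule_format, OF i] sn by (simp add: s_def[symmetric])
          then have "(\<Sum>j=1..n. b n i j) - (\<Sum>j=1..n. q n i j) \<le> 1"
            using bq[OF elim(3), of "\<lambda>_. i" "\<lambda>j. j" "\<lambda>_. 1" "{1..n}"] by (simp add: sum_subtractf)
          then show "(\<Sum>j=1..n. b n i j) \<le> B + 1" using q_sums[OF i] by linarith
          have "(\<Sum>j=1..n. (of_bool (a n j i \<omega>) - p n j i) * 1) / s n \<le> 1"
            using elim(2)[rule_format, OF i] sn by (simp add: s_def[symmetric])
          then have "(\<Sum>j=1..n. b n j i) - (\<Sum>j=1..n. q n j i) \<le> 1"
            using bq[OF elim(3), of "\<lambda>j. j" "\<lambda>_. i" "\<lambda>_. 1" "{1..n}"] by (simp add: sum_subtractf)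
          then show "(\<Sum>j=1..n. b n j i) \<le> B + 1" using q_sums[OF i] by linarith
        qed
      qed
      show "(\<Sum>j=1..n. cell_avg n (\<lambda>z. min (c n) (W' z)) i j / real n) \<le> B + 1 \<and>
          (\<Sum>j=1..n. cell_avg n (\<lambda>z. min (c n) (W' z)) j i / real n) \<le> B + 1" if "i \<in> {1..n}" for n i
        using q_sums[OF that] by (simp add: q_def)
      show "(\<lambda>n. L2_set (\<lambda>i. \<Sum>j=1..n. (b n i j - cell_avg n (\<lambda>z. min (c n) (W' z)) i j / real n) *
        D (cell_mean n V j - cell_mean n V i)) {1..n} / sqrt (real n)) \<longlonglongrightarrow> 0" if V: "V \<in> E" for V
      proof (rule LIMSEQ_I)
        fix e :: real assume "e > 0"
        then obtain k where k: "1 / real (Suc k) < e" using nat_approx_posE by blast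
        have "\<forall>\<^sub>F n in sequentially. norm (L2_set (\<lambda>i. \<Sum>j=1..n. (b n i j - q n i j) *
          D (cell_mean n V j - cell_mean n V i)) {1..n} / sqrt (real n) - 0) < e"
          using elim(3)[rule_format, OF V, of k] eventually_ge_at_top[of 1]
        proof eventually_elim
          case (elim n)
          have sn: "s n > 0" by (rule s_pos[OF elim(2)])
          let ?Z = "\<lambda>i. \<Sum>j=1..n. (b n i j - q n i j) * D (cell_mean n V j - cell_mean n V i)"
          have "\<bar>?Z i\<bar> \<le> 1 / real (Suc k)" if i: "i \<in> {1..n}" for i
          proof -
            have "\<bar>?Z i\<bar> = \<bar>\<Sum>j=1..n. (of_bool (a n i j \<omega>) - p n i j) * D (cell_mean n V j - cell_mean n V i)\<bar> / s n"
              using bq[OF elim(2), of "\<lambda>_. i" "\<lambda>j. j" "\<lambda>j. D (cell_mean n V j - cell_mean n V i)" "{1..n}"] sn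
              by simp
            also have "\<dots> \<le> (1 / real (Suc k) * s n) / s n"
              using elim(1)[rule_format, OF i] sn by (intro divide_right_mono) (auto simp: s_def)
            finally show ?thesis using sn by simp
          qed
          \<comment> \<open>A bound uniform in the rows is enough: a constant vector has Euclidean
            norm sqrt n times the constant, and the normalisation removes sqrt n.\<close>
          then have "L2_set ?Z {1..n} \<le> L2_set (\<lambda>i. 1 / real (Suc k)) {1..n}"
            by (rule L2_set_mono_abs)
          also have "\<dots> = sqrt (real n) * (1 / real (Suc k))"
            by (simp add: L2_set_constant)
          finally have "L2_set ?Z {1..n} / sqrt (real n) \<le> 1 / real (Suc k)"
            using elim(2) by (simp add: field_simps)
          then show ?case using k by simp
        qed
        then show "\<exists>N. \<forall>n\<ge>N. norm (L2_set (\<lambda>i. \<Sum>j=1..n. (b n i j - cell_avg n (\<lambda>z. min (c n) (W' z)) i j / real n) *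
          D (cell_mean n V j - cell_mean n V i)) {1..n} / sqrt (real n) - 0) < e"
          unfolding q_def eventually_sequentially .
      qed
      show "u n \<omega> i 0 = cell_mean n (U 0) i" if i: "i \<in> {1..n}" for n i
        using u[of n \<omega>] i elim(4) cell_mean_initial[OF g_L2 i] by (auto simp: kuramoto_solution_def U0)
      show "(u n \<omega> i has_real_derivative f (u n \<omega> i t) t + (\<Sum>j=1..n. b n i j * D (u n \<omega> j t - u n \<omega> i t)))
        (at t within {0..T})" if i: "i \<in> {1..n}" and t: "t \<in> {0..T}" for n i t
      proof -
        have n: "n \<ge> 1" using i by auto
        have "(u n \<omega> i has_real_derivative f (u n \<omega> i t) t
          + 1 / (real n * \<alpha> n) * (\<Sum>j=1..n. of_bool (a n i j \<omega>) * D (u n \<omega> j t - u n \<omega> i t))) (at t within {0..T})"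
          using u[OF n elim(4)] i t unfolding kuramoto_solution_def by blast
        moreover have "1 / (real n * \<alpha> n) * (\<Sum>j=1..n. of_bool (a n i j \<omega>) * D (u n \<omega> j t - u n \<omega> i t))
          = (\<Sum>j=1..n. b n i j * D (u n \<omega> j t - u n \<omega> i t))"
          unfolding sum_distrib_left by (intro sum.cong refl) (simp add: b_def s_def \<alpha>[OF n])
        ultimately show ?thesis by (simp only:)
      qed
    qed (use B(1) T c_nonneg c_lim dense Lf f_continuous W'_ae2 H eq s_def in \<open>auto simp: b_def s_def\<close>)
  qed
qed

end
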